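(* Let $\mathcal G\rightrightarrows\mathcal M$ be a Lie supergroupoid and let $\psi$ be a multiplicative vector field on $\mathcal G$, with induced vector fields $\psi^{(q)}$ on $\mathcal G^{(q)}$ for $q\ge 0$. Then the action of $\psi$ on groupoid cochains commutes with the coboundary operator: for every $q\geq 1$, $$\psi^{(q)}\circ\delta^q=\delta^q\circ\psi^{(q-1)}$$ as maps $C^\infty(\mathcal G^{(q-1)})\to C^\infty(\mathcal G^{(q)})$.
   Context: All gradings are $\mathbb Z$-gradings. For a sequence $\{p_i\}_{i\in\mathbb Z}$ of nonnegative integers, $\mathcal O^{\{p_i\}}$ is the sheaf of graded-commutative algebras on $\mathbb R^{p_0}$ given by $\mathcal O^{\{p_i\}}(U)=C^\infty(U)[\bigcup_{i\ne0}\{\xi_i^1,\dots,\xi_i^{p_i}\}]$ with $\xi_i^k$ of degree $-i$. A supermanifold $\mathcal M$ of dimension $\{p_i\}$ is a topological space $M$ (the support) with a sheaf $C^\infty(\mathcal M)$ of graded algebras locally isomorphic to $(U,\mathcal O^{\{p_i\}}|_U)$, $U\subseteq\mathbb R^{p_0}$ open. Let $\mathrm{ev}:C^\infty(\mathcal M)\to C^\infty(M)$ be the quotient by the ideal generated by elements of nonzero degree. A morphism $\mu:\mathcal M\to\mathcal N$ is a smooth map $\mu_0:M\to N$ with a morphism of sheaves of graded algebras $\mu^*:C^\infty(\mathcal N)\to C^\infty(\mathcal M)$ over $\mu_0$ such that $\mathrm{ev}\circ\mu^*=\mu_0^*\circ\mathrm{ev}$. A vector field of degree $j$ is a degree $j$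 derivation $\phi$ of $C^\infty(\mathcal M)$: $\phi(fg)=\phi(f)g+(-1)^{j|f|}f\phi(g)$. Vector fields $\phi$ on $\mathcal M$ and $\psi$ on $\mathcal N$ are $\mu$-related if $\mu^*(\psi f)=\phi(\mu^*f)$ for all $f$. A Lie supergroupoid $\mathcal G\rightrightarrows\mathcal M$ is a groupoid object in supermanifolds: surjective submersions $s,t:\mathcal G\to\mathcal M$ (a submersion is a morphism locally isomorphic to a canonical projection $\mathbb R^{\{p_i\}}\times\mathbb R^{\{q_i\}}\to\mathbb R^{\{p_i\}}$), multiplication $m:\mathcal G^{(2)}\to\mathcal G$, identity $e:\mathcal M\to\mathcal G$ and inverse $i:\mathcal G\to\mathcal G$ satisfying the usual axioms. Here $\mathcal G^{(0)}=\mathcal M$ and $\mathcal G^{(q)}=\mathcal G\,{}_s\!\times_t\cdots{}_s\!\times_t\mathcal G$ ($q$ factors); $p_1,p_2:\mathcal G^{(2)}\to\mathcal G$ are the projections. Face maps $\sigma_i^q:\mathcal G^{(q)}\to\mathcal G^{(q-1)}$, $0\le i\le q$: $\sigma_0^1=s$, $\sigma^1_1=t$; for $q>1$, $\sigma_0^q$ drops the first component, $\sigma_q^q$ drops the last component, and $\sigma_i^q$ ($0<i<q$) multiplies the $i$th and $(i+1)$st components. The coboundary operator is $\delta^q=\sum_{i=0}^q(-1)^i(\sigma_i^q)^*:C^\infty(\mathcal G^{(q-1)})\to C^\infty(\mathcal G^{(q)})$. A vector field $\psi$ on $\mathcal G$ is multiplicative if there is a vector field $\psi^{(2)}$ on $\mathcal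 G^{(2)}$ that is $p_1$-, $p_2$- and $m$-related to $\psi$. Then there is a base field $\phi$ on $\mathcal M$ that is $s$- and $t$-related to $\psi$, and $\psi$ induces for each $q$ a vector field $\psi^{(q)}$ on $\mathcal G^{(q)}$ acting as $\psi$ on each component (i.e. related to $\psi$ under each of the $q$ projections $\mathcal G^{(q)}\to\mathcal G$), with $\psi^{(1)}=\psi$ and $\psi^{(0)}=\phi$. *)

theory Defs
  imports
    "HOL-Analysis.Analysis"
    "HOL-Library.Multiset"
    "HOL-Algebra.QuotRing"
    "HOL-Algebra.Module"
    "HOL-Algebra.Algebraic_Closure_Type"
begin

section \<open>Graded algebras\<close>

abbreviation RR :: "real ring"
  where "RR \<equiv> ring_of_type_algebra"

text \<open>Unital associative real algebras, graded by the integers: \<open>A\<close> is the internal direct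
  sum of the subspaces \<open>C k\<close>.\<close>

definition graded_algebra :: "(real, 'f) module \<Rightarrow> (int \<Rightarrow> 'f set) \<Rightarrow> bool" where
  "graded_algebra A C \<longleftrightarrow>
     ring A \<and> Module.module RR A \<and>
     (\<forall>r. \<forall>x\<in>carrier A. \<forall>y\<in>carrier A.
        (r \<odot>\<^bsub>A\<^esub> x) \<otimes>\<^bsub>A\<^esub> y = r \<odot>\<^bsub>A\<^esub> (x \<otimes>\<^bsub>A\<^esub> y) \<and>
        x \<otimes>\<^bsub>A\<^esub> (r \<odot>\<^bsub>A\<^esub> y) = r \<odot>\<^bsub>A\<^esub> (x \<otimes>\<^bsub>A\<^esub> y)) \<and>
     (\<forall>k. submodule (C k) RR A) \<and>
     (\<forall>x\<in>carrier A. \<exists>!c. (\<forall>k. c k \<in> C k) \<and> finite {k. c k \<noteq> \<zero>\<^bsub>A\<^esub>} \<and>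
        x = finsum A c {k. c k \<noteq> \<zero>\<^bsub>A\<^esub>}) \<and>
     \<one>\<^bsub>A\<^esub> \<in> C 0 \<and>
     (\<forall>k l. \<forall>x\<in>C k. \<forall>y\<in>C l. x \<otimes>\<^bsub>A\<^esub> y \<in> C (k + l))"

definition graded_hom ::
  "(real, 'f) module \<Rightarrow> (int \<Rightarrow> 'f set) \<Rightarrow> (real, 'g) module \<Rightarrow> (int \<Rightarrow> 'g set) \<Rightarrow> ('f \<Rightarrow> 'g) \<Rightarrow> bool"
where
  "graded_hom A C B D h \<longleftrightarrow>
     h \<in> ring_hom A B \<and>
     (\<forall>r. \<forall>x\<in>carrier A. h (r \<odot>\<^bsub>A\<^esub> x) = r \<odot>\<^bsub>B\<^esub> h x) \<and>
     (\<forall>k. h ` C k \<subseteq> D k)"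


section \<open>Spaces with a sheaf of graded algebras\<close>

text \<open>\<open>sect S U\<close> is the algebra of sections over the open set \<open>U\<close>, \<open>gpart S U k\<close> its degree
  \<open>k\<close> part and \<open>res S U V\<close> the restriction from \<open>U\<close> to \<open>V\<close>. Values at sets that are not open
  are irrelevant.\<close>

record ('x, 'f) gspace =
  supp :: "'x topology"
  sect :: "'x set \<Rightarrow> (real, 'f) module"
  gpart :: "'x set \<Rightarrow> int \<Rightarrow> 'f set"
  res  :: "'x set \<Rightarrow> 'x set \<Rightarrow> 'f \<Rightarrow> 'f"

definition graded_presheaf :: "('x, 'f) gspace \<Rightarrow> bool" where
  "graded_presheaf S \<longleftrightarrow>
     (\<forall>U. openin (supp S) U \<longrightarrow>
        graded_algebra (sect S U) (gpart S U) \<and>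
        (\<forall>f\<in>carrier (sect S U). res S U U f = f)) \<and>
     (\<forall>U V. openin (supp S) U \<and> openin (supp S) V \<and> V \<subseteq> U \<longrightarrow>
        graded_hom (sect S U) (gpart S U) (sect S V) (gpart S V) (res S U V)) \<and>
     (\<forall>U V W. openin (supp S) U \<and> openin (supp S) V \<and> openin (supp S) W \<and> V \<subseteq> U \<and> W \<subseteq> V \<longrightarrow>
        (\<forall>f\<in>carrier (sect S U). res S V W (res S U V f) = res S U W f))"

text \<open>A sheaf in the category of graded algebras: the unique gluing condition is imposed in each
  degree. (Gluing infinitely many inhomogeneous sections of unbounded degrees is not possible
  in a direct sum.)\<close>

definition graded_sheaf :: "('x, 'f) gspace \<Rightarrow> bool" where
  "graded_sheaf S \<longleftrightarrow>
     graded_presheaf S \<and>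
     (\<forall>\<U> k s. (\<forall>U\<in>\<U>. openin (supp S) U \<and> s U \<in> gpart S U k) \<and>
        (\<forall>U\<in>\<U>. \<forall>V\<in>\<U>. res S U (U \<inter> V) (s U) = res S V (U \<inter> V) (s V)) \<longrightarrow>
        (\<exists>!f. f \<in> gpart S (\<Union>\<U>) k \<and> (\<forall>U\<in>\<U>. res S (\<Union>\<U>) U f = s U)))"

text \<open>A morphism consists of a map of the supports and, for every open subset \<open>V\<close> of the target,
  a pullback from sections over \<open>V\<close> to sections over the preimage of \<open>V\<close>. All components
  are made extensional, so that equality of morphisms is HOL equality.\<close>

record ('x, 'f, 'y, 'g) gmor =
  base :: "'x \<Rightarrow> 'y"
  pull :: "'y set \<Rightarrow> 'g \<Rightarrow> 'f"

definition mk_mor ::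
  "('x, 'f) gspace \<Rightarrow> ('y, 'g) gspace \<Rightarrow> ('x \<Rightarrow> 'y) \<Rightarrow> ('y set \<Rightarrow> 'g \<Rightarrow> 'f) \<Rightarrow> ('x, 'f, 'y, 'g) gmor"
where
  "mk_mor S Y b P =
     \<lparr>base = restrict b (topspace (supp S)),
      pull = (\<lambda>V f. if openin (supp Y) V \<and> f \<in> carrier (sect Y V) then P V f else undefined)\<rparr>"

definition preim :: "('x, 'f) gspace \<Rightarrow> ('x, 'f, 'y, 'g) gmor \<Rightarrow> 'y set \<Rightarrow> 'x set" where
  "preim S \<mu> V = {x \<in> topspace (supp S). base \<mu> x \<in> V}"

definition graded_morphism ::
  "('x, 'f) gspace \<Rightarrow> ('y, 'g) gspace \<Rightarrow> ('x, 'f, 'y, 'g) gmor \<Rightarrow> bool"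
where
  "graded_morphism S Y \<mu> \<longleftrightarrow>
     \<mu> = mk_mor S Y (base \<mu>) (pull \<mu>) \<and>
     continuous_map (supp S) (supp Y) (base \<mu>) \<and>
     (\<forall>V. openin (supp Y) V \<longrightarrow>
        graded_hom (sect Y V) (gpart Y V) (sect S (preim S \<mu> V)) (gpart S (preim S \<mu> V)) (pull \<mu> V)) \<and>
     (\<forall>U V. openin (supp Y) U \<and> openin (supp Y) V \<and> V \<subseteq> U \<longrightarrow>
        (\<forall>f\<in>carrier (sect Y U).
           pull \<mu> V (res Y U V f) = res S (preim S \<mu> U) (preim S \<mu> V) (pull \<mu> U f)))"

definition id_mor :: "('x, 'f) gspace \<Rightarrow> ('x, 'f, 'x, 'f) gmor" where
  "id_mor S = mk_mor S S (\<lambda>x. x) (\<lambda>V f. f)"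

text \<open>\<open>comp_mor S Y Z \<nu> \<mu>\<close> is the composite of \<open>\<mu>\<close> from \<open>S\<close> to \<open>Y\<close> and \<open>\<nu>\<close> from \<open>Y\<close> to \<open>Z\<close>.\<close>

definition comp_mor ::
  "('x, 'f) gspace \<Rightarrow> ('y, 'g) gspace \<Rightarrow> ('z, 'h) gspace \<Rightarrow>
   ('y, 'g, 'z, 'h) gmor \<Rightarrow> ('x, 'f, 'y, 'g) gmor \<Rightarrow> ('x, 'f, 'z, 'h) gmor"
where
  "comp_mor S Y Z \<nu> \<mu> =
     mk_mor S Z (\<lambda>x. base \<nu> (base \<mu> x)) (\<lambda>V f. pull \<mu> (preim Y \<nu> V) (pull \<nu> V f))"

definition isomorphism ::
  "('x, 'f) gspace \<Rightarrow> ('y, 'g) gspace \<Rightarrow> ('x, 'f, 'y, 'g) gmor \<Rightarrow> bool"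
where
  "isomorphism S Y \<mu> \<longleftrightarrow>
     graded_morphism S Y \<mu> \<and>
     (\<exists>\<nu>. graded_morphism Y S \<nu> \<and>
        comp_mor S Y S \<nu> \<mu> = id_mor S \<and> comp_mor Y S Y \<mu> \<nu> = id_mor Y)"

definition open_part :: "('x, 'f) gspace \<Rightarrow> 'x set \<Rightarrow> ('x, 'f) gspace" where
  "open_part S W = S\<lparr>supp := subtopology (supp S) W\<rparr>"

text \<open>The restriction of \<open>\<mu>\<close> to a morphism between open parts, for \<open>W\<close> mapped into \<open>V\<close>.\<close>

definition restrict_mor ::
  "('x, 'f) gspace \<Rightarrow> 'x set \<Rightarrow> ('y, 'g) gspace \<Rightarrow> 'y set \<Rightarrow>
   ('x, 'f, 'y, 'g) gmor \<Rightarrow> ('x, 'f, 'y, 'g) gmor"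
where
  "restrict_mor S W Y V \<mu> =
     mk_mor (open_part S W) (open_part Y V) (base \<mu>)
       (\<lambda>V' f. res S (preim S \<mu> V') (preim S \<mu> V' \<inter> W) (pull \<mu> V' f))"


section \<open>The local models\<close>

text \<open>The points of \<open>\<real>\<^sup>n\<close> are those of \<^const>\<open>Euclidean_space\<close>: sequences vanishing from
  index \<open>n\<close> on.\<close>

definition partial_deriv :: "nat \<Rightarrow> ((nat \<Rightarrow> real) \<Rightarrow> real) \<Rightarrow> (nat \<Rightarrow> real) \<Rightarrow> real" where
  "partial_deriv i f x = deriv (\<lambda>t. f (x(i := t))) (x i)"

primrec Ck_on :: "nat \<Rightarrow> nat \<Rightarrow> (nat \<Rightarrow> real) set \<Rightarrow> ((nat \<Rightarrow> real) \<Rightarrow> real) \<Rightarrow> bool" where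
  "Ck_on n 0 U f \<longleftrightarrow> continuous_map (subtopology (Euclidean_space n) U) euclideanreal f"
| "Ck_on n (Suc k) U f \<longleftrightarrow>
     continuous_map (subtopology (Euclidean_space n) U) euclideanreal f \<and>
     (\<forall>i<n. (\<forall>x\<in>U. (\<lambda>t. f (x(i := t))) field_differentiable at (x i)) \<and>
        Ck_on n k U (partial_deriv i f))"

definition Cinf_on :: "nat \<Rightarrow> (nat \<Rightarrow> real) set \<Rightarrow> ((nat \<Rightarrow> real) \<Rightarrow> real) \<Rightarrow> bool" where
  "Cinf_on n U f \<longleftrightarrow> (\<forall>k. Ck_on n k U f)"

text \<open>The pair \<open>(i, k)\<close> stands for the \<open>k\<close>-th generator (counted from \<open>0\<close>) of degree \<open>-i\<close>. A monomial
  is a multiset of generators in which odd generators occur at most once; it denotes the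
  product of its elements in increasing lexicographic order.\<close>

type_synonym generator = "int \<times> nat"
type_synonym monomial = "generator multiset"
type_synonym model_section = "monomial \<Rightarrow> (nat \<Rightarrow> real) \<Rightarrow> real"

definition monomials :: "(int \<Rightarrow> nat) \<Rightarrow> monomial set" where
  "monomials p =
     {a. \<forall>(i, k)\<in>set_mset a. i \<noteq> 0 \<and> k < p i \<and> (odd i \<longrightarrow> count a (i, k) = 1)}"

definition mdeg :: "monomial \<Rightarrow> int" where
  "mdeg a = (\<Sum>(i, k)\<in>#a. - i)"

text \<open>The product of the monomials \<open>a\<close> and \<open>b\<close> is \<open>msign a b\<close> times the monomial \<open>a + b\<close>: it
  vanishes if an odd generator is repeated, and otherwise there is a sign \<open>-1\<close> for each pair
  of odd generators that has to be transposed to sort the product.\<close>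

definition msign :: "monomial \<Rightarrow> monomial \<Rightarrow> real" where
  "msign a b =
     (if \<exists>u. odd (fst u) \<and> u \<in># a \<and> u \<in># b then 0
      else (- 1) ^ card {(u, v). u \<in># a \<and> v \<in># b \<and> odd (fst u) \<and> odd (fst v) \<and>
             (fst v < fst u \<or> fst v = fst u \<and> snd v < snd u)})"

text \<open>Sections are the functions that are locally polynomials in the generators with smooth
  coefficients (locally only finitely many monomials occur), with finitely many degrees. Local
  finiteness, as opposed to finiteness, is what sheafification of the presheaf of polynomial
  algebras amounts to; the two agree in each degree unless infinitely many monomials have that
  degree.\<close>

definition model_carrier :: "(int \<Rightarrow> nat) \<Rightarrow> (nat \<Rightarrow> real) set \<Rightarrow> model_section set" where
  "model_carrier p U =
     {c. (\<forall>a x. c a x \<noteq> 0 \<longrightarrow> a \<in> monomials p \<and> x \<in> U) \<and>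
         (\<forall>a. Cinf_on (p 0) U (c a)) \<and>
         (\<forall>x\<in>U. \<exists>W. openin (Euclidean_space (p 0)) W \<and> x \<in> W \<and> finite {a. \<exists>y\<in>W. c a y \<noteq> 0}) \<and>
         finite (mdeg ` {a. \<exists>x. c a x \<noteq> 0})}"

definition model :: "(int \<Rightarrow> nat) \<Rightarrow> (nat \<Rightarrow> real, model_section) gspace" where
  "model p =
     \<lparr>supp = Euclidean_space (p 0),
      sect = (\<lambda>U.
        \<lparr>carrier = model_carrier p U,
         monoid.mult = (\<lambda>c d a x. \<Sum>b | b \<subseteq># a. msign b (a - b) * c b x * d (a - b) x),
         one = (\<lambda>a x. if a = {#} \<and> x \<in> U then 1 else 0),
         zero = (\<lambda>a x. 0),
         add = (\<lambda>c d a x. c a x + d a x),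
         smult = (\<lambda>r c a x. r * c a x)\<rparr>),
      gpart = (\<lambda>U k. {c \<in> model_carrier p U. \<forall>a x. c a x \<noteq> 0 \<longrightarrow> mdeg a = k}),
      res = (\<lambda>U V c a x. if x \<in> V then c a x else 0)\<rparr>"

text \<open>The projection of the product \<open>\<real>\<^sup>p \<times> \<real>\<^sup>q\<close>, which is \<open>model (\<lambda>i. p i + q i)\<close>, where the coordinates
  of the first factor come first in each degree.\<close>

definition model_proj ::
  "(int \<Rightarrow> nat) \<Rightarrow> (int \<Rightarrow> nat) \<Rightarrow>
   (nat \<Rightarrow> real, model_section, nat \<Rightarrow> real, model_section) gmor"
where
  "model_proj p q =
     (let pr = (\<lambda>x i. if i < p 0 then x i else 0) in
      mk_mor (model (\<lambda>i. p i + q i)) (model p) pr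
        (\<lambda>V c a x. if x \<in> topspace (Euclidean_space (p 0 + q 0)) \<and> pr x \<in> V then c a (pr x) else 0))"


section \<open>Supermanifolds\<close>

definition supermanifold_dim :: "(int \<Rightarrow> nat) \<Rightarrow> ('x, 'f) gspace \<Rightarrow> bool" where
  "supermanifold_dim p S \<longleftrightarrow>
     graded_sheaf S \<and>
     (\<forall>x\<in>topspace (supp S). \<exists>W U \<Phi>.
        openin (supp S) W \<and> x \<in> W \<and> openin (Euclidean_space (p 0)) U \<and>
        isomorphism (open_part S W) (open_part (model p) U) \<Phi>)"

definition supermanifold :: "('x, 'f) gspace \<Rightarrow> bool" where
  "supermanifold S \<longleftrightarrow> (\<exists>p. supermanifold_dim p S)"

definition nz_ideal :: "('x, 'f) gspace \<Rightarrow> 'x set \<Rightarrow> 'f set" where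
  "nz_ideal S U = Idl\<^bsub>sect S U\<^esub> (\<Union>k\<in>-{0}. gpart S U k)"

definition body_alg :: "('x, 'f) gspace \<Rightarrow> 'x set \<Rightarrow> 'f set ring" where
  "body_alg S U = sect S U Quot nz_ideal S U"

definition ev :: "('x, 'f) gspace \<Rightarrow> 'x set \<Rightarrow> 'f \<Rightarrow> 'f set" where
  "ev S U f = nz_ideal S U +>\<^bsub>sect S U\<^esub> f"

text \<open>On a small coordinate domain the quotient \<open>body_alg S U\<close> is an algebra of smooth functions.
  To regard \<open>ev S U f\<close> as a function on the support, its value at \<open>x\<close> is read off as the number
  \<open>r\<close> for which the class of \<open>f - r\<close> is not invertible on any neighbourhood of \<open>x\<close>.\<close>

definition ev_fun :: "('x, 'f) gspace \<Rightarrow> 'x set \<Rightarrow> 'f \<Rightarrow> 'x \<Rightarrow> real" where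
  "ev_fun S U f x =
     (THE r. \<forall>W. openin (supp S) W \<and> x \<in> W \<and> W \<subseteq> U \<longrightarrow>
        ev S W (res S U W f \<ominus>\<^bsub>sect S W\<^esub> r \<odot>\<^bsub>sect S W\<^esub> \<one>\<^bsub>sect S W\<^esub>) \<notin> Units (body_alg S W))"

text \<open>The smooth functions on the support are the sections of the sheaf of quotient algebras.\<close>

definition smooth_fun :: "('x, 'f) gspace \<Rightarrow> 'x set \<Rightarrow> ('x \<Rightarrow> real) \<Rightarrow> bool" where
  "smooth_fun S W g \<longleftrightarrow>
     (\<forall>x\<in>W. \<exists>U. openin (supp S) U \<and> x \<in> U \<and> U \<subseteq> W \<and>
        (\<exists>f\<in>carrier (sect S U). \<forall>y\<in>U. g y = ev_fun S U f y))"

definition smooth_map_on_supp ::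
  "('x, 'f) gspace \<Rightarrow> ('y, 'g) gspace \<Rightarrow> ('x, 'f, 'y, 'g) gmor \<Rightarrow> bool"
where
  "smooth_map_on_supp S Y \<mu> \<longleftrightarrow>
     continuous_map (supp S) (supp Y) (base \<mu>) \<and>
     (\<forall>V g. openin (supp Y) V \<and> smooth_fun Y V g \<longrightarrow>
        smooth_fun S (preim S \<mu> V) (\<lambda>x. g (base \<mu> x)))"

definition smorphism ::
  "('x, 'f) gspace \<Rightarrow> ('y, 'g) gspace \<Rightarrow> ('x, 'f, 'y, 'g) gmor \<Rightarrow> bool"
where
  "smorphism S Y \<mu> \<longleftrightarrow>
     smooth_map_on_supp S Y \<mu> \<and>
     graded_morphism S Y \<mu> \<and>
     (\<forall>V. openin (supp Y) V \<longrightarrow> (\<forall>f\<in>carrier (sect Y V). \<forall>x\<in>preim S \<mu> V.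
        ev_fun S (preim S \<mu> V) (pull \<mu> V f) x = ev_fun Y V f (base \<mu> x)))"

definition submersion ::
  "('x, 'f) gspace \<Rightarrow> ('y, 'g) gspace \<Rightarrow> ('x, 'f, 'y, 'g) gmor \<Rightarrow> bool"
where
  "submersion S Y \<mu> \<longleftrightarrow>
     smorphism S Y \<mu> \<and>
     (\<forall>x\<in>topspace (supp S). \<exists>p q W V U' U \<Phi> \<Psi>.
        openin (supp S) W \<and> x \<in> W \<and> openin (supp Y) V \<and> base \<mu> ` W \<subseteq> V \<and>
        openin (Euclidean_space (p 0 + q 0)) U' \<and> openin (Euclidean_space (p 0)) U \<and>
        base (model_proj p q) ` U' \<subseteq> U \<and>
        isomorphism (open_part S W) (open_part (model (\<lambda>i. p i + q i)) U') \<Phi> \<and>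
        isomorphism (open_part Y V) (open_part (model p) U) \<Psi> \<and>
        comp_mor (open_part S W) (open_part Y V) (open_part (model p) U)
          \<Psi> (restrict_mor S W Y V \<mu>) =
        comp_mor (open_part S W) (open_part (model (\<lambda>i. p i + q i)) U') (open_part (model p) U)
          (restrict_mor (model (\<lambda>i. p i + q i)) U' (model p) U (model_proj p q)) \<Phi>)"

definition surjective_submersion ::
  "('x, 'f) gspace \<Rightarrow> ('y, 'g) gspace \<Rightarrow> ('x, 'f, 'y, 'g) gmor \<Rightarrow> bool"
where
  "surjective_submersion S Y \<mu> \<longleftrightarrow>
     submersion S Y \<mu> \<and> base \<mu> ` topspace (supp S) = topspace (supp Y)"


section \<open>Vector fields\<close>

text \<open>Derivations of the sheaf, i.e. families of derivations compatible with restriction.\<close>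

definition vector_field :: "('x, 'f) gspace \<Rightarrow> int \<Rightarrow> ('x set \<Rightarrow> 'f \<Rightarrow> 'f) \<Rightarrow> bool" where
  "vector_field S j \<phi> \<longleftrightarrow>
     (\<forall>U. openin (supp S) U \<longrightarrow> (let A = sect S U in
        \<phi> U \<in> carrier A \<rightarrow> carrier A \<and>
        (\<forall>f\<in>carrier A. \<forall>g\<in>carrier A. \<phi> U (f \<oplus>\<^bsub>A\<^esub> g) = \<phi> U f \<oplus>\<^bsub>A\<^esub> \<phi> U g) \<and>
        (\<forall>r. \<forall>f\<in>carrier A. \<phi> U (r \<odot>\<^bsub>A\<^esub> f) = r \<odot>\<^bsub>A\<^esub> \<phi> U f) \<and>
        (\<forall>k. \<phi> U ` gpart S U k \<subseteq> gpart S U (k + j)) \<and>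
        (\<forall>k. \<forall>f\<in>gpart S U k. \<forall>g\<in>carrier A.
           \<phi> U (f \<otimes>\<^bsub>A\<^esub> g) =
             \<phi> U f \<otimes>\<^bsub>A\<^esub> g \<oplus>\<^bsub>A\<^esub> ((- 1) powi (j * k)) \<odot>\<^bsub>A\<^esub> (f \<otimes>\<^bsub>A\<^esub> \<phi> U g)))) \<and>
     (\<forall>U V. openin (supp S) U \<and> openin (supp S) V \<and> V \<subseteq> U \<longrightarrow>
        (\<forall>f\<in>carrier (sect S U). \<phi> V (res S U V f) = res S U V (\<phi> U f)))"

definition related ::
  "('x, 'f) gspace \<Rightarrow> ('y, 'g) gspace \<Rightarrow> ('x, 'f, 'y, 'g) gmor \<Rightarrow>
   ('x set \<Rightarrow> 'f \<Rightarrow> 'f) \<Rightarrow> ('y set \<Rightarrow> 'g \<Rightarrow> 'g) \<Rightarrow> bool"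
where
  "related S Y \<mu> \<phi> \<psi> \<longleftrightarrow>
     (\<forall>V. openin (supp Y) V \<longrightarrow> (\<forall>f\<in>carrier (sect Y V).
        pull \<mu> V (\<psi> V f) = \<phi> (preim S \<mu> V) (pull \<mu> V f)))"


section \<open>Lie supergroupoids\<close>

text \<open>\<open>(P, pr 1, \<dots>, pr q)\<close> is a fibre product \<open>G \<^sub>s\<times>\<^sub>t \<dots> \<^sub>s\<times>\<^sub>t G\<close> of \<open>q\<close> factors in the category
  of supermanifolds. HOL cannot quantify over the types of the test objects \<open>T\<close>, so these range over
  supermanifolds of the same types as the other spaces.\<close>

definition fibre_power ::
  "('x, 'f) gspace \<Rightarrow> ('x, 'f) gspace \<Rightarrow> ('x, 'f, 'x, 'f) gmor \<Rightarrow> ('x, 'f, 'x, 'f) gmor \<Rightarrow>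
   nat \<Rightarrow> ('x, 'f) gspace \<Rightarrow> (nat \<Rightarrow> ('x, 'f, 'x, 'f) gmor) \<Rightarrow> bool"
where
  "fibre_power M G s t q P pr \<longleftrightarrow>
     (let cone = (\<lambda>T f. supermanifold T \<and> (\<forall>j\<in>{1..q}. smorphism T G (f j)) \<and>
            (\<forall>j\<in>{1..<q}. comp_mor T G M s (f j) = comp_mor T G M t (f (j + 1))))
      in cone P pr \<and>
         (\<forall>T f. cone T f \<longrightarrow>
            (\<exists>!u. smorphism T P u \<and> (\<forall>j\<in>{1..q}. comp_mor T P G (pr j) u = f j))))"

text \<open>The spaces \<open>nerve \<G> q\<close> with their projections \<open>prj \<G> q j\<close> (for \<open>1 \<le> j \<le> q\<close>) to the
  space of arrows are a choice of the fibre products.\<close>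

record ('x, 'f) groupoid_data =
  obj   :: "('x, 'f) gspace"
  arr   :: "('x, 'f) gspace"
  src   :: "('x, 'f, 'x, 'f) gmor"
  tgt   :: "('x, 'f, 'x, 'f) gmor"
  nerve :: "nat \<Rightarrow> ('x, 'f) gspace"
  prj   :: "nat \<Rightarrow> nat \<Rightarrow> ('x, 'f, 'x, 'f) gmor"
  mlt   :: "('x, 'f, 'x, 'f) gmor"
  idt   :: "('x, 'f, 'x, 'f) gmor"
  ivt   :: "('x, 'f, 'x, 'f) gmor"

text \<open>The morphism from \<open>T\<close> to \<open>nerve \<G> q\<close> with components \<open>f 1, \<dots>, f q\<close>.\<close>

definition tuple_mor ::
  "('x, 'f) groupoid_data \<Rightarrow> nat \<Rightarrow> ('x, 'f) gspace \<Rightarrow> (nat \<Rightarrow> ('x, 'f, 'x, 'f) gmor) \<Rightarrow>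
   ('x, 'f, 'x, 'f) gmor"
where
  "tuple_mor \<G> q T f =
     (THE u. smorphism T (nerve \<G> q) u \<and>
        (\<forall>j\<in>{1..q}. comp_mor T (nerve \<G> q) (arr \<G>) (prj \<G> q j) u = f j))"

definition mult_mor ::
  "('x, 'f) groupoid_data \<Rightarrow> ('x, 'f) gspace \<Rightarrow> ('x, 'f, 'x, 'f) gmor \<Rightarrow> ('x, 'f, 'x, 'f) gmor \<Rightarrow>
   ('x, 'f, 'x, 'f) gmor"
where
  "mult_mor \<G> T g h =
     comp_mor T (nerve \<G> 2) (arr \<G>) (mlt \<G>) (tuple_mor \<G> 2 T (\<lambda>j. if j = 1 then g else h))"

definition lie_supergroupoid :: "('x, 'f) groupoid_data \<Rightarrow> bool" where
  "lie_supergroupoid \<G> \<longleftrightarrow>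
     (let M = obj \<G>; G = arr \<G>; s = src \<G>; t = tgt \<G>; N = nerve \<G>; pr = prj \<G>;
          m = mlt \<G>; e = idt \<G>; \<iota> = ivt \<G> in
      supermanifold M \<and> supermanifold G \<and>
      surjective_submersion G M s \<and> surjective_submersion G M t \<and>
      N 0 = M \<and> N 1 = G \<and> pr 1 1 = id_mor G \<and>
      (\<forall>q\<ge>2. fibre_power M G s t q (N q) (pr q)) \<and>
      smorphism (N 2) G m \<and> smorphism M G e \<and> smorphism G G \<iota> \<and>
      comp_mor (N 2) G M s m = comp_mor (N 2) G M s (pr 2 2) \<and>
      comp_mor (N 2) G M t m = comp_mor (N 2) G M t (pr 2 1) \<and>
      mult_mor \<G> (N 3) (mult_mor \<G> (N 3) (pr 3 1) (pr 3 2)) (pr 3 3) =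
        mult_mor \<G> (N 3) (pr 3 1) (mult_mor \<G> (N 3) (pr 3 2) (pr 3 3)) \<and>
      comp_mor M G M s e = id_mor M \<and>
      comp_mor M G M t e = id_mor M \<and>
      mult_mor \<G> G (comp_mor G M G e t) (id_mor G) = id_mor G \<and>
      mult_mor \<G> G (id_mor G) (comp_mor G M G e s) = id_mor G \<and>
      comp_mor G G M s \<iota> = t \<and>
      comp_mor G G M t \<iota> = s \<and>
      mult_mor \<G> G (id_mor G) \<iota> = comp_mor G M G e t \<and>
      mult_mor \<G> G \<iota> (id_mor G) = comp_mor G M G e s)"

definition face :: "('x, 'f) groupoid_data \<Rightarrow> nat \<Rightarrow> nat \<Rightarrow> ('x, 'f, 'x, 'f) gmor" where
  "face \<G> q i =
     (let N = nerve \<G>; pr = prj \<G> q in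
      if q = 1 then (if i = 0 then src \<G> else tgt \<G>)
      else if i = 0 then tuple_mor \<G> (q - 1) (N q) (\<lambda>j. pr (j + 1))
      else if i = q then tuple_mor \<G> (q - 1) (N q) pr
      else tuple_mor \<G> (q - 1) (N q)
        (\<lambda>j. if j < i then pr j
             else if j = i then mult_mor \<G> (N q) (pr i) (pr (i + 1))
             else pr (j + 1)))"

definition global_sections :: "('x, 'f) gspace \<Rightarrow> (real, 'f) module" where
  "global_sections S = sect S (topspace (supp S))"

definition coboundary :: "('x, 'f) groupoid_data \<Rightarrow> nat \<Rightarrow> 'f \<Rightarrow> 'f" where
  "coboundary \<G> q f =
     (\<Oplus>\<^bsub>global_sections (nerve \<G> q)\<^esub>i\<in>{0..q}.
        ((- 1) ^ i) \<odot>\<^bsub>global_sections (nerve \<G> q)\<^esub>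
          pull (face \<G> q i) (topspace (supp (nerve \<G> (q - 1)))) f)"

definition multiplicative :: "('x, 'f) groupoid_data \<Rightarrow> int \<Rightarrow> ('x set \<Rightarrow> 'f \<Rightarrow> 'f) \<Rightarrow> bool" where
  "multiplicative \<G> j \<psi> \<longleftrightarrow>
     vector_field (arr \<G>) j \<psi> \<and>
     (\<exists>\<psi>2. vector_field (nerve \<G> 2) j \<psi>2 \<and>
        related (nerve \<G> 2) (arr \<G>) (prj \<G> 2 1) \<psi>2 \<psi> \<and>
        related (nerve \<G> 2) (arr \<G>) (prj \<G> 2 2) \<psi>2 \<psi> \<and>
        related (nerve \<G> 2) (arr \<G>) (mlt \<G>) \<psi>2 \<psi>)"

definition induced_fields ::
  "('x, 'f) groupoid_data \<Rightarrow> int \<Rightarrow> ('x set \<Rightarrow> 'f \<Rightarrow> 'f) \<Rightarrow> (nat \<Rightarrow> 'x set \<Rightarrow> 'f \<Rightarrow> 'f) \<Rightarrow> bool"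
where
  "induced_fields \<G> j \<psi> \<Psi> \<longleftrightarrow>
     (\<forall>q. vector_field (nerve \<G> q) j (\<Psi> q)) \<and>
     (\<forall>q\<ge>1. \<forall>k\<in>{1..q}. related (nerve \<G> q) (arr \<G>) (prj \<G> q k) (\<Psi> q) \<psi>) \<and>
     \<Psi> 1 = \<psi> \<and>
     related (arr \<G>) (obj \<G>) (src \<G>) \<psi> (\<Psi> 0) \<and>
     related (arr \<G>) (obj \<G>) (tgt \<G>) \<psi> (\<Psi> 0)"

end

theory Submission
  imports Defs
begin

text \<open>Pullback along a face map relates \<open>\<Psi> q\<close> to \<open>\<Psi> (q - 1)\<close>, and the coboundary is an alternating
  sum of such pullbacks. A face map \<open>u\<close> is only known through its components, so one has to show that a
  derivation \<open>D\<close> along \<open>u\<close> into a fibre power vanishes as soon as it kills the functions pulled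
  back from the factors; this is applied to \<open>D = u\<^sup>* \<Psi> (q - 1) - \<Psi> q u\<^sup>*\<close>. If \<open>D\<close> has odd degree \<open>j\<close>, adjoin
  an odd variable \<open>\<epsilon>\<close> of degree \<open>- j\<close> to the source: then \<open>u\<^sup>* + \<epsilon> D\<close> is again a morphism, and it has
  the same components as \<open>u\<^sup>*\<close>, so \<open>D = 0\<close> by the universal property. If \<open>D\<close> has even degree,
  the same is applied to \<open>\<epsilon> D\<close> for a further odd variable.\<close>

section \<open>Graded algebras and their parity involution\<close>

text \<open>No coordinates on a fibre power are at hand: it is known only through its universal
  property, so a derivation into it can be tested only by turning it into a morphism. The variable
  \<epsilon> has to be odd because models have free generators: an even one would not square to
  zero, an odd one does, and this makes \<open>u + \<epsilon> D\<close> multiplicative. Since the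
  degree of \<epsilon> is then nonzero, \<epsilon> lies in the ideal that \<open>ev\<close> divides
  out, so base maps, smooth functions and values at points stay the same. Most of the work goes into
  showing that the extended source is a legitimate test object: a sheaf that is locally a model with
  one more generator and has its sections in the original type. The last demand calls for a
  bijection between that type and its square, which exists if the type is infinite; a finite type
  carries only zero algebras. The sections of a model are never shown to form an algebra by
  themselves; their closure properties are transported through the charts of the given
  supermanifold.\<close>

definition sgn_deg :: "int \<Rightarrow> real" where
  "sgn_deg k = (- 1) powi k"

lemma sgn_deg_add: "sgn_deg (k + l) = sgn_deg k * sgn_deg l"
  by (simp add: sgn_deg_def power_int_add)

lemma sgn_deg_0 [simp]: "sgn_deg 0 = 1"
  by (simp add: sgn_deg_def)

lemma sgn_deg_even: "even k \<Longrightarrow> sgn_deg k = 1"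
  by (auto simp: sgn_deg_def elim!: evenE)

lemma sgn_deg_odd: "odd k \<Longrightarrow> sgn_deg k = -1"
  by (auto simp: sgn_deg_def power_int_add elim!: oddE)

lemma sgn_deg_square [simp]: "sgn_deg k * sgn_deg k = 1"
  by (cases "even k") (simp_all add: sgn_deg_even sgn_deg_odd)

lemma ring_of_reals [simp]:
  "carrier RR = UNIV" "a \<oplus>\<^bsub>RR\<^esub> b = a + b" "a \<otimes>\<^bsub>RR\<^esub> b = a * b" "\<one>\<^bsub>RR\<^esub> = 1" "\<zero>\<^bsub>RR\<^esub> = 0"
  by (simp_all add: ring_of_type_algebra_def)

text \<open>The finite set \<open>S\<close> may exceed the support of \<open>c\<close>. This lets
  two decompositions be put over a common index set, whereas \<open>graded_algebra\<close> sums over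
  the exact support.\<close>

definition graded_family :: "(real, 'f) module \<Rightarrow> (int \<Rightarrow> 'f set) \<Rightarrow> int set \<Rightarrow> (int \<Rightarrow> 'f) \<Rightarrow> bool" where
  "graded_family A C S c \<longleftrightarrow> finite S \<and> (\<forall>k. c k \<in> C k) \<and> (\<forall>k. k \<notin> S \<longrightarrow> c k = \<zero>\<^bsub>A\<^esub>)"

text \<open>The parity automorphism, i.e. what becomes of an element when an odd variable is moved
  past it. A scalar sign would make sense only for homogeneous elements.\<close>

definition par :: "(real, 'f) module \<Rightarrow> (int \<Rightarrow> 'f set) \<Rightarrow> 'f \<Rightarrow> 'f" where
  "par A C x = (let c = (THE c. (\<forall>k. c k \<in> C k) \<and> finite {k. c k \<noteq> \<zero>\<^bsub>A\<^esub>} \<and>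
      x = finsum A c {k. c k \<noteq> \<zero>\<^bsub>A\<^esub>})
    in finsum A (\<lambda>k. sgn_deg k \<odot>\<^bsub>A\<^esub> c k) {k. c k \<noteq> \<zero>\<^bsub>A\<^esub>})"

locale galg = ring A for A :: "(real, 'f) module" (structure) +
  fixes C :: "int \<Rightarrow> 'f set"
  assumes smod: "Module.module RR A"
    and smult_mult_left: "\<And>r x y. \<lbrakk>x \<in> carrier A; y \<in> carrier A\<rbrakk> \<Longrightarrow> (r \<odot> x) \<otimes> y = r \<odot> (x \<otimes> y)"
    and smult_mult_right: "\<And>r x y. \<lbrakk>x \<in> carrier A; y \<in> carrier A\<rbrakk> \<Longrightarrow> x \<otimes> (r \<odot> y) = r \<odot> (x \<otimes> y)"
    and smod_part: "\<And>k. submodule (C k) RR A"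
    and decomp: "\<And>x. x \<in> carrier A \<Longrightarrow> \<exists>!c. (\<forall>k. c k \<in> C k) \<and> finite {k. c k \<noteq> \<zero>} \<and>
        x = finsum A c {k. c k \<noteq> \<zero>}"
    and part_one: "\<one> \<in> C 0"
    and part_mult: "\<And>k l x y. \<lbrakk>x \<in> C k; y \<in> C l\<rbrakk> \<Longrightarrow> x \<otimes> y \<in> C (k + l)"

lemma graded_algebra_iff_galg: "graded_algebra A C \<longleftrightarrow> galg A C"
  unfolding graded_algebra_def galg_def galg_axioms_def by blast

context galg
begin

lemma smult_closed [simp, intro]: "x \<in> carrier A \<Longrightarrow> r \<odot> x \<in> carrier A"
  using Module.module.smult_closed[OF smod] by simp

lemma smult_add_left: "x \<in> carrier A \<Longrightarrow> (a + b) \<odot> x = a \<odot> x \<oplus> b \<odot> x"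
  using Module.module.smult_l_distr[OF smod] by simp

lemma smult_add_right: "\<lbrakk>x \<in> carrier A; y \<in> carrier A\<rbrakk> \<Longrightarrow> a \<odot> (x \<oplus> y) = a \<odot> x \<oplus> a \<odot> y"
  using Module.module.smult_r_distr[OF smod] by simp

lemma smult_smult: "x \<in> carrier A \<Longrightarrow> a \<odot> (b \<odot> x) = (a * b) \<odot> x"
  using Module.module.smult_assoc1[OF smod] by simp

lemma smult_one [simp]: "x \<in> carrier A \<Longrightarrow> 1 \<odot> x = x"
  using Module.module.smult_one[OF smod] by simp

lemma smult_zero_left [simp]: "x \<in> carrier A \<Longrightarrow> 0 \<odot> x = \<zero>"
  using Module.module.smult_l_null[OF smod] by simp

lemma smult_zero_right [simp]: "a \<odot> \<zero> = \<zero>"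
  using Module.module.smult_r_null[OF smod] by simp

lemma smult_minus_one: "x \<in> carrier A \<Longrightarrow> (-1) \<odot> x = \<ominus> x"
  using Module.module.smult_l_minus[OF smod, of 1 x]
  by (metis add.inv_comm add.l_cancel_one add_eq_0_iff local.minus_equality smult_add_left smult_closed smult_one smult_zero_left)

lemma part_sub: "x \<in> C k \<Longrightarrow> x \<in> carrier A"
  using Module.module.submoduleE(1)[OF smod smod_part] by auto

lemma part_add: "\<lbrakk>x \<in> C k; y \<in> C k\<rbrakk> \<Longrightarrow> x \<oplus> y \<in> C k"
  using Module.module.submoduleE(5)[OF smod smod_part] by auto

lemma part_smult: "x \<in> C k \<Longrightarrow> r \<odot> x \<in> C k"
  using Module.module.submoduleE(4)[OF smod smod_part] by auto

lemma part_zero [simp]: "\<zero> \<in> C k"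
proof -
  obtain x where "x \<in> C k"
    using Module.module.submoduleE(2)[OF smod smod_part] by auto
  then show ?thesis using part_smult[of x k 0] part_sub by auto
qed

lemma part_neg: "x \<in> C k \<Longrightarrow> \<ominus> x \<in> C k"
  using part_smult[of x k "-1"] smult_minus_one part_sub by auto

lemma graded_family_closed: "graded_family A C S c \<Longrightarrow> c k \<in> carrier A"
  using part_sub by (auto simp: graded_family_def)

lemma finsum_superset:
  assumes "finite S" "S' \<subseteq> S" "\<And>k. k \<in> S - S' \<Longrightarrow> c k = \<zero>" "\<And>k. k \<in> S \<Longrightarrow> c k \<in> carrier A"
  shows "finsum A c S = finsum A c S'"
  using assms by (intro add.finprod_mono_neutral_cong_right) auto

lemma graded_family_finsum_supp:
  "graded_family A C S c \<Longrightarrow> finsum A c {k. c k \<noteq> \<zero>} = finsum A c S"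
  by (rule sym, rule finsum_superset) (auto simp: graded_family_def intro: part_sub)

lemma graded_family_supp: "graded_family A C S c \<Longrightarrow> finite {k. c k \<noteq> \<zero>}"
  by (rule finite_subset[of _ S]) (auto simp: graded_family_def)

lemma graded_family_exists:
  assumes "x \<in> carrier A"
  obtains S c where "graded_family A C S c" "x = finsum A c S"
  using decomp[OF assms] that unfolding graded_family_def by blast

lemma graded_family_unique:
  assumes "graded_family A C S c" "graded_family A C S' c'" "finsum A c S = finsum A c' S'"
  shows "c = c'"
proof -
  have "finsum A c S \<in> carrier A"
    using graded_family_closed[OF assms(1)] by (intro finsum_closed) auto
  from decomp[OF this] show ?thesis
    using assms graded_family_finsum_supp[OF assms(1)] graded_family_finsum_supp[OF assms(2)]
      graded_family_supp[OF assms(1)] graded_family_supp[OF assms(2)]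
    unfolding graded_family_def by metis
qed

lemma par_eq:
  assumes "graded_family A C S c"
  shows "par A C (finsum A c S) = finsum A (\<lambda>k. sgn_deg k \<odot> c k) S"
proof -
  have "(THE c'. (\<forall>k. c' k \<in> C k) \<and> finite {k. c' k \<noteq> \<zero>} \<and>
      finsum A c S = finsum A c' {k. c' k \<noteq> \<zero>}) = c"
  proof (rule the_equality)
    show "(\<forall>k. c k \<in> C k) \<and> finite {k. c k \<noteq> \<zero>} \<and> finsum A c S = finsum A c {k. c k \<noteq> \<zero>}"
      using assms graded_family_finsum_supp[OF assms] graded_family_supp[OF assms]
      by (auto simp: graded_family_def)
    fix c' assume "(\<forall>k. c' k \<in> C k) \<and> finite {k. c' k \<noteq> \<zero>} \<and> finsum A c S = finsum A c' {k. c' k \<noteq> \<zero>}"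
    then show "c' = c"
      using graded_family_unique[OF _ assms, of "{k. c' k \<noteq> \<zero>}" c'] by (auto simp: graded_family_def)
  qed
  moreover have "finsum A (\<lambda>k. sgn_deg k \<odot> c k) S = finsum A (\<lambda>k. sgn_deg k \<odot> c k) {k. c k \<noteq> \<zero>}"
    using assms by (intro finsum_superset) (auto simp: graded_family_def intro: part_sub)
  ultimately show ?thesis by (simp add: par_def)
qed

lemma graded_family_single: "x \<in> C k \<Longrightarrow> graded_family A C {k} (\<lambda>l. if l = k then x else \<zero>)"
  by (auto simp: graded_family_def)

lemma par_part: assumes "x \<in> C k" shows "par A C x = sgn_deg k \<odot> x"
proof -
  have "finsum A (\<lambda>l. if l = k then x else \<zero>) {k} = x"
    using part_sub[OF assms] by (simp add: finsum_insert)
  then show ?thesis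
    using par_eq[OF graded_family_single[OF assms]] part_sub[OF assms] by (simp add: finsum_insert)
qed

lemma par_closed [simp, intro]: assumes "x \<in> carrier A" shows "par A C x \<in> carrier A"
proof -
  obtain S c where c: "graded_family A C S c" "x = finsum A c S" using graded_family_exists[OF assms] .
  then show ?thesis using graded_family_closed[OF c(1)] by (simp add: par_eq Pi_def)
qed

lemma par_add:
  assumes "x \<in> carrier A" "y \<in> carrier A"
  shows "par A C (x \<oplus> y) = par A C x \<oplus> par A C y"
proof -
  obtain S c where c: "graded_family A C S c" "x = finsum A c S" using graded_family_exists[OF assms(1)] .
  obtain S' d where d: "graded_family A C S' d" "y = finsum A d S'" using graded_family_exists[OF assms(2)] .
  note cl = graded_family_closed[OF c(1)] graded_family_closed[OF d(1)]
  let ?T = "S \<union> S'"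
  have c': "graded_family A C ?T c" "x = finsum A c ?T" and d': "graded_family A C ?T d" "y = finsum A d ?T"
    using c d graded_family_finsum_supp[of S c] graded_family_finsum_supp[of ?T c]
      graded_family_finsum_supp[of S' d] graded_family_finsum_supp[of ?T d]
    by (auto simp: graded_family_def)
  have cd: "graded_family A C ?T (\<lambda>k. c k \<oplus> d k)"
    using c d by (auto simp: graded_family_def part_add)
  have "x \<oplus> y = finsum A (\<lambda>k. c k \<oplus> d k) ?T"
    unfolding c'(2) d'(2) using cl by (subst finsum_addf) auto
  then have "par A C (x \<oplus> y) = finsum A (\<lambda>k. sgn_deg k \<odot> c k \<oplus> sgn_deg k \<odot> d k) ?T"
    using par_eq[OF cd] cl by (simp add: smult_add_right)
  also have "\<dots> = par A C x \<oplus> par A C y"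
    unfolding c'(2) d'(2) par_eq[OF c'(1)] par_eq[OF d'(1)] using cl by (subst finsum_addf) auto
  finally show ?thesis .
qed

lemma graded_induct [consumes 1, case_names part add]:
  assumes "x \<in> carrier A"
    and part: "\<And>k x. x \<in> C k \<Longrightarrow> P x"
    and add: "\<And>x y. \<lbrakk>x \<in> carrier A; y \<in> carrier A; P x; P y\<rbrakk> \<Longrightarrow> P (x \<oplus> y)"
  shows "P x"
proof -
  obtain S c where c: "graded_family A C S c" "x = finsum A c S" using graded_family_exists[OF assms(1)] .
  have "finite S" using c by (simp add: graded_family_def)
  then have "P (finsum A c S)"
  proof induct
    case empty
    then show ?case using part[OF part_zero] by simp
  next
    case (insert k S)
    have "c k \<in> C k" using c by (simp add: graded_family_def)
    then show ?case
      using insert graded_family_closed[OF c(1)] add[OF _ _ part] by (simp add: finsum_insert Pi_def)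
  qed
  then show ?thesis using c by simp
qed

lemma par_smult: "x \<in> carrier A \<Longrightarrow> par A C (r \<odot> x) = r \<odot> par A C x"
proof (induct rule: graded_induct)
  case (part k x)
  then show ?case using part_sub[OF part]
    by (simp add: par_part[OF part] par_part[OF part_smult[OF part]] smult_smult mult.commute)
qed (simp add: smult_add_right par_add)

text \<open>Degrees add under products, so their signs multiply. Associativity of
  \<open>A[\<epsilon>]\<close> rests on this: moving \<epsilon> past a product is moving it past
  each factor in turn.\<close>

lemma par_mult:
  assumes "x \<in> carrier A" "y \<in> carrier A"
  shows "par A C (x \<otimes> y) = par A C x \<otimes> par A C y"
  using assms(1)
proof (induct rule: graded_induct)
  case x: (part k x)
  show ?case using assms(2)
  proof (induct rule: graded_induct)
    case y: (part l y)
    show ?case using part_sub[OF x] part_sub[OF y]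
      by (simp add: par_part[OF x] par_part[OF y] par_part[OF part_mult[OF x y]]
          smult_mult_left smult_mult_right smult_smult sgn_deg_add mult.commute)
  qed (simp add: part_sub[OF x] r_distr par_add)
qed (simp add: assms(2) l_distr par_add)

lemma par_zero [simp]: "par A C \<zero> = \<zero>"
  using par_part[OF part_zero[of 0]] by simp

lemma par_one [simp]: "par A C \<one> = \<one>"
  using par_part[OF part_one] by simp

lemma par_part_closed: "x \<in> C k \<Longrightarrow> par A C x \<in> C k"
  by (simp add: par_part part_smult)

end

lemma graded_hom_par:
  assumes "galg A C" "galg B D" "graded_hom A C B D h" "x \<in> carrier A"
  shows "h (par A C x) = par B D (h x)"
proof -
  interpret A: galg A C by fact
  interpret B: galg B D by fact
  have h: "h \<in> ring_hom A B" "\<And>r x. x \<in> carrier A \<Longrightarrow> h (r \<odot>\<^bsub>A\<^esub> x) = r \<odot>\<^bsub>B\<^esub> h x"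
    "\<And>k x. x \<in> C k \<Longrightarrow> h x \<in> D k"
    using assms(3) by (auto simp: graded_hom_def image_subset_iff)
  from assms(4) show ?thesis
  proof (induct rule: A.graded_induct)
    case (part k x)
    then show ?case using h by (metis A.par_part B.par_part A.part_sub)
  next
    case (add x y)
    then show ?case
      using ring_hom_add[OF h(1)] ring_hom_closed[OF h(1)] by (simp add: A.par_add B.par_add)
  qed
qed

section \<open>Adjoining an odd variable to a graded algebra\<close>

text \<open>The test objects of a fibre power have sections of the same type as the fibre power, so
  \<open>A[\<epsilon>]\<close>, which is \<open>A \<times> A\<close> as a set, is encoded in the type of \<open>A\<close>.\<close>

definition pairing :: "('f \<Rightarrow> 'f \<Rightarrow> 'g) \<Rightarrow> bool" where
  "pairing e \<longleftrightarrow> bij (case_prod e)"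

definition lft :: "('f \<Rightarrow> 'f \<Rightarrow> 'g) \<Rightarrow> 'g \<Rightarrow> 'f" where
  "lft e x = fst (inv_into UNIV (case_prod e) x)"

definition rgt :: "('f \<Rightarrow> 'f \<Rightarrow> 'g) \<Rightarrow> 'g \<Rightarrow> 'f" where
  "rgt e x = snd (inv_into UNIV (case_prod e) x)"

lemma pairing_simps [simp]:
  assumes "pairing e"
  shows "lft e (e a b) = a" "rgt e (e a b) = b" "e (lft e x) (rgt e x) = x"
proof -
  have b: "bij (case_prod e)" using assms by (simp add: pairing_def)
  have l: "inv_into UNIV (case_prod e) (e a b) = (a, b)"
    using inv_f_f[OF bij_is_inj[OF b], of "(a, b)"] by (simp only: prod.case)
  have r: "case_prod e (inv_into UNIV (case_prod e) x) = x"
    by (rule surj_f_inv_f[OF bij_is_surj[OF b]])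
  show "lft e (e a b) = a" "rgt e (e a b) = b"
    unfolding lft_def rgt_def l by simp_all
  show "e (lft e x) (rgt e x) = x"
    unfolding lft_def rgt_def using r by (metis case_prod_beta)
qed

lemma pairing_eq_iff: "pairing e \<Longrightarrow> x = y \<longleftrightarrow> lft e x = lft e y \<and> rgt e x = rgt e y"
  by (metis pairing_simps(3))

lemma pairing_inject [simp]: "pairing e \<Longrightarrow> e a b = e a' b' \<longleftrightarrow> a = a' \<and> b = b'"
  by (metis pairing_simps(1,2))

text \<open>By the axiom of choice, an infinite set is equipotent to its square.\<close>

lemma exists_pairing:
  assumes "infinite (UNIV :: 'f set)"
  shows "\<exists>e :: 'f \<Rightarrow> 'f \<Rightarrow> 'f. pairing e"
proof -
  obtain h :: "'f \<times> 'f \<Rightarrow> 'f" where "bij_betw h (UNIV \<times> UNIV) UNIV"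
    using card_of_Times_same_infinite[OF assms, THEN iffD2[OF card_of_ordIso]] ..
  then have "bij h" by simp
  then have "pairing (curry h)" by (simp add: pairing_def)
  then show ?thesis by blast
qed

text \<open>The algebra \<open>A[\<epsilon>]\<close> for an odd \<open>\<epsilon>\<close> that supercommutes with \<open>A\<close> and has square zero: \<open>e a b\<close>
  encodes \<open>a + \<epsilon> b\<close>.\<close>

definition ext_alg :: "('f \<Rightarrow> 'f \<Rightarrow> 'g) \<Rightarrow> (real, 'f) module \<Rightarrow> (int \<Rightarrow> 'f set) \<Rightarrow> (real, 'g) module" where
  "ext_alg e A C =
     \<lparr>carrier = {x. lft e x \<in> carrier A \<and> rgt e x \<in> carrier A},
      monoid.mult = (\<lambda>x y. e (lft e x \<otimes>\<^bsub>A\<^esub> lft e y)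
        (par A C (lft e x) \<otimes>\<^bsub>A\<^esub> rgt e y \<oplus>\<^bsub>A\<^esub> rgt e x \<otimes>\<^bsub>A\<^esub> lft e y)),
      one = e \<one>\<^bsub>A\<^esub> \<zero>\<^bsub>A\<^esub>,
      zero = e \<zero>\<^bsub>A\<^esub> \<zero>\<^bsub>A\<^esub>,
      add = (\<lambda>x y. e (lft e x \<oplus>\<^bsub>A\<^esub> lft e y) (rgt e x \<oplus>\<^bsub>A\<^esub> rgt e y)),
      smult = (\<lambda>r x. e (r \<odot>\<^bsub>A\<^esub> lft e x) (r \<odot>\<^bsub>A\<^esub> rgt e x))\<rparr>"

text \<open>The parameter \<open>d\<close> is the degree of \<epsilon>, hence the shift in the
  degree of its coefficient.\<close>

definition ext_part :: "('f \<Rightarrow> 'f \<Rightarrow> 'g) \<Rightarrow> int \<Rightarrow> (int \<Rightarrow> 'f set) \<Rightarrow> int \<Rightarrow> 'g set" where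
  "ext_part e d C k = {x. lft e x \<in> C k \<and> rgt e x \<in> C (k - d)}"

lemma ext_alg_simps [simp]:
  "x \<in> carrier (ext_alg e A C) \<longleftrightarrow> lft e x \<in> carrier A \<and> rgt e x \<in> carrier A"
  "x \<otimes>\<^bsub>ext_alg e A C\<^esub> y = e (lft e x \<otimes>\<^bsub>A\<^esub> lft e y)
        (par A C (lft e x) \<otimes>\<^bsub>A\<^esub> rgt e y \<oplus>\<^bsub>A\<^esub> rgt e x \<otimes>\<^bsub>A\<^esub> lft e y)"
  "\<one>\<^bsub>ext_alg e A C\<^esub> = e \<one>\<^bsub>A\<^esub> \<zero>\<^bsub>A\<^esub>"
  "\<zero>\<^bsub>ext_alg e A C\<^esub> = e \<zero>\<^bsub>A\<^esub> \<zero>\<^bsub>A\<^esub>"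
  "x \<oplus>\<^bsub>ext_alg e A C\<^esub> y = e (lft e x \<oplus>\<^bsub>A\<^esub> lft e y) (rgt e x \<oplus>\<^bsub>A\<^esub> rgt e y)"
  "r \<odot>\<^bsub>ext_alg e A C\<^esub> x = e (r \<odot>\<^bsub>A\<^esub> lft e x) (r \<odot>\<^bsub>A\<^esub> rgt e x)"
  by (simp_all add: ext_alg_def)

locale galg_ext = galg A C for A :: "(real, 'f) module" (structure) and C +
  fixes e :: "'f \<Rightarrow> 'f \<Rightarrow> 'g" and d :: int
  assumes e: "pairing e"
begin

abbreviation (input) "E \<equiv> ext_alg e A C"

lemma abelian_group_ext: "abelian_group E"
proof (rule abelian_groupI)
  fix x assume "x \<in> carrier E"
  then show "\<exists>y\<in>carrier E. y \<oplus>\<^bsub>E\<^esub> x = \<zero>\<^bsub>E\<^esub>"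
    by (intro bexI[of _ "e (\<ominus> lft e x) (\<ominus> rgt e x)"]) (simp_all add: e l_neg)
qed (auto simp: e a_ac)

lemma ring_ext: "ring E"
proof (rule ringI)
  show "abelian_group E" by (rule abelian_group_ext)
  show "monoid E"
  proof (rule monoidI)
    fix x y z assume "x \<in> carrier E" "y \<in> carrier E" "z \<in> carrier E"
    then show "x \<otimes>\<^bsub>E\<^esub> y \<otimes>\<^bsub>E\<^esub> z = x \<otimes>\<^bsub>E\<^esub> (y \<otimes>\<^bsub>E\<^esub> z)"
      by (simp add: e par_mult l_distr r_distr m_assoc a_ac)
  qed (auto simp: e)
qed (auto simp: e l_distr r_distr par_add a_ac)

lemma module_ext: "Module.module RR E"
proof (rule moduleI)
  show "cring RR" using smod by (simp add: module_def)
  show "abelian_group E" by (rule abelian_group_ext)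
qed (auto simp: e smult_add_left smult_add_right smult_smult)

lemma submodule_ext_part: "submodule (ext_part e d C k) RR E"
proof (rule Module.module.submoduleI[OF module_ext])
  interpret E: ring E by (rule ring_ext)
  fix x assume x: "x \<in> ext_part e d C k"
  then have "\<ominus>\<^bsub>E\<^esub> x = e (\<ominus> lft e x) (\<ominus> rgt e x)"
    using part_sub by (intro E.minus_equality) (auto simp: ext_part_def e l_neg)
  then show "\<ominus>\<^bsub>E\<^esub> x \<in> ext_part e d C k"
    using x by (simp add: ext_part_def e part_neg)
qed (auto simp: ext_part_def e part_add part_smult part_sub)

lemma finsum_ext:
  assumes "finite S" "\<And>k. k \<in> S \<Longrightarrow> c k \<in> carrier E"
  shows "finsum E c S = e (finsum A (\<lambda>k. lft e (c k)) S) (finsum A (\<lambda>k. rgt e (c k)) S)"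
proof -
  interpret E: ring E by (rule ring_ext)
  show ?thesis using assms
  proof (induct S)
    case (insert k S)
    then show ?case
      by (subst E.finsum_insert, simp_all del: ext_alg_simps(1,2,3,4) add: Pi_def)
         (simp add: e finsum_insert Pi_def)
  qed simp
qed

text \<open>A decomposition in \<open>A[\<epsilon>]\<close> carries two decompositions in
  \<open>A\<close>. The coefficients of \<epsilon> have degrees lower by \<open>d\<close>, so their
  index set is shifted along with them.\<close>

lemma graded_family_ext:
  assumes "graded_family E (ext_part e d C) S c"
  shows "graded_family A C S (\<lambda>k. lft e (c k))"
    and "graded_family A C ((\<lambda>k. k - d) ` S) (\<lambda>k. rgt e (c (k + d)))"
    and "finsum E c S = e (finsum A (\<lambda>k. lft e (c k)) S)
           (finsum A (\<lambda>k. rgt e (c (k + d))) ((\<lambda>k. k - d) ` S))"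
proof -
  have c: "lft e (c k) \<in> C k" "rgt e (c k) \<in> C (k - d)" for k
    using assms by (auto simp: graded_family_def ext_part_def)
  show "graded_family A C S (\<lambda>k. lft e (c k))"
    using assms c by (auto simp: graded_family_def e)
  show "graded_family A C ((\<lambda>k. k - d) ` S) (\<lambda>k. rgt e (c (k + d)))"
    unfolding graded_family_def
  proof (intro conjI allI impI)
    fix k show "rgt e (c (k + d)) \<in> C k" using c(2)[of "k + d"] by simp
    assume "k \<notin> (\<lambda>k. k - d) ` S"
    then have "k + d \<notin> S" by force
    then show "rgt e (c (k + d)) = \<zero>" using assms by (simp add: graded_family_def e)
  qed (use assms in \<open>simp add: graded_family_def\<close>)
  have "finsum A (\<lambda>k. rgt e (c (k + d))) ((\<lambda>k. k - d) ` S) = finsum A (\<lambda>k. rgt e (c k)) S"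
    using part_sub[OF c(2)] by (subst finsum_reindex) (auto simp: inj_on_def)
  then show "finsum E c S = e (finsum A (\<lambda>k. lft e (c k)) S)
           (finsum A (\<lambda>k. rgt e (c (k + d))) ((\<lambda>k. k - d) ` S))"
    using assms part_sub[OF c(1)] part_sub[OF c(2)]
    by (subst finsum_ext) (auto simp: graded_family_def)
qed

lemma decomp_ext:
  assumes "x \<in> carrier E"
  shows "\<exists>!c. (\<forall>k. c k \<in> ext_part e d C k) \<and> finite {k. c k \<noteq> \<zero>\<^bsub>E\<^esub>} \<and>
           x = finsum E c {k. c k \<noteq> \<zero>\<^bsub>E\<^esub>}" (is "\<exists>!c. ?P c")
proof -
  interpret E: ring E by (rule ring_ext)
  have P: "?P c" if c: "graded_family E (ext_part e d C) S c" "x = finsum E c S" for S c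
  proof (intro conjI)
    have lr: "lft e (c k) \<in> carrier A" "rgt e (c k) \<in> carrier A" for k
    proof -
      have "c k \<in> ext_part e d C k" using c(1) by (simp add: graded_family_def)
      then show "lft e (c k) \<in> carrier A" "rgt e (c k) \<in> carrier A"
        unfolding ext_part_def by (blast intro: part_sub)+
    qed
    show "\<forall>k. c k \<in> ext_part e d C k" using c by (simp add: graded_family_def)
    show "finite {k. c k \<noteq> \<zero>\<^bsub>E\<^esub>}"
      by (rule finite_subset[of _ S]) (use c in \<open>auto simp: graded_family_def simp del: ext_alg_simps\<close>)
    show "x = finsum E c {k. c k \<noteq> \<zero>\<^bsub>E\<^esub>}"
      unfolding c(2)
    proof (rule E.add.finprod_mono_neutral_cong_right)
      show "finite S" "{k. c k \<noteq> \<zero>\<^bsub>E\<^esub>} \<subseteq> S"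
        using c(1) unfolding graded_family_def by blast+
      show "c k = \<zero>\<^bsub>E\<^esub>" if "k \<in> S - {k. c k \<noteq> \<zero>\<^bsub>E\<^esub>}" for k using that by blast
      show "c \<in> S \<rightarrow> carrier E" by (rule Pi_I) (simp add: lr)
    qed (rule refl)
  qed
  obtain S c where c: "graded_family A C S c" "lft e x = finsum A c S"
    using graded_family_exists[of "lft e x"] assms by auto
  obtain S' c' where c': "graded_family A C S' c'" "rgt e x = finsum A c' S'"
    using graded_family_exists[of "rgt e x"] assms by auto
  \<comment> \<open>A coefficient of \<epsilon> of degree \<open>l\<close> contributes to degree
    \<open>l + d\<close>, so \<open>S'\<close> is moved by \<open>d\<close> before the two index
    sets are united.\<close>
  let ?c = "\<lambda>k. e (c k) (c' (k - d))" and ?S = "S \<union> (\<lambda>k. k + d) ` S'"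
  have fin: "finite S" "finite S'" using c(1) c'(1) by (simp_all add: graded_family_def)
  have fam: "graded_family E (ext_part e d C) ?S ?c"
    unfolding graded_family_def
  proof (intro conjI allI impI)
    fix k
    show "?c k \<in> ext_part e d C k"
      using c(1) c'(1) by (simp add: graded_family_def ext_part_def e)
    assume k: "k \<notin> ?S"
    then have "k - d \<notin> S'" by force
    then show "?c k = \<zero>\<^bsub>E\<^esub>" using c(1) c'(1) k by (simp add: graded_family_def e)
  qed (simp add: fin)
  have cS: "graded_family A C ?S c" using c(1) fin by (simp add: graded_family_def)
  have cx: "finsum A c ?S = lft e x"
    using graded_family_finsum_supp[OF cS] graded_family_finsum_supp[OF c(1)] c(2) by simp
  have cS': "graded_family A C ((\<lambda>k. k - d) ` ?S) c'"
    unfolding graded_family_def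
  proof (intro conjI allI impI)
    fix k assume "k \<notin> (\<lambda>k. k - d) ` ?S"
    moreover have "k \<in> (\<lambda>k. k - d) ` ?S" if "k \<in> S'"
      by (rule image_eqI[of _ _ "k + d"]) (use that in simp_all)
    ultimately have "k \<notin> S'" by blast
    then show "c' k = \<zero>" using c'(1) by (simp add: graded_family_def)
  qed (use c'(1) fin in \<open>simp_all add: graded_family_def\<close>)
  have cx': "finsum A c' ((\<lambda>k. k - d) ` ?S) = rgt e x"
    using graded_family_finsum_supp[OF cS'] graded_family_finsum_supp[OF c'(1)] c'(2) by simp
  have "x = finsum E ?c ?S"
    unfolding graded_family_ext(3)[OF fam] using cx cx' by (simp add: e)
  then have "?P ?c" by (rule P[OF fam])
  moreover have "a = b" if a: "?P a" and b: "?P b" for a b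
  proof -
    let ?A = "{k. a k \<noteq> \<zero>\<^bsub>E\<^esub>}" and ?B = "{k. b k \<noteq> \<zero>\<^bsub>E\<^esub>}"
    have fa: "graded_family E (ext_part e d C) ?A a"
      using a unfolding graded_family_def by blast
    have fb: "graded_family E (ext_part e d C) ?B b"
      using b unfolding graded_family_def by blast
    have ab: "finsum E a ?A = finsum E b ?B"
      by (rule trans[OF sym]) (use a b in blast)+
    note ab' = ab[unfolded graded_family_ext(3)[OF fa] graded_family_ext(3)[OF fb] pairing_inject[OF e]]
    have lk: "lft e (a k) = lft e (b k)" for k
      using graded_family_unique[OF graded_family_ext(1)[OF fa] graded_family_ext(1)[OF fb] conjunct1[OF ab']]
      unfolding fun_eq_iff by blast
    have rk: "rgt e (a (k + d)) = rgt e (b (k + d))" for k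
      using graded_family_unique[OF graded_family_ext(2)[OF fa] graded_family_ext(2)[OF fb] conjunct2[OF ab']]
      unfolding fun_eq_iff by blast
    have "a k = b k" for k
      unfolding pairing_eq_iff[OF e, of "a k"] using lk[of k] rk[of "k - d"] by simp
    then show "a = b" by (rule ext)
  qed
  ultimately show ?thesis by (rule ex_ex1I[OF exI])
qed

lemma galg_ext: "galg E (ext_part e d C)"
proof (intro galg.intro galg_axioms.intro ring_ext module_ext submodule_ext_part decomp_ext)
  show "\<one>\<^bsub>E\<^esub> \<in> ext_part e d C 0" by (simp add: ext_part_def e part_one)
  fix k l x y assume "x \<in> ext_part e d C k" "y \<in> ext_part e d C l"
  then have xy: "lft e x \<in> C k" "rgt e x \<in> C (k - d)" "lft e y \<in> C l" "rgt e y \<in> C (l - d)"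
    by (simp_all add: ext_part_def)
  have "par A C (lft e x) \<otimes> rgt e y \<in> C (k + (l - d))" "rgt e x \<otimes> lft e y \<in> C (k - d + l)"
    using part_mult[OF par_part_closed[OF xy(1)] xy(4)] part_mult[OF xy(2,3)] by auto
  then show "x \<otimes>\<^bsub>E\<^esub> y \<in> ext_part e d C (k + l)"
    using part_mult[OF xy(1,3)] by (simp add: ext_part_def e part_add algebra_simps)
qed (auto simp: e smult_mult_left smult_mult_right smult_add_right par_smult)

end

text \<open>Functoriality of \<open>A[\<epsilon>]\<close>, used for restriction maps. Products are
  respected because \<open>h\<close> preserves degrees and hence commutes with
  \<open>par\<close>.\<close>

lemma graded_hom_ext:
  assumes "galg A C" "galg B D" "graded_hom A C B D h" "pairing e" "pairing e'"
  shows "graded_hom (ext_alg e A C) (ext_part e d C) (ext_alg e' B D) (ext_part e' d D)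
           (\<lambda>x. e' (h (lft e x)) (h (rgt e x)))"
proof -
  interpret A: galg_ext A C e d by (intro galg_ext.intro galg_ext_axioms.intro assms)
  interpret B: galg_ext B D e' d by (intro galg_ext.intro galg_ext_axioms.intro assms)
  have h: "h \<in> ring_hom A B" "\<And>r x. x \<in> carrier A \<Longrightarrow> h (r \<odot>\<^bsub>A\<^esub> x) = r \<odot>\<^bsub>B\<^esub> h x"
    "\<And>k x. x \<in> C k \<Longrightarrow> h x \<in> D k"
    using assms(3) by (auto simp: graded_hom_def image_subset_iff)
  note hs = ring_hom_closed[OF h(1)] ring_hom_add[OF h(1)] ring_hom_mult[OF h(1)] ring_hom_one[OF h(1)]
    ring_hom_zero[OF h(1) A.ring_axioms B.ring_axioms] h(2)
  show ?thesis
    unfolding graded_hom_def ring_hom_def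
    using h(3) by (auto simp: hs assms graded_hom_par[OF assms(1-3), symmetric] ext_part_def)
qed

section \<open>Adjoining an odd variable to a space\<close>

text \<open>Moves invertibility in a quotient back to representatives, so that quotients of
  different rings can be compared. The rings here are noncommutative, hence the two conditions on
  \<open>g\<close>.\<close>

lemma (in ring) coset_unit_iff:
  assumes I: "ideal I R" and f: "f \<in> carrier R"
  shows "I +> f \<in> Units (R Quot I) \<longleftrightarrow> (\<exists>g\<in>carrier R. f \<otimes> g \<ominus> \<one> \<in> I \<and> g \<otimes> f \<ominus> \<one> \<in> I)"
proof -
  interpret I: ideal I R by fact
  have carr: "carrier (R Quot I) = (\<lambda>x. I +> x) ` carrier R"
    by (auto simp: FactRing_def A_RCOSETS_def')
  have "I +> f \<in> Units (R Quot I) \<longleftrightarrow>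
      (\<exists>g\<in>carrier R. (I +> g) \<otimes>\<^bsub>R Quot I\<^esub> (I +> f) = \<one>\<^bsub>R Quot I\<^esub> \<and> (I +> f) \<otimes>\<^bsub>R Quot I\<^esub> (I +> g) = \<one>\<^bsub>R Quot I\<^esub>)"
    using f by (auto simp: Units_def carr)
  also have "\<dots> \<longleftrightarrow> (\<exists>g\<in>carrier R. I +> (g \<otimes> f) = I +> \<one> \<and> I +> (f \<otimes> g) = I +> \<one>)"
    using f by (simp add: FactRing_def I.rcoset_mult_add)
  also have "\<dots> \<longleftrightarrow> (\<exists>g\<in>carrier R. f \<otimes> g \<ominus> \<one> \<in> I \<and> g \<otimes> f \<ominus> \<one> \<in> I)"
    using f quotient_eq_iff_same_a_r_cos[OF I] by (intro bex_cong) auto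
  finally show ?thesis .
qed

section \<open>The quotient by the ideal of nonzero degrees, before and after adjoining
  \<epsilon>\<close>

context galg_ext
begin

lemma neg_ext:
  assumes "x \<in> carrier E"
  shows "\<ominus>\<^bsub>E\<^esub> x = e (\<ominus> lft e x) (\<ominus> rgt e x)"
proof -
  interpret E: ring E by (rule ring_ext)
  show ?thesis using assms by (intro E.minus_equality) (auto simp: e l_neg)
qed

lemma minus_ext:
  "y \<in> carrier E \<Longrightarrow> x \<ominus>\<^bsub>E\<^esub> y = e (lft e x \<ominus> lft e y) (rgt e x \<ominus> rgt e y)"
  by (simp add: a_minus_def[of E] neg_ext e) (simp add: a_minus_def)

text \<open>Since \<epsilon> has degree \<open>d \<noteq> 0\<close>, it is one of the generators,
  and all its multiples lie in the ideal. So the ideal restricts only the \<epsilon>-free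
  coefficient, and \<open>A[\<epsilon>]\<close> and \<open>A\<close> have the same quotient.\<close>

lemma ideal_generated_ext:
  assumes d: "d \<noteq> 0"
  shows "Idl\<^bsub>E\<^esub> (\<Union>k\<in>-{0}. ext_part e d C k) = {x \<in> carrier E. lft e x \<in> Idl (\<Union>k\<in>-{0}. C k)}"
    (is "?J = ?K")
proof
  interpret E: galg E "ext_part e d C" by (rule galg_ext)
  let ?I = "Idl (\<Union>k\<in>-{0}. C k)"
  have EI: "(\<Union>k\<in>-{0}. C k) \<subseteq> carrier A" using part_sub by blast
  note genI = genideal_self[OF EI] and idI = genideal_ideal[OF EI]
  interpret I: ideal ?I A by (rule idI)
  have EJ: "(\<Union>k\<in>-{0}. ext_part e d C k) \<subseteq> carrier E" using E.part_sub by blast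
  note genJ = E.genideal_self[OF EJ] and idJ = E.genideal_ideal[OF EJ]
  interpret J: ideal ?J E by (rule idJ)
  have "ideal ?K E"
  proof (rule idealI)
    show "ring E" by (rule ring_ext)
    show "subgroup ?K (add_monoid E)"
    proof (rule E.add.subgroupI)
      show "?K \<noteq> {}" using I.zero_closed by (auto intro!: exI[of _ "e \<zero> \<zero>"] simp: e)
      fix x assume x: "x \<in> ?K"
      then show "\<ominus>\<^bsub>E\<^esub> x \<in> ?K"
        by (subst neg_ext) (auto simp: e I.a_inv_closed)
    qed (auto simp: e I.a_closed)
  qed (auto simp: e I.I_l_closed I.I_r_closed)
  moreover have "(\<Union>k\<in>-{0}. ext_part e d C k) \<subseteq> ?K"
    using genI EJ by (auto simp: ext_part_def)
  ultimately show "?J \<subseteq> ?K" by (rule E.genideal_minimal)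
  \<comment> \<open>The \<epsilon>-free elements of \<open>?J\<close> form an ideal of
    \<open>A\<close> that contains all generators, hence the whole of \<open>?I\<close>.\<close>
  have "ideal {x \<in> carrier A. e x \<zero> \<in> ?J} A"
  proof (rule idealI)
    show "ring A" by (rule ring_axioms)
    show "subgroup {x \<in> carrier A. e x \<zero> \<in> ?J} (add_monoid A)"
    proof (rule add.subgroupI)
      show "{x \<in> carrier A. e x \<zero> \<in> ?J} \<noteq> {}"
        using J.zero_closed by (auto intro!: exI[of _ "\<zero>"])
      fix x assume x: "x \<in> {x \<in> carrier A. e x \<zero> \<in> ?J}"
      then have "\<ominus>\<^bsub>E\<^esub> e x \<zero> \<in> ?J" by (intro J.a_inv_closed) auto
      then show "\<ominus> x \<in> {x \<in> carrier A. e x \<zero> \<in> ?J}"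
        using x by (subst (asm) neg_ext) (auto simp: e)
    next
      fix x y assume xy: "x \<in> {x \<in> carrier A. e x \<zero> \<in> ?J}" "y \<in> {x \<in> carrier A. e x \<zero> \<in> ?J}"
      then have "e x \<zero> \<oplus>\<^bsub>E\<^esub> e y \<zero> \<in> ?J" by (intro J.a_closed) auto
      then show "x \<oplus> y \<in> {x \<in> carrier A. e x \<zero> \<in> ?J}" using xy by (simp add: e)
    qed auto
  next
    fix a x assume ax: "a \<in> {x \<in> carrier A. e x \<zero> \<in> ?J}" "x \<in> carrier A"
    then have J: "e a \<zero> \<in> ?J" and E: "e x \<zero> \<in> carrier E" by (auto simp: e)
    note J.I_l_closed[OF J E] J.I_r_closed[OF J E]
    then show "x \<otimes> a \<in> {x \<in> carrier A. e x \<zero> \<in> ?J}" "a \<otimes> x \<in> {x \<in> carrier A. e x \<zero> \<in> ?J}"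
      using ax by (simp_all add: e)
  qed
  moreover have "(\<Union>k\<in>-{0}. C k) \<subseteq> {x \<in> carrier A. e x \<zero> \<in> ?J}"
  proof
    fix x assume "x \<in> (\<Union>k\<in>-{0}. C k)"
    then obtain k where k: "k \<noteq> 0" "x \<in> C k" by auto
    then have "e x \<zero> \<in> ext_part e d C k" by (simp add: ext_part_def e)
    then show "x \<in> {x \<in> carrier A. e x \<zero> \<in> ?J}" using k genJ part_sub by blast
  qed
  ultimately have IJ: "?I \<subseteq> {x \<in> carrier A. e x \<zero> \<in> ?J}" by (rule genideal_minimal)
  have "e \<zero> \<one> \<in> ext_part e d C d" using part_one by (simp add: ext_part_def e)
  then have eps: "e \<zero> \<one> \<in> ?J" using d genJ by blast
  show "?K \<subseteq> ?J"
  proof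
    fix x assume x: "x \<in> ?K"
    then have x1: "e (lft e x) \<zero> \<in> ?J" using IJ by blast
    \<comment> \<open>This is \<epsilon> times its coefficient in \<open>x\<close>; there is no
      sign, because \<epsilon> already stands in front.\<close>
    have "e \<zero> \<one> \<otimes>\<^bsub>E\<^esub> e (rgt e x) \<zero> \<in> ?J"
      using x eps by (intro J.I_r_closed) (auto simp: e)
    then have "e (lft e x) \<zero> \<oplus>\<^bsub>E\<^esub> e \<zero> (rgt e x) \<in> ?J"
      using x x1 by (intro J.a_closed) (auto simp: e)
    then show "x \<in> ?J" using x by (simp add: e)
  qed
qed

end

text \<open>For odd \<open>d\<close> this is the product of \<open>S\<close> with a line whose
  support is a point and whose only coordinate \<epsilon> has degree \<open>d\<close>.\<close>

definition ext_space :: "('f \<Rightarrow> 'f \<Rightarrow> 'g) \<Rightarrow> int \<Rightarrow> ('x, 'f) gspace \<Rightarrow> ('x, 'g) gspace" where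
  "ext_space e d S =
     \<lparr>supp = supp S,
      sect = (\<lambda>U. ext_alg e (sect S U) (gpart S U)),
      gpart = (\<lambda>U. ext_part e d (gpart S U)),
      res = (\<lambda>U V x. e (res S U V (lft e x)) (res S U V (rgt e x)))\<rparr>"

lemma ext_space_simps [simp]:
  "supp (ext_space e d S) = supp S"
  "sect (ext_space e d S) U = ext_alg e (sect S U) (gpart S U)"
  "gpart (ext_space e d S) U = ext_part e d (gpart S U)"
  "res (ext_space e d S) U V x = e (res S U V (lft e x)) (res S U V (rgt e x))"
  by (simp_all add: ext_space_def)

lemma presheaf_galg: "\<lbrakk>graded_presheaf S; openin (supp S) U\<rbrakk> \<Longrightarrow> galg (sect S U) (gpart S U)"
  by (simp add: graded_presheaf_def graded_algebra_iff_galg)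

lemma presheaf_res_hom:
  "\<lbrakk>graded_presheaf S; openin (supp S) U; openin (supp S) V; V \<subseteq> U\<rbrakk> \<Longrightarrow>
     graded_hom (sect S U) (gpart S U) (sect S V) (gpart S V) (res S U V)"
  by (simp add: graded_presheaf_def)

lemma graded_hom_closed: "\<lbrakk>graded_hom A C B D h; x \<in> carrier A\<rbrakk> \<Longrightarrow> h x \<in> carrier B"
  by (auto simp: graded_hom_def ring_hom_def)

lemma graded_hom_zero: "\<lbrakk>graded_hom A C B D h; galg A C; galg B D\<rbrakk> \<Longrightarrow> h \<zero>\<^bsub>A\<^esub> = \<zero>\<^bsub>B\<^esub>"
  by (auto simp: graded_hom_def galg_def intro: ring_hom_zero)

lemma graded_hom_minus:
  assumes "graded_hom A C B D h" "galg A C" "galg B D" "x \<in> carrier A" "y \<in> carrier A"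
  shows "h (x \<ominus>\<^bsub>A\<^esub> y) = h x \<ominus>\<^bsub>B\<^esub> h y"
proof -
  interpret ring_hom_ring A B h
    using assms by (auto simp: graded_hom_def galg_def intro: ring_hom_ringI2)
  show ?thesis using assms by (simp add: a_minus_def)
qed

lemma graded_presheaf_ext:
  assumes S: "graded_presheaf S" and e: "pairing e"
  shows "graded_presheaf (ext_space e d S)"
  unfolding graded_presheaf_def
proof (intro conjI allI impI; (elim conjE)?)
  fix U assume U: "openin (supp (ext_space e d S)) U"
  then have "galg (sect S U) (gpart S U)" using presheaf_galg[OF S] by simp
  then interpret galg_ext "sect S U" "gpart S U" e d
    by (intro galg_ext.intro galg_ext_axioms.intro e)
  show "graded_algebra (sect (ext_space e d S) U) (gpart (ext_space e d S) U)"
    using galg_ext by (simp add: graded_algebra_iff_galg)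
  show "\<forall>f\<in>carrier (sect (ext_space e d S) U). res (ext_space e d S) U U f = f"
    using S U e by (simp add: graded_presheaf_def)
next
  fix U V assume "openin (supp (ext_space e d S)) U" "openin (supp (ext_space e d S)) V" "V \<subseteq> U"
  then show "graded_hom (sect (ext_space e d S) U) (gpart (ext_space e d S) U)
      (sect (ext_space e d S) V) (gpart (ext_space e d S) V) (res (ext_space e d S) U V)"
    using graded_hom_ext[OF presheaf_galg[OF S] presheaf_galg[OF S] presheaf_res_hom[OF S] e e, of U V d]
    by (simp add: ext_space_def)
next
  fix U V W
  assume "openin (supp (ext_space e d S)) U" "openin (supp (ext_space e d S)) V"
    "openin (supp (ext_space e d S)) W" "V \<subseteq> U" "W \<subseteq> V"
  then show "\<forall>f\<in>carrier (sect (ext_space e d S) U). res (ext_space e d S) V W (res (ext_space e d S) U V f) =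
      res (ext_space e d S) U W f"
    using S by (simp add: graded_presheaf_def e)
qed

text \<open>Gluing in degree \<open>k\<close> amounts to gluing the two coefficients separately, in
  the degrees \<open>k\<close> and \<open>k - d\<close>.\<close>

lemma graded_sheaf_ext:
  assumes S: "graded_sheaf S" and e: "pairing e"
  shows "graded_sheaf (ext_space e d S)"
  unfolding graded_sheaf_def
proof (intro conjI allI impI)
  show "graded_presheaf (ext_space e d S)"
    using S e by (simp add: graded_sheaf_def graded_presheaf_ext)
  fix \<U> k s
  assume "(\<forall>U\<in>\<U>. openin (supp (ext_space e d S)) U \<and> s U \<in> gpart (ext_space e d S) U k) \<and>
    (\<forall>U\<in>\<U>. \<forall>V\<in>\<U>. res (ext_space e d S) U (U \<inter> V) (s U) = res (ext_space e d S) V (U \<inter> V) (s V))"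
  note * = this[unfolded ext_space_simps pairing_inject[OF e] ext_part_def mem_Collect_eq]
  have *: "\<forall>U\<in>\<U>. openin (supp S) U \<and> lft e (s U) \<in> gpart S U k"
      "\<forall>U\<in>\<U>. openin (supp S) U \<and> rgt e (s U) \<in> gpart S U (k - d)"
      "\<forall>U\<in>\<U>. \<forall>V\<in>\<U>. res S U (U \<inter> V) (lft e (s U)) = res S V (U \<inter> V) (lft e (s V))"
      "\<forall>U\<in>\<U>. \<forall>V\<in>\<U>. res S U (U \<inter> V) (rgt e (s U)) = res S V (U \<inter> V) (rgt e (s V))"
    using * by blast+
  have glue: "\<exists>!f. f \<in> gpart S (\<Union>\<U>) k \<and> (\<forall>U\<in>\<U>. res S (\<Union>\<U>) U f = s U)"
    if "\<forall>U\<in>\<U>. openin (supp S) U \<and> s U \<in> gpart S U k"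
      "\<forall>U\<in>\<U>. \<forall>V\<in>\<U>. res S U (U \<inter> V) (s U) = res S V (U \<inter> V) (s V)" for s k
    by (rule S[unfolded graded_sheaf_def, THEN conjunct2, THEN spec, THEN spec, THEN spec, THEN mp])
      (use that in blast)
  obtain f where f: "f \<in> gpart S (\<Union>\<U>) k" "\<forall>U\<in>\<U>. res S (\<Union>\<U>) U f = lft e (s U)"
    and f': "\<And>f'. f' \<in> gpart S (\<Union>\<U>) k \<Longrightarrow> \<forall>U\<in>\<U>. res S (\<Union>\<U>) U f' = lft e (s U) \<Longrightarrow> f' = f"
    using glue[OF *(1,3)] by blast
  obtain g where g: "g \<in> gpart S (\<Union>\<U>) (k - d)" "\<forall>U\<in>\<U>. res S (\<Union>\<U>) U g = rgt e (s U)"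
    and g': "\<And>f'. f' \<in> gpart S (\<Union>\<U>) (k - d) \<Longrightarrow> \<forall>U\<in>\<U>. res S (\<Union>\<U>) U f' = rgt e (s U) \<Longrightarrow> f' = g"
    using glue[OF *(2,4)] by blast
  show "\<exists>!f. f \<in> gpart (ext_space e d S) (\<Union>\<U>) k \<and> (\<forall>U\<in>\<U>. res (ext_space e d S) (\<Union>\<U>) U f = s U)"
  proof (rule ex1I)
    show "e f g \<in> gpart (ext_space e d S) (\<Union>\<U>) k \<and> (\<forall>U\<in>\<U>. res (ext_space e d S) (\<Union>\<U>) U (e f g) = s U)"
      using f g by (simp add: e ext_part_def)
    fix h assume h: "h \<in> gpart (ext_space e d S) (\<Union>\<U>) k \<and> (\<forall>U\<in>\<U>. res (ext_space e d S) (\<Union>\<U>) U h = s U)"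
    have hp: "lft e h \<in> gpart S (\<Union>\<U>) k" "rgt e h \<in> gpart S (\<Union>\<U>) (k - d)"
      using h by (simp_all add: ext_part_def)
    have hU: "res S (\<Union>\<U>) U (lft e h) = lft e (s U) \<and> res S (\<Union>\<U>) U (rgt e h) = rgt e (s U)"
      if "U \<in> \<U>" for U
    proof -
      have "e (res S (\<Union>\<U>) U (lft e h)) (res S (\<Union>\<U>) U (rgt e h)) = s U" using h that by simp
      from arg_cong[OF this, of "lft e"] arg_cong[OF this, of "rgt e"] show ?thesis by (simp add: e)
    qed
    have "lft e h = f"
      by (rule f') (use hp hU in blast)+
    moreover have "rgt e h = g"
      by (rule g') (use hp hU in blast)+
    ultimately show "h = e f g" by (simp add: pairing_eq_iff[OF e, of h] e)
  qed
qed

text \<open>By \<open>coset_unit_iff\<close>, invertibility is a matter of membership in the ideals,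
  and membership depends on the \<epsilon>-free coefficient alone. An inverse of that coefficient
  therefore serves for the whole section.\<close>

lemma ev_unit_ext:
  assumes S: "graded_presheaf S" and e: "pairing e" and d: "d \<noteq> 0"
    and W: "openin (supp S) W" and f: "f \<in> carrier (sect (ext_space e d S) W)"
  shows "ev (ext_space e d S) W f \<in> Units (body_alg (ext_space e d S) W) \<longleftrightarrow>
     ev S W (lft e f) \<in> Units (body_alg S W)"
proof -
  let ?A = "sect S W" and ?C = "gpart S W"
  interpret galg_ext ?A ?C e d
    using presheaf_galg[OF S W] by (intro galg_ext.intro galg_ext_axioms.intro e)
  interpret E: galg "ext_alg e ?A ?C" "ext_part e d ?C" by (rule galg_ext)
  have "(\<Union>k\<in>-{0}. ?C k) \<subseteq> carrier ?A" using part_sub by blast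
  then have I: "ideal (nz_ideal S W) ?A" unfolding nz_ideal_def by (rule genideal_ideal)
  have "(\<Union>k\<in>-{0}. ext_part e d ?C k) \<subseteq> carrier (ext_alg e ?A ?C)" using E.part_sub by blast
  then have J: "ideal (nz_ideal (ext_space e d S) W) (ext_alg e ?A ?C)"
    unfolding nz_ideal_def ext_space_simps by (rule E.genideal_ideal)
  have IJ: "nz_ideal (ext_space e d S) W = {x \<in> carrier (ext_alg e ?A ?C). lft e x \<in> nz_ideal S W}"
    unfolding nz_ideal_def ext_space_simps by (rule ideal_generated_ext[OF d])
  have f': "f \<in> carrier (ext_alg e ?A ?C)" using f by simp
  have J_iff: "x \<otimes>\<^bsub>ext_alg e ?A ?C\<^esub> y \<ominus>\<^bsub>ext_alg e ?A ?C\<^esub> \<one>\<^bsub>ext_alg e ?A ?C\<^esub> \<in> nz_ideal (ext_space e d S) W \<longleftrightarrow>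
      lft e x \<otimes>\<^bsub>?A\<^esub> lft e y \<ominus>\<^bsub>?A\<^esub> \<one>\<^bsub>?A\<^esub> \<in> nz_ideal S W"
    if "x \<in> carrier (ext_alg e ?A ?C)" "y \<in> carrier (ext_alg e ?A ?C)" for x y
    unfolding IJ using that by (subst minus_ext) (auto simp: e minus_ext)
  show ?thesis
    unfolding ev_def body_alg_def ext_space_simps E.coset_unit_iff[OF J f']
      coset_unit_iff[OF I, of "lft e f", OF f'[unfolded ext_alg_simps, THEN conjunct1]]
  proof
    assume "\<exists>g\<in>carrier (ext_alg e ?A ?C).
      f \<otimes>\<^bsub>ext_alg e ?A ?C\<^esub> g \<ominus>\<^bsub>ext_alg e ?A ?C\<^esub> \<one>\<^bsub>ext_alg e ?A ?C\<^esub> \<in> nz_ideal (ext_space e d S) W \<and>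
      g \<otimes>\<^bsub>ext_alg e ?A ?C\<^esub> f \<ominus>\<^bsub>ext_alg e ?A ?C\<^esub> \<one>\<^bsub>ext_alg e ?A ?C\<^esub> \<in> nz_ideal (ext_space e d S) W"
    then obtain g where g: "g \<in> carrier (ext_alg e ?A ?C)"
      "f \<otimes>\<^bsub>ext_alg e ?A ?C\<^esub> g \<ominus>\<^bsub>ext_alg e ?A ?C\<^esub> \<one>\<^bsub>ext_alg e ?A ?C\<^esub> \<in> nz_ideal (ext_space e d S) W"
      "g \<otimes>\<^bsub>ext_alg e ?A ?C\<^esub> f \<ominus>\<^bsub>ext_alg e ?A ?C\<^esub> \<one>\<^bsub>ext_alg e ?A ?C\<^esub> \<in> nz_ideal (ext_space e d S) W" by blast
    show "\<exists>g\<in>carrier ?A. lft e f \<otimes>\<^bsub>?A\<^esub> g \<ominus>\<^bsub>?A\<^esub> \<one>\<^bsub>?A\<^esub> \<in> nz_ideal S W \<and>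
        g \<otimes>\<^bsub>?A\<^esub> lft e f \<ominus>\<^bsub>?A\<^esub> \<one>\<^bsub>?A\<^esub> \<in> nz_ideal S W"
      using g(2,3)[unfolded J_iff[OF f' g(1)] J_iff[OF g(1) f']] g(1) by (intro bexI[of _ "lft e g"]) auto
  next
    assume "\<exists>g\<in>carrier ?A. lft e f \<otimes>\<^bsub>?A\<^esub> g \<ominus>\<^bsub>?A\<^esub> \<one>\<^bsub>?A\<^esub> \<in> nz_ideal S W \<and>
        g \<otimes>\<^bsub>?A\<^esub> lft e f \<ominus>\<^bsub>?A\<^esub> \<one>\<^bsub>?A\<^esub> \<in> nz_ideal S W"
    then obtain g where g: "g \<in> carrier ?A" "lft e f \<otimes>\<^bsub>?A\<^esub> g \<ominus>\<^bsub>?A\<^esub> \<one>\<^bsub>?A\<^esub> \<in> nz_ideal S W"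
        "g \<otimes>\<^bsub>?A\<^esub> lft e f \<ominus>\<^bsub>?A\<^esub> \<one>\<^bsub>?A\<^esub> \<in> nz_ideal S W" by blast
    have g': "e g \<zero>\<^bsub>?A\<^esub> \<in> carrier (ext_alg e ?A ?C)" using g(1) by (simp add: e)
    show "\<exists>g\<in>carrier (ext_alg e ?A ?C).
      f \<otimes>\<^bsub>ext_alg e ?A ?C\<^esub> g \<ominus>\<^bsub>ext_alg e ?A ?C\<^esub> \<one>\<^bsub>ext_alg e ?A ?C\<^esub> \<in> nz_ideal (ext_space e d S) W \<and>
      g \<otimes>\<^bsub>ext_alg e ?A ?C\<^esub> f \<ominus>\<^bsub>ext_alg e ?A ?C\<^esub> \<one>\<^bsub>ext_alg e ?A ?C\<^esub> \<in> nz_ideal (ext_space e d S) W"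
      by (rule bexI[OF _ g'], unfold J_iff[OF f' g'] J_iff[OF g' f'])
        (use g in \<open>simp add: e\<close>)
  qed
qed

text \<open>The value at a point is read off from invertibility, which does not see the coefficient
  of \<epsilon>.\<close>

lemma ev_fun_ext:
  assumes S: "graded_presheaf S" and e: "pairing e" and d: "d \<noteq> 0"
    and U: "openin (supp S) U" and f: "f \<in> carrier (sect (ext_space e d S) U)"
  shows "ev_fun (ext_space e d S) U f x = ev_fun S U (lft e f) x"
proof -
  let ?T = "ext_space e d S"
  have "ev ?T W (res ?T U W f \<ominus>\<^bsub>sect ?T W\<^esub> r \<odot>\<^bsub>sect ?T W\<^esub> \<one>\<^bsub>sect ?T W\<^esub>) \<in> Units (body_alg ?T W) \<longleftrightarrow>
      ev S W (res S U W (lft e f) \<ominus>\<^bsub>sect S W\<^esub> r \<odot>\<^bsub>sect S W\<^esub> \<one>\<^bsub>sect S W\<^esub>) \<in> Units (body_alg S W)"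
    if W: "openin (supp S) W" "W \<subseteq> U" for W r
  proof -
    interpret galg_ext "sect S W" "gpart S W" e d
      using presheaf_galg[OF S W(1)] by (intro galg_ext.intro galg_ext_axioms.intro e)
    have cl: "res S U W g \<in> carrier (sect S W)" if "g \<in> carrier (sect S U)" for g
      using graded_hom_closed[OF presheaf_res_hom[OF S U W] that] .
    have m: "res ?T U W f \<ominus>\<^bsub>sect ?T W\<^esub> r \<odot>\<^bsub>sect ?T W\<^esub> \<one>\<^bsub>sect ?T W\<^esub> =
        e (res S U W (lft e f) \<ominus>\<^bsub>sect S W\<^esub> r \<odot>\<^bsub>sect S W\<^esub> \<one>\<^bsub>sect S W\<^esub>)
          (res S U W (rgt e f) \<ominus>\<^bsub>sect S W\<^esub> r \<odot>\<^bsub>sect S W\<^esub> \<zero>\<^bsub>sect S W\<^esub>)"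
      using f cl unfolding ext_space_simps by (subst minus_ext) (auto simp: e)
    show ?thesis
      unfolding m using f cl by (subst ev_unit_ext[OF S e d W(1)]) (auto simp: e)
  qed
  then show ?thesis unfolding ev_fun_def ext_space_simps(1) by (simp del: ext_space_simps cong: imp_cong)
qed

lemma smooth_fun_ext:
  assumes S: "graded_presheaf S" and e: "pairing e" and d: "d \<noteq> 0"
  shows "smooth_fun (ext_space e d S) W g \<longleftrightarrow> smooth_fun S W g"
proof -
  have "(\<exists>f\<in>carrier (sect (ext_space e d S) U). \<forall>y\<in>U. g y = ev_fun (ext_space e d S) U f y) \<longleftrightarrow>
      (\<exists>f\<in>carrier (sect S U). \<forall>y\<in>U. g y = ev_fun S U f y)" if U: "openin (supp S) U" for U
  proof -
    interpret galg "sect S U" "gpart S U" by (rule presheaf_galg[OF S U])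
    show ?thesis
    proof
      assume "\<exists>f\<in>carrier (sect (ext_space e d S) U). \<forall>y\<in>U. g y = ev_fun (ext_space e d S) U f y"
      then obtain f where f: "f \<in> carrier (sect (ext_space e d S) U)"
        "\<forall>y\<in>U. g y = ev_fun (ext_space e d S) U f y" by blast
      then show "\<exists>f\<in>carrier (sect S U). \<forall>y\<in>U. g y = ev_fun S U f y"
        using ev_fun_ext[OF S e d U f(1)] by (intro bexI[of _ "lft e f"]) auto
    next
      assume "\<exists>f\<in>carrier (sect S U). \<forall>y\<in>U. g y = ev_fun S U f y"
      then obtain f where f: "f \<in> carrier (sect S U)" "\<forall>y\<in>U. g y = ev_fun S U f y" by blast
      then have f': "e f \<zero>\<^bsub>sect S U\<^esub> \<in> carrier (sect (ext_space e d S) U)" by (simp add: e)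
      show "\<exists>f\<in>carrier (sect (ext_space e d S) U). \<forall>y\<in>U. g y = ev_fun (ext_space e d S) U f y"
        using ev_fun_ext[OF S e d U f'] f by (intro bexI[OF _ f']) (simp add: e)
    qed
  qed
  then show ?thesis unfolding smooth_fun_def by (simp del: ext_space_simps(2) cong: conj_cong)
qed

section \<open>Morphisms and derivations along morphisms\<close>

lemma mk_mor_base [simp]: "x \<in> topspace (supp S) \<Longrightarrow> base (mk_mor S Y b P) x = b x"
  by (simp add: mk_mor_def)

lemma mk_mor_pull [simp]:
  "\<lbrakk>openin (supp Y) V; f \<in> carrier (sect Y V)\<rbrakk> \<Longrightarrow> pull (mk_mor S Y b P) V f = P V f"
  by (simp add: mk_mor_def)

lemma mk_mor_cong:
  assumes "\<And>x. x \<in> topspace (supp S) \<Longrightarrow> b x = b' x"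
    and "\<And>V f. \<lbrakk>openin (supp Y) V; f \<in> carrier (sect Y V)\<rbrakk> \<Longrightarrow> P V f = P' V f"
  shows "mk_mor S Y b P = mk_mor S Y b' P'"
  using assms unfolding mk_mor_def by (auto intro!: restrict_ext ext)

lemma mk_mor_idem [simp]:
  "mk_mor S Y (base (mk_mor S Y b P)) (pull (mk_mor S Y b P)) = mk_mor S Y b P"
  by (rule mk_mor_cong) auto

lemma preim_mk_mor: "preim S (mk_mor S Y b P) V = {x \<in> topspace (supp S). b x \<in> V}"
  by (auto simp: preim_def mk_mor_def)

context
  fixes S :: "('x, 'f) gspace" and Y :: "('y, 'g) gspace" and \<mu>
  assumes \<mu>: "graded_morphism S Y \<mu>"
begin

lemma graded_morphism_mk: "\<mu> = mk_mor S Y (base \<mu>) (pull \<mu>)"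
  and graded_morphism_continuous: "continuous_map (supp S) (supp Y) (base \<mu>)"
  and graded_morphism_hom: "openin (supp Y) V \<Longrightarrow>
        graded_hom (sect Y V) (gpart Y V) (sect S (preim S \<mu> V)) (gpart S (preim S \<mu> V)) (pull \<mu> V)"
  and graded_morphism_res: "\<lbrakk>openin (supp Y) U; openin (supp Y) V; V \<subseteq> U; f \<in> carrier (sect Y U)\<rbrakk> \<Longrightarrow>
           pull \<mu> V (res Y U V f) = res S (preim S \<mu> U) (preim S \<mu> V) (pull \<mu> U f)"
  using \<mu> unfolding graded_morphism_def by blast+

lemma graded_morphism_base: "x \<in> topspace (supp S) \<Longrightarrow> base \<mu> x \<in> topspace (supp Y)"
  using graded_morphism_continuous by (auto simp: continuous_map_def)

lemma openin_preim: "openin (supp Y) V \<Longrightarrow> openin (supp S) (preim S \<mu> V)"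
  using graded_morphism_continuous unfolding preim_def by (rule openin_continuous_map_preimage)

lemma preim_topspace: "preim S \<mu> (topspace (supp Y)) = topspace (supp S)"
  using graded_morphism_base by (auto simp: preim_def)

lemma pull_closed: "\<lbrakk>openin (supp Y) V; f \<in> carrier (sect Y V)\<rbrakk> \<Longrightarrow> pull \<mu> V f \<in> carrier (sect S (preim S \<mu> V))"
  by (rule graded_hom_closed[OF graded_morphism_hom])

end

lemma preim_mono: "V \<subseteq> U \<Longrightarrow> preim S \<mu> V \<subseteq> preim S \<mu> U"
  by (auto simp: preim_def)

lemma graded_hom_comp:
  assumes "graded_hom A C B D h" "graded_hom B D E F k"
  shows "graded_hom A C E F (\<lambda>x. k (h x))"
  using assms unfolding graded_hom_def ring_hom_def by (auto simp: image_subset_iff Pi_iff)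

lemma comp_mor_base [simp]:
  "x \<in> topspace (supp S) \<Longrightarrow> base (comp_mor S Y Z \<nu> \<mu>) x = base \<nu> (base \<mu> x)"
  by (simp add: comp_mor_def)

lemma comp_mor_pull [simp]:
  "\<lbrakk>openin (supp Z) V; f \<in> carrier (sect Z V)\<rbrakk> \<Longrightarrow>
     pull (comp_mor S Y Z \<nu> \<mu>) V f = pull \<mu> (preim Y \<nu> V) (pull \<nu> V f)"
  by (simp add: comp_mor_def)

lemma preim_comp:
  "graded_morphism S Y \<mu> \<Longrightarrow> preim S (comp_mor S Y Z \<nu> \<mu>) V = preim S \<mu> (preim Y \<nu> V)"
  using graded_morphism_base[of S Y \<mu>] by (auto simp: preim_def)

text \<open>Pullbacks are made extensional, so they agree with their defining formulas only on
  sections. This is enough, since the homogeneous parts of \<open>A\<close> consist of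
  sections.\<close>

lemma graded_hom_cong:
  assumes A: "galg A C" and h: "graded_hom A C B D h" and eq: "\<And>x. x \<in> carrier A \<Longrightarrow> k x = h x"
  shows "graded_hom A C B D k"
proof -
  interpret galg A C by fact
  show ?thesis
    using h part_sub unfolding graded_hom_def ring_hom_def by (simp add: eq image_subset_iff Pi_iff)
qed

lemma graded_morphism_comp:
  assumes \<mu>: "graded_morphism S Y \<mu>" and \<nu>: "graded_morphism Y Z \<nu>" and Z: "graded_presheaf Z"
  shows "graded_morphism S Z (comp_mor S Y Z \<nu> \<mu>)"
  unfolding graded_morphism_def
proof (intro conjI allI impI ballI; (elim conjE)?)
  show "comp_mor S Y Z \<nu> \<mu> = mk_mor S Z (base (comp_mor S Y Z \<nu> \<mu>)) (pull (comp_mor S Y Z \<nu> \<mu>))"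
    by (simp add: comp_mor_def)
  have "continuous_map (supp S) (supp Z) (\<lambda>x. base \<nu> (base \<mu> x))"
    using continuous_map_compose[OF graded_morphism_continuous[OF \<mu>] graded_morphism_continuous[OF \<nu>]]
    by (simp add: comp_def)
  then show "continuous_map (supp S) (supp Z) (base (comp_mor S Y Z \<nu> \<mu>))"
    by (rule continuous_map_eq) simp
next
  fix V assume V: "openin (supp Z) V"
  have "graded_hom (sect Z V) (gpart Z V) (sect S (preim S \<mu> (preim Y \<nu> V)))
      (gpart S (preim S \<mu> (preim Y \<nu> V))) (\<lambda>f. pull \<mu> (preim Y \<nu> V) (pull \<nu> V f))"
    by (rule graded_hom_comp[OF graded_morphism_hom[OF \<nu> V] graded_morphism_hom[OF \<mu> openin_preim[OF \<nu> V]]])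
  then show "graded_hom (sect Z V) (gpart Z V) (sect S (preim S (comp_mor S Y Z \<nu> \<mu>) V))
      (gpart S (preim S (comp_mor S Y Z \<nu> \<mu>) V)) (pull (comp_mor S Y Z \<nu> \<mu>) V)"
    unfolding preim_comp[OF \<mu>] by (rule graded_hom_cong[OF presheaf_galg[OF Z V]]) (simp add: V)
next
  fix U V f assume UV: "openin (supp Z) U" "openin (supp Z) V" "V \<subseteq> U" and f: "f \<in> carrier (sect Z U)"
  have rf: "res Z U V f \<in> carrier (sect Z V)"
    by (rule graded_hom_closed[OF presheaf_res_hom[OF Z UV] f])
  show "pull (comp_mor S Y Z \<nu> \<mu>) V (res Z U V f) =
      res S (preim S (comp_mor S Y Z \<nu> \<mu>) U) (preim S (comp_mor S Y Z \<nu> \<mu>) V) (pull (comp_mor S Y Z \<nu> \<mu>) U f)"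
    unfolding preim_comp[OF \<mu>] comp_mor_pull[OF UV(2) rf] comp_mor_pull[OF UV(1) f]
      graded_morphism_res[OF \<nu> UV f]
    by (rule graded_morphism_res[OF \<mu> openin_preim[OF \<nu> UV(1)] openin_preim[OF \<nu> UV(2)]
        preim_mono[OF UV(3)] pull_closed[OF \<nu> UV(1) f]])
qed

lemma comp_mor_assoc:
  assumes \<mu>: "graded_morphism S Y \<mu>" and \<nu>: "graded_morphism Y Z \<nu>" and \<rho>: "graded_morphism Z Q \<rho>"
  shows "comp_mor S Y Q (comp_mor Y Z Q \<rho> \<nu>) \<mu> = comp_mor S Z Q \<rho> (comp_mor S Y Z \<nu> \<mu>)"
  unfolding comp_mor_def[of S Y Q] comp_mor_def[of S Z Q]
  using graded_morphism_base[OF \<mu>] openin_preim[OF \<rho>] pull_closed[OF \<rho>]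
  by (intro mk_mor_cong) (auto simp: preim_comp[OF \<nu>])

lemma id_mor_base [simp]: "x \<in> topspace (supp S) \<Longrightarrow> base (id_mor S) x = x"
  and id_mor_pull [simp]: "\<lbrakk>openin (supp S) V; f \<in> carrier (sect S V)\<rbrakk> \<Longrightarrow> pull (id_mor S) V f = f"
  by (simp_all add: id_mor_def)

lemma preim_id: "openin (supp S) V \<Longrightarrow> preim S (id_mor S) V = V"
  using openin_subset by (fastforce simp: preim_def)

lemma comp_id_mor:
  assumes \<mu>: "graded_morphism S Y \<mu>"
  shows "comp_mor S Y Y (id_mor Y) \<mu> = \<mu>"
proof -
  have "comp_mor S Y Y (id_mor Y) \<mu> = mk_mor S Y (base \<mu>) (pull \<mu>)"
    unfolding comp_mor_def using graded_morphism_base[OF \<mu>] by (intro mk_mor_cong) (auto simp: preim_id)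
  also have "\<dots> = \<mu>" by (rule graded_morphism_mk[OF \<mu>, symmetric])
  finally show ?thesis .
qed

lemma smorphism_graded: "smorphism S Y \<mu> \<Longrightarrow> graded_morphism S Y \<mu>"
  by (simp add: smorphism_def)

lemma smooth_fun_cong:
  "(\<And>x. x \<in> W \<Longrightarrow> g x = h x) \<Longrightarrow> smooth_fun S W g \<longleftrightarrow> smooth_fun S W h"
  unfolding smooth_fun_def by (intro ball_cong ex_cong1 conj_cong refl bex_cong) (metis subsetD)

lemma smorphism_comp:
  assumes \<mu>: "smorphism S Y \<mu>" and \<nu>: "smorphism Y Z \<nu>" and Z: "graded_presheaf Z"
  shows "smorphism S Z (comp_mor S Y Z \<nu> \<mu>)"
proof -
  note \<mu>' = smorphism_graded[OF \<mu>] and \<nu>' = smorphism_graded[OF \<nu>]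
  note c = graded_morphism_comp[OF \<mu>' \<nu>' Z]
  have "smooth_fun S (preim S (comp_mor S Y Z \<nu> \<mu>) V) (\<lambda>x. g (base (comp_mor S Y Z \<nu> \<mu>) x))"
    if V: "openin (supp Z) V" and g: "smooth_fun Z V g" for V g
  proof -
    have "smooth_fun Y (preim Y \<nu> V) (\<lambda>x. g (base \<nu> x))"
      using \<nu> V g unfolding smorphism_def smooth_map_on_supp_def by blast
    then have "smooth_fun S (preim S \<mu> (preim Y \<nu> V)) (\<lambda>x. g (base \<nu> (base \<mu> x)))"
      using \<mu> openin_preim[OF \<nu>' V] unfolding smorphism_def smooth_map_on_supp_def by blast
    moreover have "base (comp_mor S Y Z \<nu> \<mu>) x = base \<nu> (base \<mu> x)"
      if "x \<in> preim S \<mu> (preim Y \<nu> V)" for x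
      using that by (simp add: preim_def)
    ultimately show ?thesis unfolding preim_comp[OF \<mu>'] by (subst smooth_fun_cong) auto
  qed
  moreover have "ev_fun S (preim S (comp_mor S Y Z \<nu> \<mu>) V) (pull (comp_mor S Y Z \<nu> \<mu>) V f) x =
      ev_fun Z V f (base (comp_mor S Y Z \<nu> \<mu>) x)"
    if V: "openin (supp Z) V" and f: "f \<in> carrier (sect Z V)"
      and x: "x \<in> preim S (comp_mor S Y Z \<nu> \<mu>) V" for V f x
  proof -
    have x': "x \<in> topspace (supp S)" "x \<in> preim S \<mu> (preim Y \<nu> V)" "base \<mu> x \<in> preim Y \<nu> V"
      using x unfolding preim_comp[OF \<mu>'] by (auto simp: preim_def)
    show ?thesis
      unfolding preim_comp[OF \<mu>'] comp_mor_pull[OF V f] comp_mor_base[OF x'(1)]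
      using \<mu> \<nu> openin_preim[OF \<nu>' V] pull_closed[OF \<nu>' V f] V f x'(2,3)
      unfolding smorphism_def by metis
  qed
  ultimately show ?thesis
    using c unfolding smorphism_def smooth_map_on_supp_def by (auto dest: graded_morphism_continuous)
qed

text \<open>A vector field along \<open>\<mu>\<close>: the functions on the source form a module
  over those on the target through the pullback, and this is the graded Leibniz rule for that
  module.\<close>

definition derivation_along ::
  "('x, 'f) gspace \<Rightarrow> ('y, 'g) gspace \<Rightarrow> ('x, 'f, 'y, 'g) gmor \<Rightarrow> int \<Rightarrow> ('y set \<Rightarrow> 'g \<Rightarrow> 'f) \<Rightarrow> bool"
where
  "derivation_along S Y \<mu> j D \<longleftrightarrow>
     (\<forall>V. openin (supp Y) V \<longrightarrow> (let A = sect Y V; B = sect S (preim S \<mu> V) in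
        D V \<in> carrier A \<rightarrow> carrier B \<and>
        (\<forall>f\<in>carrier A. \<forall>g\<in>carrier A. D V (f \<oplus>\<^bsub>A\<^esub> g) = D V f \<oplus>\<^bsub>B\<^esub> D V g) \<and>
        (\<forall>r. \<forall>f\<in>carrier A. D V (r \<odot>\<^bsub>A\<^esub> f) = r \<odot>\<^bsub>B\<^esub> D V f) \<and>
        (\<forall>k. D V ` gpart Y V k \<subseteq> gpart S (preim S \<mu> V) (k + j)) \<and>
        (\<forall>k. \<forall>f\<in>gpart Y V k. \<forall>g\<in>carrier A.
           D V (f \<otimes>\<^bsub>A\<^esub> g) =
             D V f \<otimes>\<^bsub>B\<^esub> pull \<mu> V g \<oplus>\<^bsub>B\<^esub> sgn_deg (j * k) \<odot>\<^bsub>B\<^esub> (pull \<mu> V f \<otimes>\<^bsub>B\<^esub> D V g)))) \<and>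
     (\<forall>U V. openin (supp Y) U \<and> openin (supp Y) V \<and> V \<subseteq> U \<longrightarrow>
        (\<forall>f\<in>carrier (sect Y U). D V (res Y U V f) = res S (preim S \<mu> U) (preim S \<mu> V) (D U f)))"

context
  fixes S :: "('x, 'f) gspace" and Y :: "('y, 'g) gspace" and \<mu> j D
  assumes D: "derivation_along S Y \<mu> j D"
begin

lemma derivation_closed: "\<lbrakk>openin (supp Y) V; f \<in> carrier (sect Y V)\<rbrakk> \<Longrightarrow> D V f \<in> carrier (sect S (preim S \<mu> V))"
  and derivation_add: "\<lbrakk>openin (supp Y) V; f \<in> carrier (sect Y V); g \<in> carrier (sect Y V)\<rbrakk> \<Longrightarrow>
      D V (f \<oplus>\<^bsub>sect Y V\<^esub> g) = D V f \<oplus>\<^bsub>sect S (preim S \<mu> V)\<^esub> D V g"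
  and derivation_smult: "\<lbrakk>openin (supp Y) V; f \<in> carrier (sect Y V)\<rbrakk> \<Longrightarrow>
      D V (r \<odot>\<^bsub>sect Y V\<^esub> f) = r \<odot>\<^bsub>sect S (preim S \<mu> V)\<^esub> D V f"
  and derivation_part: "\<lbrakk>openin (supp Y) V; f \<in> gpart Y V k\<rbrakk> \<Longrightarrow> D V f \<in> gpart S (preim S \<mu> V) (k + j)"
  and derivation_mult: "\<lbrakk>openin (supp Y) V; f \<in> gpart Y V k; g \<in> carrier (sect Y V)\<rbrakk> \<Longrightarrow>
      D V (f \<otimes>\<^bsub>sect Y V\<^esub> g) = D V f \<otimes>\<^bsub>sect S (preim S \<mu> V)\<^esub> pull \<mu> V g
        \<oplus>\<^bsub>sect S (preim S \<mu> V)\<^esub> sgn_deg (j * k) \<odot>\<^bsub>sect S (preim S \<mu> V)\<^esub>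
          (pull \<mu> V f \<otimes>\<^bsub>sect S (preim S \<mu> V)\<^esub> D V g)"
  and derivation_res: "\<lbrakk>openin (supp Y) U; openin (supp Y) V; V \<subseteq> U; f \<in> carrier (sect Y U)\<rbrakk> \<Longrightarrow>
      D V (res Y U V f) = res S (preim S \<mu> U) (preim S \<mu> V) (D U f)"
proof -
  note DV = D[unfolded derivation_along_def Let_def, THEN conjunct1, THEN spec, THEN mp]
  show "\<lbrakk>openin (supp Y) V; f \<in> carrier (sect Y V)\<rbrakk> \<Longrightarrow> D V f \<in> carrier (sect S (preim S \<mu> V))"
    using DV[THEN conjunct1] by (rule funcset_mem)
  show "\<lbrakk>openin (supp Y) V; f \<in> carrier (sect Y V); g \<in> carrier (sect Y V)\<rbrakk> \<Longrightarrow>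
      D V (f \<oplus>\<^bsub>sect Y V\<^esub> g) = D V f \<oplus>\<^bsub>sect S (preim S \<mu> V)\<^esub> D V g"
    using DV[THEN conjunct2, THEN conjunct1] by blast
  show "\<lbrakk>openin (supp Y) V; f \<in> carrier (sect Y V)\<rbrakk> \<Longrightarrow>
      D V (r \<odot>\<^bsub>sect Y V\<^esub> f) = r \<odot>\<^bsub>sect S (preim S \<mu> V)\<^esub> D V f"
    using DV[THEN conjunct2, THEN conjunct2, THEN conjunct1] by blast
  show "\<lbrakk>openin (supp Y) V; f \<in> gpart Y V k\<rbrakk> \<Longrightarrow> D V f \<in> gpart S (preim S \<mu> V) (k + j)"
    using DV[THEN conjunct2, THEN conjunct2, THEN conjunct2, THEN conjunct1] by blast
  show "\<lbrakk>openin (supp Y) V; f \<in> gpart Y V k; g \<in> carrier (sect Y V)\<rbrakk> \<Longrightarrow>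
      D V (f \<otimes>\<^bsub>sect Y V\<^esub> g) = D V f \<otimes>\<^bsub>sect S (preim S \<mu> V)\<^esub> pull \<mu> V g
        \<oplus>\<^bsub>sect S (preim S \<mu> V)\<^esub> sgn_deg (j * k) \<odot>\<^bsub>sect S (preim S \<mu> V)\<^esub>
          (pull \<mu> V f \<otimes>\<^bsub>sect S (preim S \<mu> V)\<^esub> D V g)"
    using DV[THEN conjunct2, THEN conjunct2, THEN conjunct2, THEN conjunct2] by blast
  show "\<lbrakk>openin (supp Y) U; openin (supp Y) V; V \<subseteq> U; f \<in> carrier (sect Y U)\<rbrakk> \<Longrightarrow>
      D V (res Y U V f) = res S (preim S \<mu> U) (preim S \<mu> V) (D U f)"
    using D[unfolded derivation_along_def, THEN conjunct2] by blast
qed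

end

text \<open>Lifting \<open>\<mu>\<close> with it gives the composite of \<open>\<mu>\<close> with
  the projection that forgets \<epsilon>. This is the reference with which other lifts are
  compared.\<close>

definition zero_along ::
  "('x, 'f) gspace \<Rightarrow> ('x, 'f, 'y, 'g) gmor \<Rightarrow> 'y set \<Rightarrow> 'g \<Rightarrow> 'f" where
  "zero_along S \<mu> V f = \<zero>\<^bsub>sect S (preim S \<mu> V)\<^esub>"

lemma derivation_zero_along:
  assumes S: "graded_presheaf S" and \<mu>: "graded_morphism S Y \<mu>"
  shows "derivation_along S Y \<mu> j (zero_along S \<mu>)"
  unfolding derivation_along_def Let_def zero_along_def
proof (intro conjI allI impI ballI; (elim conjE)?)
  show "\<zero>\<^bsub>sect S (preim S \<mu> V)\<^esub> = res S (preim S \<mu> U) (preim S \<mu> V) \<zero>\<^bsub>sect S (preim S \<mu> U)\<^esub>"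
    if "openin (supp Y) U" "openin (supp Y) V" "V \<subseteq> U" for U V
    by (rule graded_hom_zero[OF presheaf_res_hom[OF S] presheaf_galg[OF S] presheaf_galg[OF S],
        OF openin_preim[OF \<mu>] openin_preim[OF \<mu>] preim_mono openin_preim[OF \<mu>] openin_preim[OF \<mu>],
        symmetric]) (use that in blast)+
  fix V assume V: "openin (supp Y) V"
  interpret galg "sect S (preim S \<mu> V)" "gpart S (preim S \<mu> V)"
    by (rule presheaf_galg[OF S openin_preim[OF \<mu> V]])
  have part: "pull \<mu> V f \<in> carrier (sect S (preim S \<mu> V))" if "f \<in> gpart Y V k" for f k
    using graded_morphism_hom[OF \<mu> V] that part_sub unfolding graded_hom_def by blast
  show "\<zero>\<^bsub>sect S (preim S \<mu> V)\<^esub> =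
      \<zero>\<^bsub>sect S (preim S \<mu> V)\<^esub> \<otimes>\<^bsub>sect S (preim S \<mu> V)\<^esub> pull \<mu> V g \<oplus>\<^bsub>sect S (preim S \<mu> V)\<^esub>
      sgn_deg (j * k) \<odot>\<^bsub>sect S (preim S \<mu> V)\<^esub> (pull \<mu> V f \<otimes>\<^bsub>sect S (preim S \<mu> V)\<^esub> \<zero>\<^bsub>sect S (preim S \<mu> V)\<^esub>)"
    if "f \<in> gpart Y V k" "g \<in> carrier (sect Y V)" for k f g
    using part[OF that(1)] pull_closed[OF \<mu> V that(2)] by simp
  show "(\<lambda>f. \<zero>\<^bsub>sect S (preim S \<mu> V)\<^esub>) ` gpart Y V k \<subseteq> gpart S (preim S \<mu> V) (k + j)" for k
    by auto
  show "(\<lambda>f. \<zero>\<^bsub>sect S (preim S \<mu> V)\<^esub>) \<in> carrier (sect Y V) \<rightarrow> carrier (sect S (preim S \<mu> V))" by simp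
  show "\<zero>\<^bsub>sect S (preim S \<mu> V)\<^esub> = \<zero>\<^bsub>sect S (preim S \<mu> V)\<^esub> \<oplus>\<^bsub>sect S (preim S \<mu> V)\<^esub> \<zero>\<^bsub>sect S (preim S \<mu> V)\<^esub>"
    "\<zero>\<^bsub>sect S (preim S \<mu> V)\<^esub> = r \<odot>\<^bsub>sect S (preim S \<mu> V)\<^esub> \<zero>\<^bsub>sect S (preim S \<mu> V)\<^esub>" for r
    by simp_all
qed

definition lift_mor ::
  "('f \<Rightarrow> 'f \<Rightarrow> 'h) \<Rightarrow> int \<Rightarrow> ('x, 'f) gspace \<Rightarrow> ('y, 'g) gspace \<Rightarrow> ('x, 'f, 'y, 'g) gmor \<Rightarrow>
     ('y set \<Rightarrow> 'g \<Rightarrow> 'f) \<Rightarrow> ('x, 'h, 'y, 'g) gmor" where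
  "lift_mor e d S Y \<mu> D = mk_mor (ext_space e d S) Y (base \<mu>) (\<lambda>V f. e (pull \<mu> V f) (D V f))"

lemma lift_mor_base [simp]: "x \<in> topspace (supp S) \<Longrightarrow> base (lift_mor e d S Y \<mu> D) x = base \<mu> x"
  by (simp add: lift_mor_def)

lemma lift_mor_pull [simp]:
  "\<lbrakk>openin (supp Y) V; f \<in> carrier (sect Y V)\<rbrakk> \<Longrightarrow> pull (lift_mor e d S Y \<mu> D) V f = e (pull \<mu> V f) (D V f)"
  by (simp add: lift_mor_def)

lemma preim_lift [simp]: "preim (ext_space e d S) (lift_mor e d S Y \<mu> D) V = preim S \<mu> V"
  by (auto simp: preim_def)

text \<open>Following a lift by \<open>\<nu>\<close> keeps of \<open>D\<close> only its values on
  functions pulled back along \<open>\<nu>\<close>. If \<open>D\<close> kills these, the composite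
  no longer depends on \<open>D\<close>.\<close>

lemma comp_lift_mor:
  assumes \<mu>: "graded_morphism S Y \<mu>" and \<nu>: "graded_morphism Y Z \<nu>"
  shows "comp_mor (ext_space e d S) Y Z \<nu> (lift_mor e d S Y \<mu> D) =
    lift_mor e d S Z (comp_mor S Y Z \<nu> \<mu>) (\<lambda>V f. D (preim Y \<nu> V) (pull \<nu> V f))"
  unfolding comp_mor_def[of "ext_space e d S"] lift_mor_def[of e d S Z]
  by (rule mk_mor_cong) (simp_all add: openin_preim[OF \<nu>] pull_closed[OF \<nu>])

lemma lift_mor_cong:
  assumes "\<And>V f. \<lbrakk>openin (supp Y) V; f \<in> carrier (sect Y V)\<rbrakk> \<Longrightarrow> D V f = D' V f"
  shows "lift_mor e d S Y \<mu> D = lift_mor e d S Y \<mu> D'"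
  unfolding lift_mor_def by (rule mk_mor_cong) (simp_all add: assms)

text \<open>With \<open>\<epsilon>\<close> of degree \<open>- j\<close>, the map \<open>\<mu> + \<epsilon> D\<close> is multiplicative because \<open>\<epsilon>\<^sup>2 = 0\<close>.\<close>

lemma graded_morphism_lift:
  assumes S: "graded_presheaf S" and Y: "graded_presheaf Y" and \<mu>: "graded_morphism S Y \<mu>"
    and D: "derivation_along S Y \<mu> j D" and j: "odd j" and e: "pairing e"
  shows "graded_morphism (ext_space e (- j) S) Y (lift_mor e (- j) S Y \<mu> D)"
  unfolding graded_morphism_def
proof (intro conjI allI impI ballI; (elim conjE)?)
  let ?T = "ext_space e (- j) S" and ?u = "lift_mor e (- j) S Y \<mu> D"
  show "?u = mk_mor ?T Y (base ?u) (pull ?u)" by (simp add: lift_mor_def)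
  show "continuous_map (supp ?T) (supp Y) (base ?u)"
    using graded_morphism_continuous[OF \<mu>] by (simp add: continuous_map_eq)
  show "pull ?u V (res Y U V f) = res ?T (preim ?T ?u U) (preim ?T ?u V) (pull ?u U f)"
    if UV: "openin (supp Y) U" "openin (supp Y) V" "V \<subseteq> U" and f: "f \<in> carrier (sect Y U)" for U V f
    using UV f graded_hom_closed[OF presheaf_res_hom[OF Y UV] f]
    by (simp add: e graded_morphism_res[OF \<mu>] derivation_res[OF D])
  fix V assume V: "openin (supp Y) V"
  let ?A = "sect Y V" and ?W = "preim S \<mu> V"
  let ?B = "sect S ?W"
  interpret A: galg ?A "gpart Y V" by (rule presheaf_galg[OF Y V])
  interpret B: galg_ext ?B "gpart S ?W" e "- j"
    by (intro galg_ext.intro galg_ext_axioms.intro e presheaf_galg[OF S openin_preim[OF \<mu> V]])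
  note hom = graded_morphism_hom[OF \<mu> V]
  have h: "pull \<mu> V \<in> ring_hom ?A ?B" "\<And>r x. x \<in> carrier ?A \<Longrightarrow> pull \<mu> V (r \<odot>\<^bsub>?A\<^esub> x) = r \<odot>\<^bsub>?B\<^esub> pull \<mu> V x"
    "\<And>k x. x \<in> gpart Y V k \<Longrightarrow> pull \<mu> V x \<in> gpart S ?W k"
    using hom by (auto simp: graded_hom_def image_subset_iff)
  note hs = ring_hom_closed[OF h(1)] ring_hom_add[OF h(1)] ring_hom_mult[OF h(1)] ring_hom_one[OF h(1)] h(2)
  note Dc = derivation_closed[OF D V] and Da = derivation_add[OF D V] and Dm = derivation_mult[OF D V]
  \<comment> \<open>For odd \<open>j\<close> the sign in the Leibniz rule is that of the degree of
    \<open>f\<close>, so \<open>par\<close> absorbs it. In this form the rule extends to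
    inhomogeneous \<open>f\<close> by additivity.\<close>
  have leib: "D V (f \<otimes>\<^bsub>?A\<^esub> g) = par ?B (gpart S ?W) (pull \<mu> V f) \<otimes>\<^bsub>?B\<^esub> D V g \<oplus>\<^bsub>?B\<^esub> D V f \<otimes>\<^bsub>?B\<^esub> pull \<mu> V g"
    if f: "f \<in> carrier ?A" and g: "g \<in> carrier ?A" for f g
    using f
  proof (induct rule: A.graded_induct)
    case (part k f)
    have "sgn_deg (j * k) = sgn_deg k" using j by (cases "even k") (simp_all add: sgn_deg_even sgn_deg_odd)
    then show ?case
      using g A.part_sub[OF part] part
      by (simp add: Dm B.par_part[OF h(3)[OF part]] B.smult_mult_left hs Dc B.a_comm)
  next
    case (add f f')
    then show ?case
      using g by (simp add: A.l_distr Da hs Dc B.l_distr B.par_add) (simp add: B.a_ac hs Dc)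
  qed
  \<comment> \<open>The Leibniz rule for the square of the unit gives
    \<open>D 1 = D 1 + D 1\<close>; so the lift preserves the unit.\<close>
  have one: "D V \<one>\<^bsub>?A\<^esub> = \<zero>\<^bsub>?B\<^esub>"
  proof -
    have "D V \<one>\<^bsub>?A\<^esub> = D V \<one>\<^bsub>?A\<^esub> \<oplus>\<^bsub>?B\<^esub> D V \<one>\<^bsub>?A\<^esub>"
      using leib[of "\<one>\<^bsub>?A\<^esub>" "\<one>\<^bsub>?A\<^esub>"] by (simp add: hs Dc)
    then show ?thesis using Dc[of "\<one>\<^bsub>?A\<^esub>"] by (metis A.one_closed B.add.r_cancel_one')
  qed
  have "graded_hom ?A (gpart Y V) (sect ?T ?W) (gpart ?T ?W) (\<lambda>f. e (pull \<mu> V f) (D V f))"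
    unfolding graded_hom_def ring_hom_def ext_space_simps
    using h(3) derivation_part[OF D V]
    by (auto simp: e hs Dc Da leib one derivation_smult[OF D V] ext_part_def)
  then have "graded_hom ?A (gpart Y V) (sect ?T ?W) (gpart ?T ?W) (pull ?u V)"
    by (rule graded_hom_cong[OF A.galg_axioms]) (simp add: V)
  then show "graded_hom ?A (gpart Y V) (sect ?T (preim ?T ?u V)) (gpart ?T (preim ?T ?u V)) (pull ?u V)"
    by (simp only: preim_lift)
qed

text \<open>The base map is that of \<open>\<mu>\<close>, and by \<open>ev_fun_ext\<close> and
  \<open>smooth_fun_ext\<close> the terms with \<epsilon> are invisible to smoothness and
  evaluation. These two apply because an odd degree is nonzero.\<close>

lemma smorphism_lift:
  assumes S: "graded_presheaf S" and Y: "graded_presheaf Y" and \<mu>: "smorphism S Y \<mu>"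
    and D: "derivation_along S Y \<mu> j D" and j: "odd j" and e: "pairing e"
  shows "smorphism (ext_space e (- j) S) Y (lift_mor e (- j) S Y \<mu> D)"
proof -
  let ?T = "ext_space e (- j) S" and ?u = "lift_mor e (- j) S Y \<mu> D"
  note \<mu>' = smorphism_graded[OF \<mu>]
  note g = graded_morphism_lift[OF S Y \<mu>' D j e]
  have d: "- j \<noteq> 0" using j by auto
  have "smooth_fun ?T (preim ?T ?u V) (\<lambda>x. g (base ?u x))"
    if V: "openin (supp Y) V" and g: "smooth_fun Y V g" for V g
  proof -
    have "smooth_fun S (preim S \<mu> V) (\<lambda>x. g (base \<mu> x))"
      using \<mu> V g unfolding smorphism_def smooth_map_on_supp_def by blast
    then show ?thesis
      unfolding smooth_fun_ext[OF S e d] preim_lift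
      by (subst smooth_fun_cong[where h = "\<lambda>x. g (base \<mu> x)"]) (auto simp: preim_def)
  qed
  moreover have "ev_fun ?T (preim ?T ?u V) (pull ?u V f) x = ev_fun Y V f (base ?u x)"
    if V: "openin (supp Y) V" and f: "f \<in> carrier (sect Y V)" and x: "x \<in> preim ?T ?u V" for V f x
  proof -
    have x': "x \<in> topspace (supp S)" "x \<in> preim S \<mu> V"
      using x by (auto simp: preim_def)
    have "ev_fun S (preim S \<mu> V) (pull \<mu> V f) x = ev_fun Y V f (base \<mu> x)"
      using \<mu> V f x'(2) unfolding smorphism_def by blast
    moreover have "pull ?u V f \<in> carrier (sect ?T (preim S \<mu> V))"
      using pull_closed[OF g V f] by (simp only: preim_lift)
    ultimately show ?thesis
      unfolding preim_lift lift_mor_base[OF x'(1)]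
      by (subst ev_fun_ext[OF S e d openin_preim[OF \<mu>' V]]) (simp_all add: V f e)
  qed
  ultimately show ?thesis
    using g unfolding smorphism_def smooth_map_on_supp_def
    by (auto dest: graded_morphism_continuous simp del: preim_lift)
qed

section \<open>Adjoining a generator to a local model\<close>

text \<open>The laws on \<open>B\<close> are carried over from \<open>A\<close> through
  \<open>h\<close>. In the application \<open>B\<close> consists of model sections, about which only
  the chart is known, and products then have to be computed in one direction only.\<close>

lemma graded_hom_inverse:
  assumes A: "galg A C" and h: "graded_hom A C B D h"
    and k: "\<And>y. y \<in> carrier B \<Longrightarrow> k y \<in> carrier A" "\<And>y. y \<in> carrier B \<Longrightarrow> h (k y) = y"
      "\<And>x. x \<in> carrier A \<Longrightarrow> k (h x) = x" "\<And>l y. y \<in> D l \<Longrightarrow> k y \<in> C l"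
  shows "graded_hom B D A C k"
proof -
  interpret galg A C by fact
  have h': "h \<in> ring_hom A B" "\<And>r x. x \<in> carrier A \<Longrightarrow> h (r \<odot>\<^bsub>A\<^esub> x) = r \<odot>\<^bsub>B\<^esub> h x"
    using h by (auto simp: graded_hom_def)
  have "k (x \<otimes>\<^bsub>B\<^esub> y) = k x \<otimes>\<^bsub>A\<^esub> k y" "k (x \<oplus>\<^bsub>B\<^esub> y) = k x \<oplus>\<^bsub>A\<^esub> k y"
    if "x \<in> carrier B" "y \<in> carrier B" for x y
    using that k(3)[of "k x \<otimes>\<^bsub>A\<^esub> k y"] k(3)[of "k x \<oplus>\<^bsub>A\<^esub> k y"] k(1,2)
    by (simp_all add: ring_hom_mult[OF h'(1)] ring_hom_add[OF h'(1)])
  moreover have "k \<one>\<^bsub>B\<^esub> = \<one>\<^bsub>A\<^esub>"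
    using k(3)[of "\<one>\<^bsub>A\<^esub>"] ring_hom_one[OF h'(1)] by simp
  moreover have "k (r \<odot>\<^bsub>B\<^esub> x) = r \<odot>\<^bsub>A\<^esub> k x" if "x \<in> carrier B" for r x
    using that k(3)[of "r \<odot>\<^bsub>A\<^esub> k x"] k(1,2) h'(2) by simp
  ultimately show ?thesis
    using k(1,4) by (auto simp: graded_hom_def ring_hom_def)
qed

section \<open>Signs in the product of monomials\<close>

definition gless :: "generator \<Rightarrow> generator \<Rightarrow> bool" where
  "gless u v \<longleftrightarrow> fst u < fst v \<or> fst u = fst v \<and> snd u < snd v"

definition odd_gens :: "monomial \<Rightarrow> generator set" where
  "odd_gens a = {u. u \<in># a \<and> odd (fst u)}"

lemma finite_odd_gens [simp]: "finite (odd_gens a)"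
  by (rule finite_subset[of _ "set_mset a"]) (auto simp: odd_gens_def)

lemma odd_gens_simps:
  "odd_gens (a + b) = odd_gens a \<union> odd_gens b"
  "odd (fst u) \<Longrightarrow> odd_gens (add_mset u a) = insert u (odd_gens a)"
  "even (fst u) \<Longrightarrow> odd_gens (add_mset u a) = odd_gens a"
  "odd_gens {#} = {}"
  by (auto simp: odd_gens_def)

lemma msign_eq:
  "msign a b = (if odd_gens a \<inter> odd_gens b \<noteq> {} then 0
     else (- 1) ^ card {(u, v) \<in> odd_gens a \<times> odd_gens b. gless v u})"
proof -
  have "(\<exists>u. odd (fst u) \<and> u \<in># a \<and> u \<in># b) \<longleftrightarrow> odd_gens a \<inter> odd_gens b \<noteq> {}"
    by (auto simp: odd_gens_def)
  moreover have "{(u, v). u \<in># a \<and> v \<in># b \<and> odd (fst u) \<and> odd (fst v) \<and>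
      (fst v < fst u \<or> fst v = fst u \<and> snd v < snd u)} = {(u, v) \<in> odd_gens a \<times> odd_gens b. gless v u}"
    by (auto simp: odd_gens_def gless_def)
  ultimately show ?thesis by (simp add: msign_def)
qed

context
  fixes w :: generator
  assumes w: "odd (fst w)"
begin

text \<open>Starting at the front, \<open>w\<close> has to pass exactly the odd generators of
  \<open>a\<close> that precede it in the order.\<close>

lemma msign_single: "w \<notin># a \<Longrightarrow> msign {#w#} a = (- 1) ^ card {v \<in> odd_gens a. gless v w}"
proof -
  assume "w \<notin># a"
  then have "w \<notin> odd_gens a" by (simp add: odd_gens_def)
  moreover have "{(u, v) \<in> odd_gens {#w#} \<times> odd_gens a. gless v u} = Pair w ` {v \<in> odd_gens a. gless v w}"
    using w by (auto simp: odd_gens_simps)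
  ultimately show ?thesis
    using w by (auto simp: msign_eq odd_gens_simps card_image inj_on_def)
qed

lemma msign_single_square: "w \<notin># a \<Longrightarrow> msign {#w#} a * msign {#w#} a = 1"
  by (simp add: msign_single flip: power_add)

lemma msign_single_cases: "w \<notin># a \<Longrightarrow> msign {#w#} a = 1 \<or> msign {#w#} a = - 1"
  by (simp add: msign_single) (metis neg_one_even_power neg_one_odd_power)

lemma msign_single_add:
  assumes "w \<notin># a" "w \<notin># b" "odd_gens a \<inter> odd_gens b = {}"
  shows "msign {#w#} (a + b) = msign {#w#} a * msign {#w#} b"
proof -
  have "{v \<in> odd_gens (a + b). gless v w} = {v \<in> odd_gens a. gless v w} \<union> {v \<in> odd_gens b. gless v w}"
    by (auto simp: odd_gens_simps)
  moreover have "{v \<in> odd_gens a. gless v w} \<inter> {v \<in> odd_gens b. gless v w} = {}"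
    using assms by auto
  ultimately have "card {v \<in> odd_gens (a + b). gless v w} =
      card {v \<in> odd_gens a. gless v w} + card {v \<in> odd_gens b. gless v w}"
    by (simp add: card_Un_disjoint)
  then show ?thesis using assms by (simp add: msign_single power_add)
qed

text \<open>Both sides are the sign of sorting \<open>w\<close>, \<open>a\<close>, \<open>b\<close>:
  on the left \<open>w\<close> and \<open>a\<close> are joined first, on the right \<open>a\<close>
  and \<open>b\<close>. An odd generator shared by \<open>a\<close> and \<open>b\<close> makes both
  sides zero.\<close>

lemma msign_add_left:
  assumes "w \<notin># a" "w \<notin># b"
  shows "msign (add_mset w a) b * msign {#w#} a = msign {#w#} (a + b) * msign a b"
proof (cases "odd_gens a \<inter> odd_gens b = {}")
  case True
  have nb: "w \<notin> odd_gens a" "w \<notin> odd_gens b" using assms by (auto simp: odd_gens_def)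
  have "{(u, v) \<in> odd_gens (add_mset w a) \<times> odd_gens b. gless v u} =
      {(u, v) \<in> odd_gens a \<times> odd_gens b. gless v u} \<union> Pair w ` {v \<in> odd_gens b. gless v w}"
    using w by (auto simp: odd_gens_simps)
  moreover have "finite {(u, v) \<in> odd_gens a \<times> odd_gens b. gless v u}"
    by (rule finite_subset[of _ "odd_gens a \<times> odd_gens b"]) auto
  moreover have "{(u, v) \<in> odd_gens a \<times> odd_gens b. gless v u} \<inter> Pair w ` {v \<in> odd_gens b. gless v w} = {}"
    using nb by auto
  ultimately have "card {(u, v) \<in> odd_gens (add_mset w a) \<times> odd_gens b. gless v u} =
      card {(u, v) \<in> odd_gens a \<times> odd_gens b. gless v u} + card {v \<in> odd_gens b. gless v w}"
    by (simp add: card_Un_disjoint card_image inj_on_def)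
  then have "msign (add_mset w a) b = msign a b * msign {#w#} b"
    using True nb w assms by (simp add: msign_eq[of "add_mset w a"] msign_eq[of a] msign_single odd_gens_simps power_add)
  then show ?thesis
    using msign_single_add[OF assms True] by simp
next
  case False
  then show ?thesis using w by (auto simp: msign_eq[of "add_mset w a"] msign_eq[of a] odd_gens_simps)
qed

text \<open>Both sides are the sign of sorting \<open>a\<close>, \<open>w\<close>, \<open>b\<close>.
  On the right \<open>w\<close> is first brought to the front, which costs one transposition for
  each odd generator of \<open>a\<close>.\<close>

lemma msign_add_right:
  assumes "w \<notin># a" "w \<notin># b"
  shows "msign a (add_mset w b) * msign {#w#} b =
    msign {#w#} (a + b) * (- 1) ^ card (odd_gens a) * msign a b"
proof (cases "odd_gens a \<inter> odd_gens b = {}")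
  case True
  have nb: "w \<notin> odd_gens a" "w \<notin> odd_gens b" using assms by (auto simp: odd_gens_def)
  have "{(u, v) \<in> odd_gens a \<times> odd_gens (add_mset w b). gless v u} =
      {(u, v) \<in> odd_gens a \<times> odd_gens b. gless v u} \<union> (\<lambda>u. (u, w)) ` {u \<in> odd_gens a. gless w u}"
    using w by (auto simp: odd_gens_simps)
  moreover have "finite {(u, v) \<in> odd_gens a \<times> odd_gens b. gless v u}"
    by (rule finite_subset[of _ "odd_gens a \<times> odd_gens b"]) auto
  moreover have "{(u, v) \<in> odd_gens a \<times> odd_gens b. gless v u} \<inter> (\<lambda>u. (u, w)) ` {u \<in> odd_gens a. gless w u} = {}"
    using nb by auto
  ultimately have "card {(u, v) \<in> odd_gens a \<times> odd_gens (add_mset w b). gless v u} =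
      card {(u, v) \<in> odd_gens a \<times> odd_gens b. gless v u} + card {u \<in> odd_gens a. gless w u}"
    by (simp add: card_Un_disjoint card_image inj_on_def)
  then have 1: "msign a (add_mset w b) = msign a b * (- 1) ^ card {u \<in> odd_gens a. gless w u}"
    using True nb w assms by (simp add: msign_eq[of a] odd_gens_simps power_add)
  \<comment> \<open>Every odd generator of \<open>a\<close> lies above or below \<open>w\<close>.
    The left side counts those above; on the right those below enter twice, through
    \<open>msign {#w#} a\<close> and through \<open>card (odd_gens a)\<close>, and cancel.\<close>
  have "u = w \<or> gless w u \<or> gless u w" for u :: generator
    unfolding gless_def by (cases u, cases w) auto
  then have "gless w u \<or> gless u w" if "u \<in> odd_gens a" for u
    using that nb(1) by metis
  then have "odd_gens a = {u \<in> odd_gens a. gless w u} \<union> {u \<in> odd_gens a. gless u w}"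
    by auto
  moreover have "{u \<in> odd_gens a. gless w u} \<inter> {u \<in> odd_gens a. gless u w} = {}"
    by (auto simp: gless_def)
  ultimately have 2: "card (odd_gens a) = card {u \<in> odd_gens a. gless w u} + card {u \<in> odd_gens a. gless u w}"
    by (metis (no_types, lifting) card_Un_disjoint finite_Un finite_odd_gens)
  have 3: "(- 1 :: real) ^ card {u \<in> odd_gens a. gless u w} * (- 1) ^ card {u \<in> odd_gens a. gless u w} = 1"
    by (simp flip: power_add mult_2)
  show ?thesis
    unfolding 1 2 msign_single_add[OF assms True] msign_single[OF assms(1)] power_add
    using 3 by (simp add: algebra_simps)
next
  case False
  then show ?thesis using w by (auto simp: msign_eq[of a] odd_gens_simps)
qed

end

text \<open>Even generators contribute even degrees, and since odd ones occur once in a monomial, it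
  makes no difference whether they are counted as a set or with multiplicity.\<close>

lemma sgn_deg_mdeg:
  assumes "a \<in> monomials p"
  shows "sgn_deg (mdeg a) = (- 1) ^ card (odd_gens a)"
proof -
  have "\<forall>u\<in>#a. odd (fst u) \<longrightarrow> count a u = 1" using assms by (auto simp: monomials_def)
  then show ?thesis
  proof (induct a)
    case (add u a)
    have deg: "sgn_deg (mdeg (add_mset u a)) = sgn_deg (fst u) * sgn_deg (mdeg a)"
      by (cases "even (fst u)") (auto simp: mdeg_def sgn_deg_add sgn_deg_even sgn_deg_odd case_prod_unfold
          diff_conv_add_uminus simp del: add_uminus_conv_diff)
    have IH: "sgn_deg (mdeg a) = (- 1) ^ card (odd_gens a)"
    proof (rule add.hyps, intro ballI impI)
      fix v assume "v \<in># a" "odd (fst v)"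
      then have "count (add_mset u a) v = 1" using add.prems by auto
      then show "count a v = 1" using \<open>v \<in># a\<close> by (auto simp: count_eq_zero_iff split: if_splits)
    qed
    show ?case
    proof (cases "even (fst u)")
      case False
      then have "count (add_mset u a) u = 1" using add.prems by auto
      then have "u \<notin># a" by (simp add: not_in_iff)
      then have "u \<notin> odd_gens a" by (simp add: odd_gens_def)
      then show ?thesis using False deg IH by (simp add: odd_gens_simps sgn_deg_odd)
    qed (simp add: deg IH odd_gens_simps sgn_deg_even)
  qed (simp add: mdeg_def odd_gens_simps)
qed

section \<open>Splitting a model section along one odd generator\<close>

definition mmult :: "model_section \<Rightarrow> model_section \<Rightarrow> model_section" where
  "mmult c d a x = (\<Sum>b | b \<subseteq># a. msign b (a - b) * c b x * d (a - b) x)"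

text \<open>Splitting off the generator \<open>w\<close>: a section is \<open>adj_lft w c + w * adj_rgt w c\<close>, where the sign
  comes from moving \<open>w\<close> to the front.\<close>

definition adj_join :: "generator \<Rightarrow> model_section \<Rightarrow> model_section \<Rightarrow> model_section" where
  "adj_join w c c' a x = (if w \<in># a then msign {#w#} (a - {#w#}) * c' (a - {#w#}) x else c a x)"

definition adj_lft :: "generator \<Rightarrow> model_section \<Rightarrow> model_section" where
  "adj_lft w c a x = (if w \<in># a then 0 else c a x)"

definition adj_rgt :: "generator \<Rightarrow> model_section \<Rightarrow> model_section" where
  "adj_rgt w c a x = (if w \<in># a then 0 else msign {#w#} a * c (add_mset w a) x)"

text \<open>A submultiset either fits into \<open>m\<close> or uses the added copy of
  \<open>w\<close>. The two classes overlap when \<open>w\<close> occurs in \<open>m\<close>; below,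
  a sum is split over them only when it does not.\<close>

lemma submset_add_mset:
  "{b. b \<subseteq># add_mset w m} = {b. b \<subseteq># m} \<union> add_mset w ` {b. b \<subseteq># m}"
proof -
  have "b \<in> {b. b \<subseteq># m} \<union> add_mset w ` {b. b \<subseteq># m}" if b: "b \<subseteq># add_mset w m" for b
  proof (cases "w \<in># b")
    case True
    then obtain b' where "b = add_mset w b'" by (metis insert_DiffM)
    then show ?thesis using b by auto
  next
    case False
    then have "count b x \<le> count m x" for x
      using mset_subset_eq_count[OF b, of x] by (cases "x = w") (simp_all add: not_in_iff)
    then show ?thesis by (auto intro: mset_subset_eqI)
  qed
  then show ?thesis by (auto intro: subset_mset.trans)
qed

lemma finite_submset: "finite {b. b \<subseteq># a}"
  by (induct a) (simp_all add: submset_add_mset)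

text \<open>Reading \<open>adj_join w c c'\<close> as \<open>c + w c'\<close>, this is the product
  of \<open>A[\<epsilon>]\<close>: in the terms with one \<open>w\<close> it comes from either
  factor, it passes \<open>c\<close> with the sign of the degree, and the square of \<open>w\<close>
  is zero.\<close>

lemma mmult_adj_join:
  assumes w: "odd (fst w)" and p: "\<And>a. a \<in> monomials p \<Longrightarrow> w \<notin># a"
    and c: "\<And>a x. c a x \<noteq> 0 \<Longrightarrow> a \<in> monomials p" and c': "\<And>a x. c' a x \<noteq> 0 \<Longrightarrow> a \<in> monomials p"
    and d: "\<And>a x. d a x \<noteq> 0 \<Longrightarrow> a \<in> monomials p" and d': "\<And>a x. d' a x \<noteq> 0 \<Longrightarrow> a \<in> monomials p"
  shows "mmult (adj_join w c c') (adj_join w d d') =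
     adj_join w (mmult c d)
       (\<lambda>a x. mmult (\<lambda>a x. sgn_deg (mdeg a) * c a x) d' a x + mmult c' d a x)"
proof (intro ext)
  fix a x
  show "mmult (adj_join w c c') (adj_join w d d') a x =
     adj_join w (mmult c d)
       (\<lambda>a x. mmult (\<lambda>a x. sgn_deg (mdeg a) * c a x) d' a x + mmult c' d a x) a x"
  proof (cases "w \<in># a")
    case False
    have "w \<notin># b" "w \<notin># a - b" if "b \<subseteq># a" for b
      using that False by (auto dest: mset_subset_eqD in_diffD)
    then show ?thesis using False by (auto simp: adj_join_def mmult_def intro!: sum.cong)
  next
    case True
    then obtain m where a: "a = add_mset w m" by (metis insert_DiffM)
    show ?thesis
    proof (cases "w \<in># m")
      \<comment> \<open>Now \<open>w\<close> occurs at least twice in \<open>a\<close>, so both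
        sides have to vanish.\<close>
      case True
      have zero: "f b x * g (m - b) x = 0"
        if "b \<subseteq># m" "\<And>a x. f a x \<noteq> 0 \<Longrightarrow> a \<in> monomials p" "\<And>a x. g a x \<noteq> 0 \<Longrightarrow> a \<in> monomials p"
        for b and f g :: model_section
      proof -
        have "w \<in># b \<or> w \<in># m - b"
          using True that(1) by (metis subset_mset.add_diff_inverse union_iff)
        then have "b \<notin> monomials p \<or> m - b \<notin> monomials p" using p by blast
        then show ?thesis using that(2)[of b x] that(3)[of "m - b" x] by auto
      qed
      have "mmult (\<lambda>a x. sgn_deg (mdeg a) * c a x) d' m x = 0" "mmult c' d m x = 0"
        unfolding mmult_def using zero[OF _ c d'] zero[OF _ c' d]
        by (auto intro!: sum.neutral simp: mult.assoc)
      then have rhs: "adj_join w (mmult c d)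
          (\<lambda>a x. mmult (\<lambda>a x. sgn_deg (mdeg a) * c a x) d' a x + mmult c' d a x) a x = 0"
        by (simp add: a adj_join_def)
      \<comment> \<open>Either both parts contain \<open>w\<close>, and the sign is zero, or one
        part contains it twice. In the second case removing one copy leaves a multiset that is no
        monomial of \<open>p\<close>, where the coefficient vanishes.\<close>
      have "msign b (a - b) * adj_join w c c' b x * adj_join w d d' (a - b) x = 0"
        if b: "b \<subseteq># a" for b
      proof (cases "w \<in># b \<and> w \<in># a - b")
        case True
        then have "\<exists>u. odd (fst u) \<and> u \<in># b \<and> u \<in># a - b" using w by blast
        then have "msign b (a - b) = 0" unfolding msign_def by (rule if_P)
        then show ?thesis by simp
      next
        case False
        have cnt: "count b w + count (a - b) w \<ge> 2"
        proof -
          have "count b w + count (a - b) w = count a w"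
            using b by (metis count_union subset_mset.add_diff_inverse)
          moreover have "count m w > 0" using True by simp
          ultimately show ?thesis by (simp add: a)
        qed
        show ?thesis
        proof (cases "w \<in># b")
          case True
          then have "count b w \<ge> 2" using False cnt by (simp add: not_in_iff)
          then have "w \<in># b - {#w#}" by (simp flip: count_greater_zero_iff)
          then have "c' (b - {#w#}) x = 0" using c' p by blast
          then show ?thesis using True by (simp add: adj_join_def)
        next
          case nb: False
          then have cn: "count (a - b) w \<ge> 2" using cnt by (simp add: not_in_iff)
          then have "w \<in># a - b - {#w#}" by (simp flip: count_greater_zero_iff)
          then have "d' (a - b - {#w#}) x = 0" using d' p by blast
          moreover have "w \<in># a - b" using cn by (simp flip: count_greater_zero_iff)
          ultimately show ?thesis by (simp add: adj_join_def)
        qed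
      qed
      then have "mmult (adj_join w c c') (adj_join w d d') a x = 0"
        unfolding mmult_def by (intro sum.neutral) blast
      then show ?thesis using rhs by simp
    next
      case False
      have nb: "w \<notin># b" "w \<notin># m - b" "add_mset w m - b = add_mset w (m - b)" if "b \<subseteq># m" for b
      proof -
        show "w \<notin># b" "w \<notin># m - b" using that False by (auto dest: mset_subset_eqD in_diffD)
        show "add_mset w m - b = add_mset w (m - b)"
          using that subset_mset.add_diff_assoc[of b m "{#w#}"] by simp
      qed
      \<comment> \<open>The terms in which \<open>w\<close> comes from the second factor and has to
        pass \<open>b\<close>. The case \<open>c b x = 0\<close> is separated because
        \<open>sgn_deg_mdeg\<close> needs \<open>b\<close> to be a monomial.\<close>
      have 1: "msign b (add_mset w m - b) * adj_join w c c' b x * adj_join w d d' (add_mset w m - b) x =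
          msign {#w#} m * (msign b (m - b) * (sgn_deg (mdeg b) * c b x) * d' (m - b) x)"
        if b: "b \<subseteq># m" for b
      proof (cases "c b x = 0")
        case False
        then have "sgn_deg (mdeg b) = (- 1) ^ card (odd_gens b)" using c sgn_deg_mdeg by blast
        moreover have "msign b (add_mset w (m - b)) * msign {#w#} (m - b) =
            msign {#w#} m * (- 1) ^ card (odd_gens b) * msign b (m - b)"
          using msign_add_right[OF w nb(1,2)[OF b]] b by simp
        ultimately show ?thesis
          using nb[OF b] by (simp add: adj_join_def)
      qed (use nb[OF b] in \<open>simp add: adj_join_def\<close>)
      \<comment> \<open>The terms in which \<open>w\<close> comes from the first factor and already
        stands in front.\<close>
      have 2: "msign (add_mset w b) (add_mset w m - add_mset w b) * adj_join w c c' (add_mset w b) x *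
            adj_join w d d' (add_mset w m - add_mset w b) x =
          msign {#w#} m * (msign b (m - b) * c' b x * d (m - b) x)" if b: "b \<subseteq># m" for b
      proof -
        have "msign (add_mset w b) (m - b) * msign {#w#} b = msign {#w#} m * msign b (m - b)"
          using msign_add_left[OF w nb(1,2)[OF b]] b by simp
        then show ?thesis
          using nb[OF b] by (simp add: adj_join_def)
      qed
      have disj: "{b. b \<subseteq># m} \<inter> add_mset w ` {b. b \<subseteq># m} = {}"
        using False by (auto dest: mset_subset_eqD)
      have "mmult (adj_join w c c') (adj_join w d d') a x =
        (\<Sum>b | b \<subseteq># m. msign {#w#} m * (msign b (m - b) * (sgn_deg (mdeg b) * c b x) * d' (m - b) x)) +
        (\<Sum>b | b \<subseteq># m. msign {#w#} m * (msign b (m - b) * c' b x * d (m - b) x))"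
      proof -
        let ?f = "\<lambda>b. msign b (a - b) * adj_join w c c' b x * adj_join w d d' (a - b) x"
        have "mmult (adj_join w c c') (adj_join w d d') a x = sum ?f ({b. b \<subseteq># m} \<union> add_mset w ` {b. b \<subseteq># m})"
          by (simp only: mmult_def a submset_add_mset)
        also have "\<dots> = sum ?f {b. b \<subseteq># m} + sum ?f (add_mset w ` {b. b \<subseteq># m})"
          by (rule sum.union_disjoint) (simp_all only: finite_submset finite_imageI disj)
        also have "sum ?f (add_mset w ` {b. b \<subseteq># m}) = (\<Sum>b | b \<subseteq># m. ?f (add_mset w b))"
          by (subst sum.reindex) (auto simp: inj_on_def)
        also have "\<dots> = (\<Sum>b | b \<subseteq># m. msign {#w#} m * (msign b (m - b) * c' b x * d (m - b) x))"
          by (rule sum.cong[OF refl]) (simp only: a 2 mem_Collect_eq)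
        also have "sum ?f {b. b \<subseteq># m} =
            (\<Sum>b | b \<subseteq># m. msign {#w#} m * (msign b (m - b) * (sgn_deg (mdeg b) * c b x) * d' (m - b) x))"
          by (rule sum.cong[OF refl]) (simp only: a 1 mem_Collect_eq)
        finally show ?thesis .
      qed
      then show ?thesis
        using a by (simp add: adj_join_def mmult_def sum_distrib_left distrib_left)
    qed
  qed
qed

lemma model_simps [simp]:
  "supp (model p) = Euclidean_space (p 0)"
  "carrier (sect (model p) V) = model_carrier p V"
  "c \<otimes>\<^bsub>sect (model p) V\<^esub> d = mmult c d"
  "\<one>\<^bsub>sect (model p) V\<^esub> = (\<lambda>a x. if a = {#} \<and> x \<in> V then 1 else 0)"
  "\<zero>\<^bsub>sect (model p) V\<^esub> = (\<lambda>a x. 0)"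
  "c \<oplus>\<^bsub>sect (model p) V\<^esub> d = (\<lambda>a x. c a x + d a x)"
  "r \<odot>\<^bsub>sect (model p) V\<^esub> c = (\<lambda>a x. r * c a x)"
  "gpart (model p) V k = {c \<in> model_carrier p V. \<forall>a x. c a x \<noteq> 0 \<longrightarrow> mdeg a = k}"
  "res (model p) U V c = (\<lambda>a x. if x \<in> V then c a x else 0)"
  by (simp_all add: model_def mmult_def fun_eq_iff)

lemma mdeg_add_mset: "mdeg (add_mset u a) = mdeg a - fst u"
  by (simp add: mdeg_def case_prod_unfold)

lemma model_carrierI:
  assumes "\<And>a x. c a x \<noteq> 0 \<Longrightarrow> a \<in> monomials p \<and> x \<in> U"
    and "\<And>a. Cinf_on (p 0) U (c a)"
    and "\<And>x. x \<in> U \<Longrightarrow> \<exists>W. openin (Euclidean_space (p 0)) W \<and> x \<in> W \<and> finite {a. \<exists>y\<in>W. c a y \<noteq> 0}"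
    and "finite (mdeg ` {a. \<exists>x. c a x \<noteq> 0})"
  shows "c \<in> model_carrier p U"
  using assms by (simp add: model_carrier_def)

lemma model_carrierD:
  assumes "c \<in> model_carrier p U"
  shows "\<And>a x. c a x \<noteq> 0 \<Longrightarrow> a \<in> monomials p" "\<And>a x. c a x \<noteq> 0 \<Longrightarrow> x \<in> U"
    and "\<And>a. Cinf_on (p 0) U (c a)"
    and "\<And>x. x \<in> U \<Longrightarrow> \<exists>W. openin (Euclidean_space (p 0)) W \<and> x \<in> W \<and> finite {a. \<exists>y\<in>W. c a y \<noteq> 0}"
    and "finite (mdeg ` {a. \<exists>x. c a x \<noteq> 0})"
  using assms unfolding model_carrier_def by blast+

section \<open>Model sections with one more odd generator\<close>

definition add_gen :: "(int \<Rightarrow> nat) \<Rightarrow> int \<Rightarrow> int \<Rightarrow> nat" where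
  "add_gen p i = p(i := Suc (p i))"

context
  fixes p :: "int \<Rightarrow> nat" and i :: int
  assumes i: "odd i"
begin

private abbreviation (input) "w \<equiv> (i, p i)"
private abbreviation (input) "p' \<equiv> add_gen p i"

lemma add_gen_0 [simp]: "p' 0 = p 0"
  using i by (auto simp: add_gen_def)

lemma w_odd: "odd (fst w)"
  using i by simp

lemma w_not_in_monomial: "a \<in> monomials p \<Longrightarrow> w \<notin># a"
  by (auto simp: monomials_def)

lemma monomials_add_gen: "a \<in> monomials p \<Longrightarrow> a \<in> monomials p'"
  by (fastforce simp: monomials_def add_gen_def)

lemma monomials_add_w: "a \<in> monomials p \<Longrightarrow> add_mset w a \<in> monomials p'"
  using i w_not_in_monomial[of a] by (fastforce simp: monomials_def add_gen_def not_in_iff)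

lemma monomials_del_gen: "\<lbrakk>a \<in> monomials p'; w \<notin># a\<rbrakk> \<Longrightarrow> a \<in> monomials p"
  by (force simp: monomials_def add_gen_def less_Suc_eq split: if_splits)

lemma monomials_del_w: assumes "add_mset w a \<in> monomials p'" shows "a \<in> monomials p"
proof -
  have *: "\<forall>(j, k)\<in>#add_mset w a. j \<noteq> 0 \<and> k < p' j \<and> (odd j \<longrightarrow> count (add_mset w a) (j, k) = 1)"
    using assms by (simp add: monomials_def)
  then have "count (add_mset w a) w = 1" using i by simp
  then have w: "w \<notin># a" by (simp add: not_in_iff)
  have "a \<in> monomials p'"
    unfolding monomials_def
  proof (clarify, intro conjI impI)
    fix j k assume jk: "(j, k) \<in># a"
    then have ne: "w \<noteq> (j, k)" using w by auto
    have "(j, k) \<in># add_mset w a" using jk by simp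
    from bspec[OF * this] ne
    show "j \<noteq> 0" "k < p' j" "odd j \<Longrightarrow> count a (j, k) = 1" by (auto split: if_splits)
  qed
  then show ?thesis using monomials_del_gen w by blast
qed

context
  fixes V :: "(nat \<Rightarrow> real) set"
  assumes neg: "\<And>c. c \<in> model_carrier p V \<Longrightarrow> (\<lambda>a x. - c a x) \<in> model_carrier p V"
begin

text \<open>Splitting and joining change coefficients only by signs. Stability under negation is a
  hypothesis at this point and is later read off from a chart, so that no derivative is ever
  computed.\<close>

lemma Cinf_sign:
  assumes c: "c \<in> model_carrier p V" and s: "s = 1 \<or> s = - 1"
  shows "Cinf_on (p 0) V (\<lambda>x. s * c a x)"
  using s model_carrierD(3)[OF c, of a] model_carrierD(3)[OF neg[OF c], of a] by auto

lemma adj_join_carrier: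
  assumes c: "c \<in> model_carrier p V" and d: "d \<in> model_carrier p V"
  shows "adj_join w c d \<in> model_carrier p' V"
proof (rule model_carrierI)
  have nz: "(w \<notin># a \<and> c a x \<noteq> 0) \<or> (\<exists>b. a = add_mset w b \<and> d b x \<noteq> 0)" if "adj_join w c d a x \<noteq> 0" for a x
    using that by (auto simp: adj_join_def split: if_splits dest: multi_member_split)
  show "a \<in> monomials p' \<and> x \<in> V" if "adj_join w c d a x \<noteq> 0" for a x
    using nz[OF that] model_carrierD(1,2)[OF c] model_carrierD(1,2)[OF d] monomials_add_gen monomials_add_w
    by blast
  show "Cinf_on (p' 0) V (adj_join w c d a)" for a
  proof (cases "w \<in># a")
    case False
    then show ?thesis using model_carrierD(3)[OF c, of a] by (simp add: adj_join_def[abs_def])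
  next
    case True
    then obtain b where a: "a = add_mset w b" by (metis insert_DiffM)
    show ?thesis
    proof (cases "w \<in># b")
      case True
      \<comment> \<open>The coefficient is zero here, and \<open>d b\<close> serves as a zero
        function already known to be smooth.\<close>
      then have "d b x = 0" for x using w_not_in_monomial model_carrierD(1)[OF d] by blast
      then have "adj_join w c d a = d b" using True by (simp add: a adj_join_def[abs_def] fun_eq_iff)
      then show ?thesis using model_carrierD(3)[OF d, of b] by simp
    next
      case False
      then show ?thesis
        using Cinf_sign[OF d msign_single_cases[OF w_odd False]]
        by (simp add: a adj_join_def[abs_def])
    qed
  qed
  show "\<exists>W. openin (Euclidean_space (p' 0)) W \<and> x \<in> W \<and> finite {a. \<exists>y\<in>W. adj_join w c d a y \<noteq> 0}"
    if xV: "x \<in> V" for x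
  proof -
    obtain W1 where W1: "openin (Euclidean_space (p 0)) W1" "x \<in> W1" "finite {a. \<exists>y\<in>W1. c a y \<noteq> 0}"
      using model_carrierD(4)[OF c xV] by blast
    obtain W2 where W2: "openin (Euclidean_space (p 0)) W2" "x \<in> W2" "finite {a. \<exists>y\<in>W2. d a y \<noteq> 0}"
      using model_carrierD(4)[OF d xV] by blast
    have "{a. \<exists>y\<in>W1 \<inter> W2. adj_join w c d a y \<noteq> 0} \<subseteq>
        {a. \<exists>y\<in>W1. c a y \<noteq> 0} \<union> add_mset w ` {a. \<exists>y\<in>W2. d a y \<noteq> 0}"
      using nz by blast
    then have "finite {a. \<exists>y\<in>W1 \<inter> W2. adj_join w c d a y \<noteq> 0}"
      by (rule finite_subset) (use W1 W2 in simp)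
    then show ?thesis using W1 W2 by (intro exI[of _ "W1 \<inter> W2"]) auto
  qed
  have "mdeg ` {a. \<exists>x. adj_join w c d a x \<noteq> 0} \<subseteq>
      mdeg ` {a. \<exists>x. c a x \<noteq> 0} \<union> (\<lambda>k. k - i) ` mdeg ` {a. \<exists>x. d a x \<noteq> 0}"
  proof
    fix k assume "k \<in> mdeg ` {a. \<exists>x. adj_join w c d a x \<noteq> 0}"
    then obtain a x where k: "k = mdeg a" and "adj_join w c d a x \<noteq> 0" by blast
    from nz[OF this(2)] show "k \<in> mdeg ` {a. \<exists>x. c a x \<noteq> 0} \<union> (\<lambda>k. k - i) ` mdeg ` {a. \<exists>x. d a x \<noteq> 0}"
    proof (elim disjE exE conjE)
      fix b assume b: "a = add_mset w b" "d b x \<noteq> 0"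
      then have "mdeg b - i \<in> (\<lambda>k. k - i) ` mdeg ` {a. \<exists>x. d a x \<noteq> 0}" by blast
      then show ?thesis by (simp add: k b(1) mdeg_add_mset)
    qed (use k in blast)
  qed
  then show "finite (mdeg ` {a. \<exists>x. adj_join w c d a x \<noteq> 0})"
    by (rule finite_subset) (use model_carrierD(5)[OF c] model_carrierD(5)[OF d] in simp)
qed

lemma adj_lft_carrier:
  assumes c: "c \<in> model_carrier p' V"
  shows "adj_lft w c \<in> model_carrier p V"
proof (rule model_carrierI)
  have nz: "w \<notin># a \<and> c a x \<noteq> 0" if "adj_lft w c a x \<noteq> 0" for a x
    using that by (auto simp: adj_lft_def split: if_splits)
  show "a \<in> monomials p \<and> x \<in> V" if "adj_lft w c a x \<noteq> 0" for a x
    using nz[OF that] model_carrierD(1,2)[OF c] monomials_del_gen by blast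
  show "Cinf_on (p 0) V (adj_lft w c a)" for a
  proof (cases "w \<in># a")
    case True
    \<comment> \<open>Monomials contain no generator of index 0, so this coefficient of
      \<open>c\<close> is the zero function, and its smoothness is part of \<open>c\<close> being a
      section.\<close>
    have "{#(0, 0)#} \<notin> monomials p'" by (simp add: monomials_def)
    then have "c {#(0, 0)#} x = 0" for x using model_carrierD(1)[OF c] by blast
    then have "adj_lft w c a = c {#(0, 0)#}" using True by (simp add: adj_lft_def fun_eq_iff)
    then show ?thesis using model_carrierD(3)[OF c, of "{#(0, 0)#}"] by simp
  next
    case False
    then show ?thesis using model_carrierD(3)[OF c, of a] by (simp add: adj_lft_def[abs_def])
  qed
  show "\<exists>W. openin (Euclidean_space (p 0)) W \<and> x \<in> W \<and> finite {a. \<exists>y\<in>W. adj_lft w c a y \<noteq> 0}"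
    if x: "x \<in> V" for x
  proof -
    obtain W where W: "openin (Euclidean_space (p 0)) W" "x \<in> W" "finite {a. \<exists>y\<in>W. c a y \<noteq> 0}"
      using model_carrierD(4)[OF c x] by auto
    moreover have "finite {a. \<exists>y\<in>W. adj_lft w c a y \<noteq> 0}"
      by (rule finite_subset[OF _ W(3)]) (use nz in blast)
    ultimately show ?thesis by blast
  qed
  show "finite (mdeg ` {a. \<exists>x. adj_lft w c a x \<noteq> 0})"
    by (rule finite_subset[OF _ model_carrierD(5)[OF c]]) (use nz in blast)
qed

lemma adj_rgt_carrier:
  assumes c: "c \<in> model_carrier p' V"
  shows "adj_rgt w c \<in> model_carrier p V"
proof -
  \<comment> \<open>This is \<open>adj_rgt w c\<close> without its sign. It is first shown to be a
    section, since \<open>Cinf_sign\<close> changes signs in sections of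
    \<open>model p\<close>.\<close>
  define u where "u a x = (if w \<in># a then 0 else c (add_mset w a) x)" for a x
  have nz: "w \<notin># a \<and> c (add_mset w a) x \<noteq> 0" if "u a x \<noteq> 0" for a x
    using that by (auto simp: u_def split: if_splits)
  have fin: "finite {a. \<exists>y\<in>W. u a y \<noteq> 0}" if "finite {a. \<exists>y\<in>W. c a y \<noteq> 0}" for W
  proof (rule finite_subset)
    show "{a. \<exists>y\<in>W. u a y \<noteq> 0} \<subseteq> (\<lambda>a. a - {#w#}) ` {a. \<exists>y\<in>W. c a y \<noteq> 0}"
    proof
      fix a assume "a \<in> {a. \<exists>y\<in>W. u a y \<noteq> 0}"
      then have "add_mset w a \<in> {a. \<exists>y\<in>W. c a y \<noteq> 0}" using nz by blast
      then show "a \<in> (\<lambda>a. a - {#w#}) ` {a. \<exists>y\<in>W. c a y \<noteq> 0}" by (rule rev_image_eqI) simp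
    qed
  qed (use that in simp)
  have u: "u \<in> model_carrier p V"
  proof (rule model_carrierI)
    show "a \<in> monomials p \<and> x \<in> V" if "u a x \<noteq> 0" for a x
      using nz[OF that] model_carrierD(1,2)[OF c] monomials_del_w by blast
    show "Cinf_on (p 0) V (u a)" for a
    proof (cases "w \<in># a")
      case True
      have "{#(0, 0)#} \<notin> monomials p'" by (simp add: monomials_def)
      then have "c {#(0, 0)#} x = 0" for x using model_carrierD(1)[OF c] by blast
      then have "u a = c {#(0, 0)#}" using True by (simp add: u_def fun_eq_iff)
      then show ?thesis using model_carrierD(3)[OF c, of "{#(0, 0)#}"] by simp
    next
      case False
      then show ?thesis using model_carrierD(3)[OF c, of "add_mset w a"] by (simp add: u_def[abs_def])
    qed
    show "\<exists>W. openin (Euclidean_space (p 0)) W \<and> x \<in> W \<and> finite {a. \<exists>y\<in>W. u a y \<noteq> 0}"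
      if x: "x \<in> V" for x
      using model_carrierD(4)[OF c x] fin by auto
    have "mdeg ` {a. \<exists>x. u a x \<noteq> 0} \<subseteq> (\<lambda>k. k + i) ` mdeg ` {a. \<exists>x. c a x \<noteq> 0}"
    proof
      fix k assume "k \<in> mdeg ` {a. \<exists>x. u a x \<noteq> 0}"
      then obtain a x where k: "k = mdeg a" and "u a x \<noteq> 0" by blast
      then have "add_mset w a \<in> {a. \<exists>x. c a x \<noteq> 0}" using nz by blast
      then have "mdeg (add_mset w a) + i \<in> (\<lambda>k. k + i) ` mdeg ` {a. \<exists>x. c a x \<noteq> 0}" by blast
      then show "k \<in> (\<lambda>k. k + i) ` mdeg ` {a. \<exists>x. c a x \<noteq> 0}" by (simp add: k mdeg_add_mset)
    qed
    then show "finite (mdeg ` {a. \<exists>x. u a x \<noteq> 0})"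
      by (rule finite_subset) (use model_carrierD(5)[OF c] in simp)
  qed
  \<comment> \<open>Where \<open>w\<close> occurs in \<open>a\<close>, \<open>msign\<close> would be
    zero and not a sign. As \<open>u\<close> vanishes there, the factor 1 can stand in for
    it.\<close>
  have eq: "adj_rgt w c a = (\<lambda>x. (if w \<in># a then 1 else msign {#w#} a) * u a x)" for a
    by (simp add: adj_rgt_def u_def fun_eq_iff)
  have nz': "u a x \<noteq> 0" if "adj_rgt w c a x \<noteq> 0" for a x
    using that by (auto simp: eq)
  show ?thesis
  proof (rule model_carrierI)
    show "a \<in> monomials p \<and> x \<in> V" if "adj_rgt w c a x \<noteq> 0" for a x
      using nz'[OF that] model_carrierD(1,2)[OF u] by blast
    show "Cinf_on (p 0) V (adj_rgt w c a)" for a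
      unfolding eq using msign_single_cases[OF w_odd] by (intro Cinf_sign[OF u]) auto
    show "\<exists>W. openin (Euclidean_space (p 0)) W \<and> x \<in> W \<and> finite {a. \<exists>y\<in>W. adj_rgt w c a y \<noteq> 0}"
      if x: "x \<in> V" for x
    proof -
      obtain W where W: "openin (Euclidean_space (p 0)) W" "x \<in> W" "finite {a. \<exists>y\<in>W. u a y \<noteq> 0}"
        using model_carrierD(4)[OF u x] by blast
      moreover have "finite {a. \<exists>y\<in>W. adj_rgt w c a y \<noteq> 0}"
        by (rule finite_subset[OF _ W(3)]) (use nz' in blast)
      ultimately show ?thesis by blast
    qed
    show "finite (mdeg ` {a. \<exists>x. adj_rgt w c a x \<noteq> 0})"
      by (rule finite_subset[OF _ model_carrierD(5)[OF u]]) (use nz' in blast)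
  qed
qed

end

lemma adj_lft_join:
  assumes c: "c \<in> model_carrier p V"
  shows "adj_lft w (adj_join w c d) = c"
proof (intro ext)
  fix a x
  have "c a x = 0" if "w \<in># a" using that w_not_in_monomial model_carrierD(1)[OF c] by blast
  then show "adj_lft w (adj_join w c d) a x = c a x"
    by (simp add: adj_lft_def adj_join_def)
qed

lemma adj_rgt_join:
  assumes d: "d \<in> model_carrier p V"
  shows "adj_rgt w (adj_join w c d) = d"
proof (intro ext)
  fix a x
  have "d a x = 0" if "w \<in># a" using that w_not_in_monomial model_carrierD(1)[OF d] by blast
  then show "adj_rgt w (adj_join w c d) a x = d a x"
    using msign_single_square[OF w_odd] by (simp add: adj_rgt_def adj_join_def flip: mult.assoc)
qed

text \<open>The sign enters once through \<open>adj_rgt\<close> and once through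
  \<open>adj_join\<close>, and its square is 1. The splitting discards the coefficients at multisets
  with \<open>w\<close> repeated, but these are zero.\<close>

lemma adj_join_lft_rgt:
  assumes c: "c \<in> model_carrier p' V"
  shows "adj_join w (adj_lft w c) (adj_rgt w c) = c"
proof (intro ext)
  fix a x
  show "adj_join w (adj_lft w c) (adj_rgt w c) a x = c a x"
  proof (cases "w \<in># a")
    case False
    then show ?thesis by (simp add: adj_lft_def adj_join_def)
  next
    case True
    then obtain b where a: "a = add_mset w b" by (metis insert_DiffM)
    have "c a x = 0" if "w \<in># b"
      using that a w_not_in_monomial monomials_del_w model_carrierD(1)[OF c] by blast
    then show ?thesis
      using msign_single_square[OF w_odd, of b] by (simp add: a adj_rgt_def adj_join_def flip: mult.assoc)
  qed
qed

lemma adj_join_res: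
  "adj_join w (res (model p) U V c) (res (model p) U V d) = res (model p') U V (adj_join w c d)"
  by (auto simp: adj_join_def fun_eq_iff)

lemma adj_join_part:
  assumes "adj_join w c d \<in> model_carrier p' V" "c \<in> gpart (model p) V k" "d \<in> gpart (model p) V (k + i)"
  shows "adj_join w c d \<in> gpart (model p') V k"
  using assms by (auto simp: adj_join_def mdeg_add_mset dest!: multi_member_split split: if_splits)

lemma adj_lft_part:
  "\<lbrakk>adj_lft w c \<in> model_carrier p V; c \<in> gpart (model p') V k\<rbrakk> \<Longrightarrow> adj_lft w c \<in> gpart (model p) V k"
  by (auto simp: adj_lft_def split: if_splits)

text \<open>The generator \<open>w\<close> has degree \<open>- i\<close>, so its cofactor in degree
  \<open>k\<close> has degree \<open>k + i\<close>.\<close>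

lemma adj_rgt_part:
  assumes "adj_rgt w c \<in> model_carrier p V" "c \<in> gpart (model p') V k"
  shows "adj_rgt w c \<in> gpart (model p) V (k + i)"
proof -
  have "mdeg a = k + i" if "adj_rgt w c a x \<noteq> 0" for a x
  proof -
    have "c (add_mset w a) x \<noteq> 0" using that by (auto simp: adj_rgt_def split: if_splits)
    then have "mdeg (add_mset w a) = k" using assms(2) by auto
    then show ?thesis by (simp add: mdeg_add_mset)
  qed
  then show ?thesis using assms(1) by auto
qed

end

text \<open>Over a chart, \<epsilon> corresponds to the new generator \<open>w\<close>, as both are
  odd of degree \<open>- i\<close>. The homomorphism laws are computed for \<open>\<xi>'\<close>;
  for \<open>\<phi>'\<close> it is enough that it is inverse to \<open>\<xi>'\<close> and respects
  degrees.\<close>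

lemma chart_sections:
  fixes A :: "(real, 'f) module"
  assumes i: "odd i" and e: "pairing e" and A: "galg A C"
    and \<phi>: "graded_hom (sect (model p) V) (gpart (model p) V) A C \<phi>"
    and \<xi>: "graded_hom A C (sect (model p) V) (gpart (model p) V) \<xi>"
    and \<xi>\<phi>: "\<forall>c\<in>model_carrier p V. \<xi> (\<phi> c) = c"
    and \<phi>\<xi>: "\<forall>f\<in>carrier A. \<phi> (\<xi> f) = f"
  defines "w \<equiv> (i, p i)" and "p' \<equiv> add_gen p i"
  defines "\<xi>' \<equiv> \<lambda>f. adj_join w (\<xi> (lft e f)) (\<xi> (rgt e f))"
    and "\<phi>' \<equiv> \<lambda>c. e (\<phi> (adj_lft w c)) (\<phi> (adj_rgt w c))"
  shows "graded_hom (ext_alg e A C) (ext_part e (- i) C) (sect (model p') V) (gpart (model p') V) \<xi>'"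
    and "\<And>c. c \<in> model_carrier p' V \<Longrightarrow> \<phi>' c \<in> carrier (ext_alg e A C)"
    and "\<And>c. c \<in> model_carrier p' V \<Longrightarrow> \<xi>' (\<phi>' c) = c"
    and "\<And>f. f \<in> carrier (ext_alg e A C) \<Longrightarrow> \<phi>' (\<xi>' f) = f"
    and "\<And>c k. c \<in> gpart (model p') V k \<Longrightarrow> \<phi>' c \<in> ext_part e (- i) C k"
    and "\<And>c. c \<in> model_carrier p' V \<Longrightarrow> adj_lft w c \<in> model_carrier p V"
    and "\<And>c. c \<in> model_carrier p' V \<Longrightarrow> adj_rgt w c \<in> model_carrier p V"
    and "\<And>c d. \<lbrakk>c \<in> model_carrier p V; d \<in> model_carrier p V\<rbrakk> \<Longrightarrow> adj_join w c d \<in> model_carrier p' V"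
proof -
  interpret galg_ext A C e "- i" by (intro galg_ext.intro galg_ext_axioms.intro e A)
  have x: "\<xi> \<in> ring_hom A (sect (model p) V)" "\<And>r f. f \<in> carrier A \<Longrightarrow> \<xi> (r \<odot>\<^bsub>A\<^esub> f) = (\<lambda>a x. r * \<xi> f a x)"
    "\<And>k f. f \<in> C k \<Longrightarrow> \<xi> f \<in> gpart (model p) V k"
    using \<xi> unfolding graded_hom_def by (simp_all add: image_subset_iff)
  have xc: "\<xi> f \<in> model_carrier p V" if "f \<in> carrier A" for f
    using ring_hom_closed[OF x(1) that] by simp
  have xa: "\<xi> (f \<oplus>\<^bsub>A\<^esub> g) = (\<lambda>a y. \<xi> f a y + \<xi> g a y)" and xm: "\<xi> (f \<otimes>\<^bsub>A\<^esub> g) = mmult (\<xi> f) (\<xi> g)"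
    if "f \<in> carrier A" "g \<in> carrier A" for f g
    using ring_hom_add[OF x(1) that] ring_hom_mult[OF x(1) that] by simp_all
  have x0: "\<xi> \<zero>\<^bsub>A\<^esub> = (\<lambda>a y. 0)"
    using x(2)[of "\<zero>\<^bsub>A\<^esub>" 0] by simp
  have x1: "\<xi> \<one>\<^bsub>A\<^esub> = (\<lambda>a y. if a = {#} \<and> y \<in> V then 1 else 0)"
    using ring_hom_one[OF x(1)] by simp
  \<comment> \<open>In coordinates the parity automorphism multiplies each monomial by the sign of
    its degree, which is the form that appears in \<open>mmult_adj_join\<close>.\<close>
  have xpar: "\<xi> (par A C f) = (\<lambda>a y. sgn_deg (mdeg a) * \<xi> f a y)" if "f \<in> carrier A" for f
    using that
  proof (induct rule: graded_induct)
    case (part k f)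
    have "\<xi> f a y \<noteq> 0 \<Longrightarrow> mdeg a = k" for a y using x(3)[OF part] by auto
    then have eq: "sgn_deg k * \<xi> f a y = sgn_deg (mdeg a) * \<xi> f a y" for a y by (cases "\<xi> f a y = 0") auto
    show ?case unfolding par_part[OF part] x(2)[OF part_sub[OF part]] by (intro ext eq)
  qed (simp add: par_add xa distrib_left)
  have pc: "\<phi> c \<in> carrier A" if "c \<in> model_carrier p V" for c
    using graded_hom_closed[OF \<phi>, of c] that by simp
  \<comment> \<open>The negative is formed in \<open>A\<close> and brought back by the chart. This
    supplies the hypothesis under which the splitting was shown to respect carriers.\<close>
  have neg: "(\<lambda>a x. - c a x) \<in> model_carrier p V" if "c \<in> model_carrier p V" for c
  proof -
    have "(\<lambda>a x. - c a x) = \<xi> ((- 1) \<odot>\<^bsub>A\<^esub> \<phi> c)" by (simp add: x(2) pc[OF that] bspec[OF \<xi>\<phi> that])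
    then show ?thesis using xc pc[OF that] by simp
  qed
  show lc: "adj_lft w c \<in> model_carrier p V" and rc: "adj_rgt w c \<in> model_carrier p V"
    if "c \<in> model_carrier p' V" for c
    using adj_lft_carrier[OF i neg, of c] adj_rgt_carrier[OF i neg, of c] that by (simp_all add: w_def p'_def)
  show jc: "adj_join w c d \<in> model_carrier p' V" if "c \<in> model_carrier p V" "d \<in> model_carrier p V" for c d
    unfolding w_def p'_def by (rule adj_join_carrier[OF i neg that])
  show "\<phi>' c \<in> carrier (ext_alg e A C)" if "c \<in> model_carrier p' V" for c
    using lc[OF that] rc[OF that] pc by (simp add: \<phi>'_def e)
  show "\<xi>' (\<phi>' c) = c" if c: "c \<in> model_carrier p' V" for c
    using adj_join_lft_rgt[OF i, of c p V] lc[OF c] rc[OF c] c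
    by (simp add: \<phi>'_def \<xi>'_def e \<xi>\<phi> flip: w_def p'_def)
  show "\<phi>' (\<xi>' f) = f" if "f \<in> carrier (ext_alg e A C)" for f
    using that xc adj_lft_join[OF i, of "\<xi> (lft e f)" p V] adj_rgt_join[OF i, of "\<xi> (rgt e f)" p V]
    by (simp add: \<phi>'_def \<xi>'_def e \<phi>\<xi> flip: w_def)
  show "\<phi>' c \<in> ext_part e (- i) C k" if c: "c \<in> gpart (model p') V k" for c k
  proof -
    have c': "c \<in> model_carrier p' V" using c by simp
    have "adj_lft w c \<in> gpart (model p) V k" "adj_rgt w c \<in> gpart (model p) V (k + i)"
      using adj_lft_part[OF i] adj_rgt_part[OF i] lc[OF c'] rc[OF c'] c unfolding w_def p'_def by blast+
    then have "\<phi> (adj_lft w c) \<in> C k" "\<phi> (adj_rgt w c) \<in> C (k + i)"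
      using \<phi> unfolding graded_hom_def by blast+
    then show ?thesis by (simp add: \<phi>'_def ext_part_def e)
  qed
  have "\<xi>' f \<in> gpart (model p') V k" if "f \<in> ext_part e (- i) C k" for f k
  proof -
    have f: "lft e f \<in> C k" "rgt e f \<in> C (k + i)" using that by (simp_all add: ext_part_def)
    show ?thesis
      unfolding \<xi>'_def w_def p'_def
      by (rule adj_join_part[OF i])
        (use jc[OF xc xc, OF part_sub[OF f(1)] part_sub[OF f(2)]] x(3)[OF f(1)] x(3)[OF f(2)]
          in \<open>simp_all add: w_def p'_def\<close>)
  qed
  moreover have "\<xi>' (f \<otimes>\<^bsub>E\<^esub> g) = mmult (\<xi>' f) (\<xi>' g)" if "f \<in> carrier E" "g \<in> carrier E" for f g
  proof -
    have supp: "\<And>a x. \<xi> h a x \<noteq> 0 \<Longrightarrow> a \<in> monomials p" if "h \<in> carrier A" for h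
      using model_carrierD(1)[OF xc[OF that]] .
    have "mmult (\<xi>' f) (\<xi>' g) = adj_join w (mmult (\<xi> (lft e f)) (\<xi> (lft e g)))
       (\<lambda>a x. mmult (\<lambda>a x. sgn_deg (mdeg a) * \<xi> (lft e f) a x) (\<xi> (rgt e g)) a x +
         mmult (\<xi> (rgt e f)) (\<xi> (lft e g)) a x)"
      unfolding \<xi>'_def
      by (rule mmult_adj_join[where p = p])
        (use i that supp w_not_in_monomial[OF i] in \<open>auto simp: w_def\<close>)
    then show ?thesis
      using that by (simp add: \<xi>'_def e xm xa xpar)
  qed
  moreover have "\<xi>' \<one>\<^bsub>E\<^esub> = (\<lambda>a y. if a = {#} \<and> y \<in> V then 1 else 0)"
    by (auto simp: \<xi>'_def e x0 x1 adj_join_def fun_eq_iff)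
  moreover have "\<xi>' (f \<oplus>\<^bsub>E\<^esub> g) = (\<lambda>a y. \<xi>' f a y + \<xi>' g a y)" if "f \<in> carrier E" "g \<in> carrier E" for f g
    using that by (auto simp: \<xi>'_def e xa adj_join_def fun_eq_iff distrib_left)
  moreover have "\<xi>' (r \<odot>\<^bsub>E\<^esub> f) = (\<lambda>a y. r * \<xi>' f a y)" if "f \<in> carrier E" for r f
    using that by (auto simp: \<xi>'_def e x(2) adj_join_def fun_eq_iff)
  moreover have "\<xi>' f \<in> model_carrier p' V" if "f \<in> carrier E" for f
    using that jc xc by (simp add: \<xi>'_def)
  ultimately show "graded_hom E (ext_part e (- i) C) (sect (model p') V) (gpart (model p') V) \<xi>'"
    unfolding graded_hom_def ring_hom_def by (simp add: image_subset_iff Pi_iff del: ext_alg_simps(2-6) model_simps(8))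
qed

section \<open>The extended space is a supermanifold\<close>

lemma comp_mor_id:
  assumes \<mu>: "graded_morphism S Y \<mu>" and id: "comp_mor S Y S \<nu> \<mu> = id_mor S"
  shows "x \<in> topspace (supp S) \<Longrightarrow> base \<nu> (base \<mu> x) = x"
    and "openin (supp S) V \<Longrightarrow> preim S \<mu> (preim Y \<nu> V) = V"
    and "\<lbrakk>openin (supp S) V; f \<in> carrier (sect S V)\<rbrakk> \<Longrightarrow> pull \<mu> (preim Y \<nu> V) (pull \<nu> V f) = f"
proof -
  show "x \<in> topspace (supp S) \<Longrightarrow> base \<nu> (base \<mu> x) = x"
    using comp_mor_base[of x S Y S \<nu> \<mu>] id by simp
  show "openin (supp S) V \<Longrightarrow> preim S \<mu> (preim Y \<nu> V) = V"
    using preim_comp[OF \<mu>, of S \<nu> V] id preim_id by metis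
  show "\<lbrakk>openin (supp S) V; f \<in> carrier (sect S V)\<rbrakk> \<Longrightarrow> pull \<mu> (preim Y \<nu> V) (pull \<nu> V f) = f"
    using comp_mor_pull[of S V f S Y \<nu> \<mu>] id by simp
qed

lemma open_part_simps [simp]:
  "supp (open_part S W) = subtopology (supp S) W"
  "sect (open_part S W) = sect S" "gpart (open_part S W) = gpart S" "res (open_part S W) = res S"
  by (simp_all add: open_part_def)

text \<open>The base maps stay the same and \<epsilon> is sent to \<open>w\<close>. Over each open
  set \<open>chart_sections\<close> provides the isomorphism of algebras; compatibility with
  restriction holds coefficient by coefficient.\<close>

lemma isomorphism_ext:
  assumes S: "graded_presheaf S" and e: "pairing e" and i: "odd i"
    and iso: "isomorphism S (open_part (model p) U) \<Phi>"
  shows "\<exists>\<Phi>'. isomorphism (ext_space e (- i) S) (open_part (model (add_gen p i)) U) \<Phi>'"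
proof -
  define Y where "Y = open_part (model p) U"
  define Y' where "Y' = open_part (model (add_gen p i)) U"
  define T where "T = ext_space e (- i) S"
  define w where "w = (i, p i)"
  have supp[simp]: "supp Y' = supp Y" "supp T = supp S"
    using i by (simp_all add: Y_def Y'_def T_def)
  have sY[simp]: "sect Y = sect (model p)" "gpart Y = gpart (model p)" "res Y = res (model p)"
    "sect Y' = sect (model (add_gen p i))" "gpart Y' = gpart (model (add_gen p i))"
    "res Y' = res (model (add_gen p i))"
    by (simp_all add: Y_def Y'_def)
  have sT[simp]: "sect T W = ext_alg e (sect S W) (gpart S W)" "gpart T W = ext_part e (- i) (gpart S W)" for W
    by (simp_all add: T_def)
  have rT: "res T W W' x = e (res S W W' (lft e x)) (res S W W' (rgt e x))" for W W' x
    by (simp add: T_def)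
  obtain \<Xi> where \<Phi>: "graded_morphism S Y \<Phi>" and \<Xi>: "graded_morphism Y S \<Xi>"
    and ids: "comp_mor S Y S \<Xi> \<Phi> = id_mor S" "comp_mor Y S Y \<Phi> \<Xi> = id_mor Y"
    using iso unfolding isomorphism_def Y_def by blast
  note idS = comp_mor_id[OF \<Phi> ids(1)] and idY = comp_mor_id[OF \<Xi> ids(2)]
  define \<Phi>' where "\<Phi>' = mk_mor T Y' (base \<Phi>)
    (\<lambda>V c. e (pull \<Phi> V (adj_lft w c)) (pull \<Phi> V (adj_rgt w c)))"
  define \<Xi>' where "\<Xi>' = mk_mor Y' T (base \<Xi>)
    (\<lambda>W f. adj_join w (pull \<Xi> W (lft e f)) (pull \<Xi> W (rgt e f)))"
  have pre\<Phi>: "preim T \<Phi>' V = preim S \<Phi> V" for V by (auto simp: \<Phi>'_def preim_mk_mor preim_def)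
  have pre\<Xi>: "preim Y' \<Xi>' W = preim Y \<Xi> W" for W by (auto simp: \<Xi>'_def preim_mk_mor preim_def)
  have pull\<Phi>: "pull \<Phi>' V c = e (pull \<Phi> V (adj_lft w c)) (pull \<Phi> V (adj_rgt w c))"
    if "openin (supp Y) V" "c \<in> model_carrier (add_gen p i) V" for V c
    unfolding \<Phi>'_def using that by (subst mk_mor_pull) simp_all
  have pull\<Xi>: "pull \<Xi>' W f = adj_join w (pull \<Xi> W (lft e f)) (pull \<Xi> W (rgt e f))"
    if "openin (supp S) W" "f \<in> carrier (sect T W)" for W f
    unfolding \<Xi>'_def using that by (subst mk_mor_pull) simp_all
  have chart: "galg (sect S (preim S \<Phi> V)) (gpart S (preim S \<Phi> V))"
      "graded_hom (sect (model p) V) (gpart (model p) V) (sect S (preim S \<Phi> V)) (gpart S (preim S \<Phi> V)) (pull \<Phi> V)"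
      "graded_hom (sect S (preim S \<Phi> V)) (gpart S (preim S \<Phi> V)) (sect (model p) V) (gpart (model p) V) (pull \<Xi> (preim S \<Phi> V))"
      "\<forall>c\<in>model_carrier p V. pull \<Xi> (preim S \<Phi> V) (pull \<Phi> V c) = c"
      "\<forall>f\<in>carrier (sect S (preim S \<Phi> V)). pull \<Phi> V (pull \<Xi> (preim S \<Phi> V) f) = f"
    if V: "openin (supp Y) V" for V
  proof -
    note W = openin_preim[OF \<Phi> V]
    show "galg (sect S (preim S \<Phi> V)) (gpart S (preim S \<Phi> V))" by (rule presheaf_galg[OF S W])
    show "graded_hom (sect (model p) V) (gpart (model p) V) (sect S (preim S \<Phi> V)) (gpart S (preim S \<Phi> V)) (pull \<Phi> V)"
      using graded_morphism_hom[OF \<Phi> V] by (simp only: sY)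
    show "graded_hom (sect S (preim S \<Phi> V)) (gpart S (preim S \<Phi> V)) (sect (model p) V) (gpart (model p) V) (pull \<Xi> (preim S \<Phi> V))"
      using graded_morphism_hom[OF \<Xi> W] by (simp only: sY idY(2)[OF V])
    show "\<forall>c\<in>model_carrier p V. pull \<Xi> (preim S \<Phi> V) (pull \<Phi> V c) = c"
      using idY(3)[OF V] by simp
    show "\<forall>f\<in>carrier (sect S (preim S \<Phi> V)). pull \<Phi> V (pull \<Xi> (preim S \<Phi> V) f) = f"
      using idS(3)[OF W] idY(2)[OF V] by simp
  qed
  have galgT: "galg (sect T W) (gpart T W)" if W: "openin (supp S) W" for W
    using graded_presheaf_ext[OF S e] W presheaf_galg[of T W] by (simp add: T_def)
  have g\<Xi>: "graded_morphism Y' T \<Xi>'"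
    unfolding graded_morphism_def
  proof (intro conjI allI impI ballI; (elim conjE)?)
    show "\<Xi>' = mk_mor Y' T (base \<Xi>') (pull \<Xi>')" by (simp add: \<Xi>'_def)
    show "continuous_map (supp Y') (supp T) (base \<Xi>')"
      using graded_morphism_continuous[OF \<Xi>] unfolding supp
      by (rule continuous_map_eq) (simp add: \<Xi>'_def)
  next
    fix W assume "openin (supp T) W"
    then have W: "openin (supp S) W" by simp
    let ?V = "preim Y \<Xi> W"
    have V: "openin (supp Y) ?V" by (rule openin_preim[OF \<Xi> W])
    have hom: "graded_hom (sect T W) (gpart T W) (sect Y' ?V) (gpart Y' ?V)
        (\<lambda>f. adj_join w (pull \<Xi> W (lft e f)) (pull \<Xi> W (rgt e f)))"
      using chart_sections(1)[OF i e chart(1-3)[OF V], OF chart(4-5)[OF V], folded w_def] unfolding sT sY idS(2)[OF W] .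
    show "graded_hom (sect T W) (gpart T W) (sect Y' (preim Y' \<Xi>' W)) (gpart Y' (preim Y' \<Xi>' W)) (pull \<Xi>' W)"
      unfolding pre\<Xi> by (rule graded_hom_cong[OF galgT[OF W] hom]) (rule pull\<Xi>[OF W])
  next
    fix W1 W2 f assume "openin (supp T) W1" "openin (supp T) W2" "W2 \<subseteq> W1" and f: "f \<in> carrier (sect T W1)"
    then have W: "openin (supp S) W1" "openin (supp S) W2" "W2 \<subseteq> W1" by simp_all
    have f': "lft e f \<in> carrier (sect S W1)" "rgt e f \<in> carrier (sect S W1)" using f by simp_all
    have rf: "res T W1 W2 f \<in> carrier (sect T W2)"
      using f' graded_hom_closed[OF presheaf_res_hom[OF S W]] by (simp add: rT e)
    show "pull \<Xi>' W2 (res T W1 W2 f) = res Y' (preim Y' \<Xi>' W1) (preim Y' \<Xi>' W2) (pull \<Xi>' W1 f)"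
      unfolding pull\<Xi>[OF W(2) rf] pull\<Xi>[OF W(1) f] pre\<Xi>
      using graded_morphism_res[OF \<Xi> W f'(1)] graded_morphism_res[OF \<Xi> W f'(2)]
      by (simp only: rT pairing_simps[OF e] sY w_def adj_join_res[OF i])
  qed
  have g\<Phi>: "graded_morphism T Y' \<Phi>'"
    unfolding graded_morphism_def
  proof (intro conjI allI impI ballI; (elim conjE)?)
    show "\<Phi>' = mk_mor T Y' (base \<Phi>') (pull \<Phi>')" by (simp add: \<Phi>'_def)
    show "continuous_map (supp T) (supp Y') (base \<Phi>')"
      using graded_morphism_continuous[OF \<Phi>] unfolding supp
      by (rule continuous_map_eq) (simp add: \<Phi>'_def)
  next
    fix V assume "openin (supp Y') V"
    then have V: "openin (supp Y) V" by simp
    note s = chart_sections[OF i e chart(1-3)[OF V], OF chart(4-5)[OF V], folded w_def]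
    have W: "openin (supp S) (preim S \<Phi> V)" by (rule openin_preim[OF \<Phi> V])
    show "graded_hom (sect Y' V) (gpart Y' V) (sect T (preim T \<Phi>' V)) (gpart T (preim T \<Phi>' V)) (pull \<Phi>' V)"
      unfolding pre\<Phi>
    \<comment> \<open>In this direction the homomorphism laws are inherited from the inverse
      map.\<close>
    proof (rule graded_hom_inverse[OF galgT[OF W]])
      show "graded_hom (sect T (preim S \<Phi> V)) (gpart T (preim S \<Phi> V)) (sect Y' V) (gpart Y' V)
        (\<lambda>f. adj_join w (pull \<Xi> (preim S \<Phi> V) (lft e f)) (pull \<Xi> (preim S \<Phi> V) (rgt e f)))"
        using s(1) unfolding sT sY .
    next
      fix c assume "c \<in> carrier (sect Y' V)"
      then have c: "c \<in> model_carrier (add_gen p i) V" by simp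
      show "pull \<Phi>' V c \<in> carrier (sect T (preim S \<Phi> V))"
        unfolding pull\<Phi>[OF V c] sT by (rule s(2)[OF c])
      show "adj_join w (pull \<Xi> (preim S \<Phi> V) (lft e (pull \<Phi>' V c))) (pull \<Xi> (preim S \<Phi> V) (rgt e (pull \<Phi>' V c))) = c"
        unfolding pull\<Phi>[OF V c] by (rule s(3)[OF c])
    next
      fix f assume f: "f \<in> carrier (sect T (preim S \<Phi> V))"
      have "adj_join w (pull \<Xi> (preim S \<Phi> V) (lft e f)) (pull \<Xi> (preim S \<Phi> V) (rgt e f)) \<in> model_carrier (add_gen p i) V"
        using f graded_hom_closed[OF chart(3)[OF V]] by (intro s(8)) (simp_all del: ext_alg_simps(2-6))
      from pull\<Phi>[OF V this] s(4)[of f] f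
      show "pull \<Phi>' V (adj_join w (pull \<Xi> (preim S \<Phi> V) (lft e f)) (pull \<Xi> (preim S \<Phi> V) (rgt e f))) = f"
        unfolding sT by simp
    next
      fix k c assume c: "c \<in> gpart Y' V k"
      then have c': "c \<in> model_carrier (add_gen p i) V" by simp
      show "pull \<Phi>' V c \<in> gpart T (preim S \<Phi> V) k"
        unfolding pull\<Phi>[OF V c'] sT by (rule s(5)) (use c in simp)
    qed
  next
    fix V1 V2 c assume "openin (supp Y') V1" "openin (supp Y') V2" "V2 \<subseteq> V1" "c \<in> carrier (sect Y' V1)"
    then have V: "openin (supp Y) V1" "openin (supp Y) V2" "V2 \<subseteq> V1" and c: "c \<in> model_carrier (add_gen p i) V1"
      by simp_all
    note s1 = chart_sections[OF i e chart(1-3)[OF V(1)], OF chart(4-5)[OF V(1)], folded w_def] and s2 = chart_sections[OF i e chart(1-3)[OF V(2)], OF chart(4-5)[OF V(2)], folded w_def]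
    note lr = s1(6)[OF c] s1(7)[OF c]
    \<comment> \<open>That a restricted model section is again a model section is obtained by
      passing to \<open>S\<close>, restricting there, and coming back.\<close>
    have res: "res (model p) V1 V2 d \<in> model_carrier p V2" if d: "d \<in> model_carrier p V1" for d
    proof -
      note W1 = openin_preim[OF \<Phi> V(1)] and W2 = openin_preim[OF \<Phi> V(2)]
      let ?f = "pull \<Phi> V1 d"
      have f: "?f \<in> carrier (sect S (preim S \<Phi> V1))" using pull_closed[OF \<Phi> V(1), of d] d by simp
      have "pull \<Xi> (preim S \<Phi> V2) (res S (preim S \<Phi> V1) (preim S \<Phi> V2) ?f) =
          res Y (preim Y \<Xi> (preim S \<Phi> V1)) (preim Y \<Xi> (preim S \<Phi> V2)) (pull \<Xi> (preim S \<Phi> V1) ?f)"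
        by (rule graded_morphism_res[OF \<Xi> W1 W2 preim_mono[OF V(3)] f])
      also have "\<dots> = res (model p) V1 V2 d"
        unfolding idY(2)[OF V(1)] idY(2)[OF V(2)] sY using bspec[OF chart(4)[OF V(1)] d] by simp
      finally show ?thesis
        using graded_hom_closed[OF chart(3)[OF V(2)]
            graded_hom_closed[OF presheaf_res_hom[OF S W1 W2 preim_mono[OF V(3)]] f]] by simp
    qed
    have c_eq: "adj_join w (adj_lft w c) (adj_rgt w c) = c"
      using adj_join_lft_rgt[OF i c] by (simp add: w_def)
    have rc: "res Y' V1 V2 c = adj_join w (res Y V1 V2 (adj_lft w c)) (res Y V1 V2 (adj_rgt w c))"
      unfolding sY w_def adj_join_res[OF i] unfolding w_def[symmetric] c_eq ..
    have rc': "res Y' V1 V2 c \<in> model_carrier (add_gen p i) V2"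
      unfolding rc unfolding sY by (rule s2(8)[OF res[OF lr(1)] res[OF lr(2)]])
    have l: "adj_lft w (res Y' V1 V2 c) = res Y V1 V2 (adj_lft w c)"
      and r: "adj_rgt w (res Y' V1 V2 c) = res Y V1 V2 (adj_rgt w c)"
      unfolding rc unfolding w_def sY using res[OF lr(1)] res[OF lr(2)]
      by (simp_all add: adj_lft_join[OF i] adj_rgt_join[OF i] w_def del: model_simps)
    have lr': "adj_lft w c \<in> carrier (sect Y V1)" "adj_rgt w c \<in> carrier (sect Y V1)" using lr by simp_all
    show "pull \<Phi>' V2 (res Y' V1 V2 c) = res T (preim T \<Phi>' V1) (preim T \<Phi>' V2) (pull \<Phi>' V1 c)"
      unfolding pull\<Phi>[OF V(2) rc'] pull\<Phi>[OF V(1) c] pre\<Phi> rT pairing_simps[OF e] l r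
        graded_morphism_res[OF \<Phi> V lr'(1)] graded_morphism_res[OF \<Phi> V lr'(2)] ..
  qed
  have "comp_mor T Y' T \<Xi>' \<Phi>' = id_mor T"
    unfolding comp_mor_def id_mor_def
  proof (rule mk_mor_cong)
    fix x assume x: "x \<in> topspace (supp T)"
    then have "base \<Phi>' x = base \<Phi> x" by (simp add: \<Phi>'_def)
    moreover have "base \<Phi> x \<in> topspace (supp Y')"
      using graded_morphism_base[OF \<Phi>, of x] x by simp
    ultimately show "base \<Xi>' (base \<Phi>' x) = x"
      using idS(1)[of x] x by (simp add: \<Xi>'_def)
  next
    fix W f assume "openin (supp T) W" and f: "f \<in> carrier (sect T W)"
    then have W: "openin (supp S) W" by simp
    have V: "openin (supp Y) (preim Y \<Xi> W)" by (rule openin_preim[OF \<Xi> W])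
    note s = chart_sections[OF i e chart(1-3)[OF V], OF chart(4-5)[OF V], folded w_def, unfolded idS(2)[OF W]]
    have "pull \<Xi>' W f \<in> carrier (sect Y' (preim Y' \<Xi>' W))" using pull_closed[OF g\<Xi>, of W f] W f by simp
    then have c: "pull \<Xi>' W f \<in> model_carrier (add_gen p i) (preim Y \<Xi> W)" by (simp add: pre\<Xi>)
    show "pull \<Phi>' (preim Y' \<Xi>' W) (pull \<Xi>' W f) = f"
      unfolding pre\<Xi> pull\<Phi>[OF V c] unfolding pull\<Xi>[OF W f] by (rule s(4)) (use f in simp)
  qed
  moreover have "comp_mor Y' T Y' \<Phi>' \<Xi>' = id_mor Y'"
    unfolding comp_mor_def id_mor_def
  proof (rule mk_mor_cong)
    fix x assume x: "x \<in> topspace (supp Y')"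
    then have "base \<Xi>' x = base \<Xi> x" by (simp add: \<Xi>'_def)
    moreover have "base \<Xi> x \<in> topspace (supp T)"
      using graded_morphism_base[OF \<Xi>, of x] x by simp
    ultimately show "base \<Phi>' (base \<Xi>' x) = x"
      using idY(1)[of x] x by (simp add: \<Phi>'_def)
  next
    fix V c assume "openin (supp Y') V" "c \<in> carrier (sect Y' V)"
    then have V: "openin (supp Y) V" and c: "c \<in> model_carrier (add_gen p i) V" by simp_all
    have W: "openin (supp S) (preim S \<Phi> V)" by (rule openin_preim[OF \<Phi> V])
    note s = chart_sections[OF i e chart(1-3)[OF V], OF chart(4-5)[OF V], folded w_def]
    have f: "pull \<Phi>' V c \<in> carrier (sect T (preim S \<Phi> V))"
      unfolding pull\<Phi>[OF V c] sT by (rule s(2)[OF c])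
    show "pull \<Xi>' (preim T \<Phi>' V) (pull \<Phi>' V c) = c"
      unfolding pre\<Phi> pull\<Xi>[OF W f] unfolding pull\<Phi>[OF V c] by (rule s(3)[OF c])
  qed
  ultimately have "isomorphism T Y' \<Phi>'"
    using g\<Phi> g\<Xi> unfolding isomorphism_def by blast
  then show ?thesis unfolding T_def Y'_def by blast
qed

lemma graded_presheaf_open_part:
  assumes "graded_presheaf S" "openin (supp S) W"
  shows "graded_presheaf (open_part S W)"
proof -
  have "openin (subtopology (supp S) W) V \<Longrightarrow> openin (supp S) V" for V
    using assms(2) openin_trans_full by blast
  then show ?thesis
    using assms(1) unfolding graded_presheaf_def open_part_simps by meson
qed

lemma supermanifold_presheaf: "supermanifold S \<Longrightarrow> graded_presheaf S"
  by (auto simp: supermanifold_def supermanifold_dim_def graded_sheaf_def)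

lemma supermanifold_ext:
  assumes S: "supermanifold S" and e: "pairing e" and d: "odd d"
  shows "supermanifold (ext_space e d S)"
proof -
  obtain p where p: "supermanifold_dim p S" using S by (auto simp: supermanifold_def)
  have i: "odd (- d)" using d by simp
  have "supermanifold_dim (add_gen p (- d)) (ext_space e d S)"
    unfolding supermanifold_dim_def
  proof (intro conjI ballI)
    show "graded_sheaf (ext_space e d S)"
      using p e by (simp add: supermanifold_dim_def graded_sheaf_ext)
    fix x assume "x \<in> topspace (supp (ext_space e d S))"
    then obtain W U \<Phi> where W: "openin (supp S) W" "x \<in> W" and U: "openin (Euclidean_space (p 0)) U"
      and iso: "isomorphism (open_part S W) (open_part (model p) U) \<Phi>"
      using p unfolding supermanifold_dim_def ext_space_simps by blast
    \<comment> \<open>A generator of index \<open>i\<close> has degree \<open>- i\<close>, so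
      \<epsilon> of degree \<open>d\<close> becomes a generator of index \<open>- d\<close>; hence
      the double negation.\<close>
    have "open_part (ext_space e d S) W = ext_space e (- (- d)) (open_part S W)"
      by (simp add: open_part_def ext_space_def)
    then obtain \<Phi>' where "isomorphism (open_part (ext_space e d S) W) (open_part (model (add_gen p (- d))) U) \<Phi>'"
      using isomorphism_ext[OF graded_presheaf_open_part[OF supermanifold_presheaf[OF S] W(1)] e i iso] by metis
    then show "\<exists>W U \<Phi>. openin (supp (ext_space e d S)) W \<and> x \<in> W \<and>
        openin (Euclidean_space (add_gen p (- d) 0)) U \<and>
        isomorphism (open_part (ext_space e d S) W) (open_part (model (add_gen p (- d))) U) \<Phi>"
      using W U add_gen_0[OF i, of p] by auto
  qed
  then show ?thesis by (auto simp: supermanifold_def)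
qed

section \<open>Derivations into fibre powers\<close>

lemma fibre_powerD:
  fixes P :: "('x, 'f) gspace"
  assumes "fibre_power M G s t q P pr"
  shows "supermanifold P" and "\<And>k. k \<in> {1..q} \<Longrightarrow> smorphism P G (pr k)"
    and "\<And>k. k \<in> {1..<q} \<Longrightarrow> comp_mor P G M s (pr k) = comp_mor P G M t (pr (k + 1))"
    and "\<And>(T :: ('x, 'f) gspace) f. \<lbrakk>supermanifold T; \<And>k. k \<in> {1..q} \<Longrightarrow> smorphism T G (f k);
           \<And>k. k \<in> {1..<q} \<Longrightarrow> comp_mor T G M s (f k) = comp_mor T G M t (f (k + 1))\<rbrakk> \<Longrightarrow>
         \<exists>!u. smorphism T P u \<and> (\<forall>k\<in>{1..q}. comp_mor T P G (pr k) u = f k)"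
proof -
  note * = assms[unfolded fibre_power_def Let_def]
  show "supermanifold P" by (rule *[THEN conjunct1, THEN conjunct1])
  show "smorphism P G (pr k)" if "k \<in> {1..q}" for k
    by (rule *[THEN conjunct1, THEN conjunct2, THEN conjunct1, THEN bspec, OF that])
  show "comp_mor P G M s (pr k) = comp_mor P G M t (pr (k + 1))" if "k \<in> {1..<q}" for k
    by (rule *[THEN conjunct1, THEN conjunct2, THEN conjunct2, THEN bspec, OF that])
  show "\<exists>!u. smorphism T P u \<and> (\<forall>k\<in>{1..q}. comp_mor T P G (pr k) u = f k)"
    if "supermanifold T" "\<And>k. k \<in> {1..q} \<Longrightarrow> smorphism T G (f k)"
      "\<And>k. k \<in> {1..<q} \<Longrightarrow> comp_mor T G M s (f k) = comp_mor T G M t (f (k + 1))" for T :: "('x, 'f) gspace" and f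
    by (rule *[THEN conjunct2, THEN spec[of _ T], THEN spec[of _ f], THEN mp]) (use that in blast)
qed

text \<open>If \<open>D\<close> kills the functions pulled back from the factors, then \<open>u\<close> and \<open>u + \<epsilon> D\<close> have the same
  components, so they agree by the universal property.\<close>

lemma derivation_vanishes_odd:
  fixes T P :: "('x, 'f) gspace"
  assumes fp: "fibre_power M G s t q P pr" and T: "supermanifold T" and u: "smorphism T P u"
    and G: "graded_presheaf G" and s: "graded_morphism G M s" and t: "graded_morphism G M t"
    and D: "derivation_along T P u j D" and j: "odd j" and e: "pairing (e :: 'f \<Rightarrow> 'f \<Rightarrow> 'f)"
    and D0: "\<And>k V f. \<lbrakk>k \<in> {1..q}; openin (supp G) V; f \<in> carrier (sect G V)\<rbrakk> \<Longrightarrow>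
       D (preim P (pr k) V) (pull (pr k) V f) = \<zero>\<^bsub>sect T (preim T u (preim P (pr k) V))\<^esub>"
    and V: "openin (supp P) V" and f: "f \<in> carrier (sect P V)"
  shows "D V f = \<zero>\<^bsub>sect T (preim T u V)\<^esub>"
proof -
  note P = fibre_powerD(1)[OF fp] and pr = fibre_powerD(2)[OF fp]
  note T' = supermanifold_presheaf[OF T] and P' = supermanifold_presheaf[OF P]
  note u' = smorphism_graded[OF u] and pr' = smorphism_graded[OF pr]
  let ?E = "ext_space e (- j) T"
  define lift where "lift D = lift_mor e (- j) T P u D" for D
  define g where "g k = lift_mor e (- j) T G (comp_mor T P G (pr k) u) (zero_along T (comp_mor T P G (pr k) u))" for k
  have Z: "derivation_along T P u j (zero_along T u)" by (rule derivation_zero_along[OF T' u'])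
  have lift: "smorphism ?E P (lift D)" if "derivation_along T P u j D" for D
    unfolding lift_def by (rule smorphism_lift[OF T' P' u that j e])
  have comp: "comp_mor ?E P G (pr k) (lift D) = g k"
    if k: "k \<in> {1..q}" and D: "\<And>V f. \<lbrakk>openin (supp G) V; f \<in> carrier (sect G V)\<rbrakk> \<Longrightarrow>
       D (preim P (pr k) V) (pull (pr k) V f) = \<zero>\<^bsub>sect T (preim T u (preim P (pr k) V))\<^esub>" for k D
    unfolding lift_def g_def comp_lift_mor[OF u' pr'[OF k]]
    by (rule lift_mor_cong) (simp add: D zero_along_def preim_comp[OF u'])
  have comp_Z: "comp_mor ?E P G (pr k) (lift (zero_along T u)) = g k" if "k \<in> {1..q}" for k
    by (rule comp[OF that]) (simp add: zero_along_def)
  \<comment> \<open>As components of the lift of the zero derivation, the \<open>g k\<close> inherit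
    smoothness here, and composability in the next step, from the projections
    \<open>pr k\<close>.\<close>
  have gs: "smorphism ?E G (g k)" if "k \<in> {1..q}" for k
    using smorphism_comp[OF lift[OF Z] pr[OF that] G] unfolding comp_Z[OF that] .
  have gst: "comp_mor ?E G M s (g k) = comp_mor ?E G M t (g (k + 1))" if k: "k \<in> {1..<q}" for k
  proof -
    have k': "k \<in> {1..q}" "k + 1 \<in> {1..q}" using k by auto
    have "comp_mor ?E G M s (g k) = comp_mor ?E P M (comp_mor P G M s (pr k)) (lift (zero_along T u))"
      unfolding comp_Z[OF k'(1), symmetric]
      by (rule comp_mor_assoc[symmetric]) (use lift[OF Z] pr'[OF k'(1)] s smorphism_graded in blast)+
    also have "\<dots> = comp_mor ?E P M (comp_mor P G M t (pr (k + 1))) (lift (zero_along T u))"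
      by (simp only: fibre_powerD(3)[OF fp k])
    also have "\<dots> = comp_mor ?E G M t (g (k + 1))"
      unfolding comp_Z[OF k'(2), symmetric]
      by (rule comp_mor_assoc) (use lift[OF Z] pr'[OF k'(2)] t smorphism_graded in blast)+
    finally show ?thesis .
  qed
  have "\<exists>!v. smorphism ?E P v \<and> (\<forall>k\<in>{1..q}. comp_mor ?E P G (pr k) v = g k)"
    using supermanifold_ext[OF T e, of "- j"] j gs gst by (intro fibre_powerD(4)[OF fp]) auto
  then obtain w where w: "\<And>v. smorphism ?E P v \<Longrightarrow> \<forall>k\<in>{1..q}. comp_mor ?E P G (pr k) v = g k \<Longrightarrow> v = w"
    by (elim ex1E) blast
  have "lift D = w" by (rule w[OF lift[OF D]]) (use comp[OF _ D0] in blast)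
  moreover have "lift (zero_along T u) = w" by (rule w[OF lift[OF Z]]) (use comp_Z in blast)
  ultimately have "lift D = lift (zero_along T u)" by simp
  then have "pull (lift D) V f = pull (lift (zero_along T u)) V f" by simp
  then show ?thesis using V f e by (simp add: lift_def zero_along_def)
qed

text \<open>Covers the case in which there is no pairing on the type of sections.\<close>

lemma (in galg) finite_trivial:
  assumes "finite (UNIV :: 'f set)" "x \<in> carrier A"
  shows "x = \<zero>"
proof -
  \<comment> \<open>There are infinitely many real scalars but finitely many multiples of
    \<open>x\<close>, so two scalars agree on \<open>x\<close>, and dividing by their difference
    gives zero.\<close>
  have "\<not> inj (\<lambda>r :: real. r \<odot> x)"
  proof
    assume "inj (\<lambda>r :: real. r \<odot> x)"
    then have "finite (UNIV :: real set)"
      by (rule finite_imageD[rotated]) (rule finite_subset[OF subset_UNIV assms(1)])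
    then show False using infinite_UNIV_char_0 by blast
  qed
  then obtain r s where rs: "r \<noteq> s" "r \<odot> x = s \<odot> x" by (auto simp: inj_def)
  have "(r - s) \<odot> x = r \<odot> x \<oplus> (- s) \<odot> x"
    using smult_add_left[OF assms(2), of r "- s"] by simp
  also have "\<dots> = (s + - s) \<odot> x"
    unfolding rs(2) by (rule smult_add_left[OF assms(2), symmetric])
  finally have "(r - s) \<odot> x = \<zero>" using assms(2) by simp
  then have "(1 / (r - s)) \<odot> ((r - s) \<odot> x) = \<zero>" by simp
  then show ?thesis using assms(2) rs(1) by (simp add: smult_smult)
qed

text \<open>For even \<open>j\<close> the odd case is applied to \<open>\<epsilon> D\<close>, a derivation of degree \<open>j + 1\<close> with values
  in \<open>A[\<epsilon>]\<close>.\<close>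

lemma derivation_vanishes:
  fixes T P :: "('x, 'f) gspace"
  assumes fp: "fibre_power M G s t q P pr" and T: "supermanifold T" and u: "smorphism T P u"
    and G: "graded_presheaf G" and s: "graded_morphism G M s" and t: "graded_morphism G M t"
    and D: "derivation_along T P u j D"
    and D0: "\<And>k V f. \<lbrakk>k \<in> {1..q}; openin (supp G) V; f \<in> carrier (sect G V)\<rbrakk> \<Longrightarrow>
       D (preim P (pr k) V) (pull (pr k) V f) = \<zero>\<^bsub>sect T (preim T u (preim P (pr k) V))\<^esub>"
    and V: "openin (supp P) V" and f: "f \<in> carrier (sect P V)"
  shows "D V f = \<zero>\<^bsub>sect T (preim T u V)\<^esub>"
proof (cases "finite (UNIV :: 'f set)")
  case True
  have "galg (sect T (preim T u V)) (gpart T (preim T u V))"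
    by (rule presheaf_galg[OF supermanifold_presheaf[OF T] openin_preim[OF smorphism_graded[OF u] V]])
  then show ?thesis using galg.finite_trivial[OF _ True] derivation_closed[OF D V f] by blast
next
  case False
  then obtain e :: "'f \<Rightarrow> 'f \<Rightarrow> 'f" where e: "pairing e" using exists_pairing by blast
  show ?thesis
  proof (cases "odd j")
    case True
    show ?thesis by (rule derivation_vanishes_odd[OF fp T u G s t D True e D0 V f])
  next
    case False
    note P = fibre_powerD(1)[OF fp] and pr = fibre_powerD(2)[OF fp]
    note T' = supermanifold_presheaf[OF T] and P' = supermanifold_presheaf[OF P]
    note u' = smorphism_graded[OF u]
    \<comment> \<open>The form \<open>- (- 1)\<close> matches \<open>smorphism_lift\<close> for the
      odd degree \<open>- 1\<close>. So \<epsilon> has degree 1, and pulling back along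
      \<open>?v\<close> is pulling back along \<open>u\<close> followed by the inclusion into
      \<open>A[\<epsilon>]\<close>.\<close>
    let ?E = "ext_space e (- (- 1)) T" and ?v = "lift_mor e (- (- 1)) T P u (zero_along T u)"
    let ?D = "\<lambda>V f. e \<zero>\<^bsub>sect T (preim T u V)\<^esub> (D V f)"
    have v: "smorphism ?E P ?v"
      by (rule smorphism_lift[OF T' P' u derivation_zero_along[OF T' u'] _ e]) simp
    have E: "supermanifold ?E" by (rule supermanifold_ext[OF T e]) simp
    have D1: "derivation_along ?E P ?v (j + 1) ?D"
      unfolding derivation_along_def Let_def preim_lift
    proof (intro conjI allI impI ballI funcsetI; (elim conjE)?)
      fix U V f assume UV: "openin (supp P) U" "openin (supp P) V" "V \<subseteq> U" and f: "f \<in> carrier (sect P U)"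
      have "res T (preim T u U) (preim T u V) \<zero>\<^bsub>sect T (preim T u U)\<^esub> = \<zero>\<^bsub>sect T (preim T u V)\<^esub>"
        using UV by (intro graded_hom_zero[OF presheaf_res_hom[OF T'] presheaf_galg[OF T'] presheaf_galg[OF T']]
            openin_preim[OF u'] preim_mono)
      then show "?D V (res P U V f) = res ?E (preim T u U) (preim T u V) (?D U f)"
        using derivation_res[OF D UV f] by (simp add: e)
    next
      fix V assume V: "openin (supp P) V"
      interpret galg_ext "sect T (preim T u V)" "gpart T (preim T u V)" e "1"
        by (intro galg_ext.intro galg_ext_axioms.intro e presheaf_galg[OF T' openin_preim[OF u' V]])
      note c = derivation_closed[OF D V] pull_closed[OF u' V]
      show "?D V f \<in> carrier (sect ?E (preim T u V))" if "f \<in> carrier (sect P V)" for f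
        using c that by (simp add: e)
      show "?D V (f \<oplus>\<^bsub>sect P V\<^esub> g) = ?D V f \<oplus>\<^bsub>sect ?E (preim T u V)\<^esub> ?D V g"
        if "f \<in> carrier (sect P V)" "g \<in> carrier (sect P V)" for f g
        using c that derivation_add[OF D V] by (simp add: e)
      show "?D V (r \<odot>\<^bsub>sect P V\<^esub> f) = r \<odot>\<^bsub>sect ?E (preim T u V)\<^esub> ?D V f"
        if "f \<in> carrier (sect P V)" for r f
        using c that derivation_smult[OF D V] by (simp add: e)
      show "?D V ` gpart P V k \<subseteq> gpart ?E (preim T u V) (k + (j + 1))" for k
        using derivation_part[OF D V, of _ k] by (auto simp: ext_part_def e add.assoc)
      interpret P: galg "sect P V" "gpart P V" by (rule presheaf_galg[OF P' V])
      show "?D V (f \<otimes>\<^bsub>sect P V\<^esub> g) = ?D V f \<otimes>\<^bsub>sect ?E (preim T u V)\<^esub> pull ?v V g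
          \<oplus>\<^bsub>sect ?E (preim T u V)\<^esub> sgn_deg ((j + 1) * k) \<odot>\<^bsub>sect ?E (preim T u V)\<^esub>
            (pull ?v V f \<otimes>\<^bsub>sect ?E (preim T u V)\<^esub> ?D V g)"
        if f: "f \<in> gpart P V k" and g: "g \<in> carrier (sect P V)" for k f g
      proof -
        have f': "f \<in> carrier (sect P V)" using P.part_sub[OF f] .
        have uf: "pull u V f \<in> gpart T (preim T u V) k"
          using graded_morphism_hom[OF u' V] f unfolding graded_hom_def by blast
        \<comment> \<open>\<open>D\<close> of even degree passes \<open>f\<close> without a sign,
          but \<epsilon> passes it with the sign of \<open>k\<close>. The latter is the sign that a
          derivation of odd degree \<open>j + 1\<close> must have.\<close>
        have sg: "sgn_deg (j * k) = 1" "sgn_deg ((j + 1) * k) = sgn_deg k"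
          using False by (cases "even k"; simp add: sgn_deg_even sgn_deg_odd)+
        show ?thesis
          using c f' g uf V
          by (simp add: e zero_along_def derivation_mult[OF D V f g] par_part[OF uf] sg
              smult_mult_left smult_smult)
      qed
    qed
    have D10: "?D (preim P (pr k) V) (pull (pr k) V f) = \<zero>\<^bsub>sect ?E (preim ?E ?v (preim P (pr k) V))\<^esub>"
      if "k \<in> {1..q}" "openin (supp G) V" "f \<in> carrier (sect G V)" for k V f
      using D0[OF that] by simp
    have j1: "odd (j + 1)" using False by simp
    have "?D V f = \<zero>\<^bsub>sect ?E (preim ?E ?v V)\<^esub>"
      by (rule derivation_vanishes_odd[OF fp E v G s t D1 j1 e _ V f]) (rule D10)
    then show ?thesis by (simp add: e)
  qed
qed

section \<open>Vector fields related by a morphism into a fibre power\<close>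

context
  fixes S :: "('x, 'f) gspace" and j \<phi>
  assumes \<phi>: "vector_field S j \<phi>"
begin

lemma vector_field_closed: "\<lbrakk>openin (supp S) U; f \<in> carrier (sect S U)\<rbrakk> \<Longrightarrow> \<phi> U f \<in> carrier (sect S U)"
  and vector_field_add: "\<lbrakk>openin (supp S) U; f \<in> carrier (sect S U); g \<in> carrier (sect S U)\<rbrakk> \<Longrightarrow>
      \<phi> U (f \<oplus>\<^bsub>sect S U\<^esub> g) = \<phi> U f \<oplus>\<^bsub>sect S U\<^esub> \<phi> U g"
  and vector_field_smult: "\<lbrakk>openin (supp S) U; f \<in> carrier (sect S U)\<rbrakk> \<Longrightarrow>
      \<phi> U (r \<odot>\<^bsub>sect S U\<^esub> f) = r \<odot>\<^bsub>sect S U\<^esub> \<phi> U f"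
  and vector_field_part: "\<lbrakk>openin (supp S) U; f \<in> gpart S U k\<rbrakk> \<Longrightarrow> \<phi> U f \<in> gpart S U (k + j)"
  and vector_field_mult: "\<lbrakk>openin (supp S) U; f \<in> gpart S U k; g \<in> carrier (sect S U)\<rbrakk> \<Longrightarrow>
      \<phi> U (f \<otimes>\<^bsub>sect S U\<^esub> g) = \<phi> U f \<otimes>\<^bsub>sect S U\<^esub> g
        \<oplus>\<^bsub>sect S U\<^esub> sgn_deg (j * k) \<odot>\<^bsub>sect S U\<^esub> (f \<otimes>\<^bsub>sect S U\<^esub> \<phi> U g)"
  and vector_field_res: "\<lbrakk>openin (supp S) U; openin (supp S) V; V \<subseteq> U; f \<in> carrier (sect S U)\<rbrakk> \<Longrightarrow>
      \<phi> V (res S U V f) = res S U V (\<phi> U f)"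
proof -
  note \<phi>U = \<phi>[unfolded vector_field_def Let_def sgn_deg_def[symmetric], THEN conjunct1, THEN spec, THEN mp]
  show "\<lbrakk>openin (supp S) U; f \<in> carrier (sect S U)\<rbrakk> \<Longrightarrow> \<phi> U f \<in> carrier (sect S U)"
    using \<phi>U[THEN conjunct1] by (rule funcset_mem)
  show "\<lbrakk>openin (supp S) U; f \<in> carrier (sect S U); g \<in> carrier (sect S U)\<rbrakk> \<Longrightarrow>
      \<phi> U (f \<oplus>\<^bsub>sect S U\<^esub> g) = \<phi> U f \<oplus>\<^bsub>sect S U\<^esub> \<phi> U g"
    using \<phi>U[THEN conjunct2, THEN conjunct1] by blast
  show "\<lbrakk>openin (supp S) U; f \<in> carrier (sect S U)\<rbrakk> \<Longrightarrow> \<phi> U (r \<odot>\<^bsub>sect S U\<^esub> f) = r \<odot>\<^bsub>sect S U\<^esub> \<phi> U f"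
    using \<phi>U[THEN conjunct2, THEN conjunct2, THEN conjunct1] by blast
  show "\<lbrakk>openin (supp S) U; f \<in> gpart S U k\<rbrakk> \<Longrightarrow> \<phi> U f \<in> gpart S U (k + j)"
    using \<phi>U[THEN conjunct2, THEN conjunct2, THEN conjunct2, THEN conjunct1] by blast
  show "\<lbrakk>openin (supp S) U; f \<in> gpart S U k; g \<in> carrier (sect S U)\<rbrakk> \<Longrightarrow>
      \<phi> U (f \<otimes>\<^bsub>sect S U\<^esub> g) = \<phi> U f \<otimes>\<^bsub>sect S U\<^esub> g
        \<oplus>\<^bsub>sect S U\<^esub> sgn_deg (j * k) \<odot>\<^bsub>sect S U\<^esub> (f \<otimes>\<^bsub>sect S U\<^esub> \<phi> U g)"
    using \<phi>U[THEN conjunct2, THEN conjunct2, THEN conjunct2, THEN conjunct2] by blast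
  show "\<lbrakk>openin (supp S) U; openin (supp S) V; V \<subseteq> U; f \<in> carrier (sect S U)\<rbrakk> \<Longrightarrow>
      \<phi> V (res S U V f) = res S U V (\<phi> U f)"
    using \<phi>[unfolded vector_field_def, THEN conjunct2] by blast
qed

end

lemma (in galg) smult_neg: "x \<in> carrier A \<Longrightarrow> r \<odot> (\<ominus> x) = \<ominus> (r \<odot> x)"
  by (simp add: smult_smult flip: smult_minus_one)

text \<open>Pulling back after \<open>\<theta>\<close> and applying \<open>\<phi>\<close> after
  pulling back are derivations along \<open>\<mu>\<close> with the same sign rule, so their
  difference is one as well. It measures how far \<open>\<phi>\<close> and \<open>\<theta>\<close>
  are from being related.\<close>

lemma derivation_related_defect:
  assumes S: "graded_presheaf S" and Y: "graded_presheaf Y" and \<mu>: "graded_morphism S Y \<mu>"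
    and \<phi>: "vector_field S j \<phi>" and \<theta>: "vector_field Y j \<theta>"
  shows "derivation_along S Y \<mu> j
     (\<lambda>V f. pull \<mu> V (\<theta> V f) \<ominus>\<^bsub>sect S (preim S \<mu> V)\<^esub> \<phi> (preim S \<mu> V) (pull \<mu> V f))" (is "derivation_along S Y \<mu> j ?D")
  unfolding derivation_along_def Let_def
proof (intro conjI allI impI ballI funcsetI; (elim conjE)?)
  fix U V f assume UV: "openin (supp Y) U" "openin (supp Y) V" "V \<subseteq> U" and f: "f \<in> carrier (sect Y U)"
  note W = openin_preim[OF \<mu> UV(1)] openin_preim[OF \<mu> UV(2)] preim_mono[OF UV(3)]
  note c = pull_closed[OF \<mu> UV(1) f] pull_closed[OF \<mu> UV(1) vector_field_closed[OF \<theta> UV(1) f]]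
  show "?D V (res Y U V f) = res S (preim S \<mu> U) (preim S \<mu> V) (?D U f)"
    unfolding vector_field_res[OF \<theta> UV f] graded_morphism_res[OF \<mu> UV f] vector_field_res[OF \<phi> W c(1)]
      graded_morphism_res[OF \<mu> UV vector_field_closed[OF \<theta> UV(1) f]]
    by (rule graded_hom_minus[symmetric, OF presheaf_res_hom[OF S W] presheaf_galg[OF S W(1)]
        presheaf_galg[OF S W(2)] c(2) vector_field_closed[OF \<phi> W(1) c(1)]])
next
  fix V assume V: "openin (supp Y) V"
  let ?W = "preim S \<mu> V"
  have W: "openin (supp S) ?W" by (rule openin_preim[OF \<mu> V])
  interpret galg "sect S ?W" "gpart S ?W" by (rule presheaf_galg[OF S W])
  interpret Y: galg "sect Y V" "gpart Y V" by (rule presheaf_galg[OF Y V])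
  have h: "pull \<mu> V \<in> ring_hom (sect Y V) (sect S ?W)"
    "\<And>r x. x \<in> carrier (sect Y V) \<Longrightarrow> pull \<mu> V (r \<odot>\<^bsub>sect Y V\<^esub> x) = r \<odot>\<^bsub>sect S ?W\<^esub> pull \<mu> V x"
    "\<And>k x. x \<in> gpart Y V k \<Longrightarrow> pull \<mu> V x \<in> gpart S ?W k"
    using graded_morphism_hom[OF \<mu> V] unfolding graded_hom_def by blast+
  note hs = ring_hom_add[OF h(1)] ring_hom_mult[OF h(1)] h(2)
  note c = pull_closed[OF \<mu> V] vector_field_closed[OF \<theta> V] vector_field_closed[OF \<phi> W]
  show "?D V f \<in> carrier (sect S ?W)" if "f \<in> carrier (sect Y V)" for f
    using c that by simp
  show "?D V (f \<oplus>\<^bsub>sect Y V\<^esub> g) = ?D V f \<oplus>\<^bsub>sect S ?W\<^esub> ?D V g"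
    if "f \<in> carrier (sect Y V)" "g \<in> carrier (sect Y V)" for f g
    using c that vector_field_add[OF \<theta> V] vector_field_add[OF \<phi> W]
    by (simp add: hs a_minus_def minus_add a_ac)
  show "?D V (r \<odot>\<^bsub>sect Y V\<^esub> f) = r \<odot>\<^bsub>sect S ?W\<^esub> ?D V f"
    if "f \<in> carrier (sect Y V)" for r f
    using c that vector_field_smult[OF \<theta> V] vector_field_smult[OF \<phi> W]
    by (simp add: hs a_minus_def smult_add_right smult_neg)
  show "?D V ` gpart Y V k \<subseteq> gpart S ?W (k + j)" for k
  proof (rule image_subsetI)
    fix f assume "f \<in> gpart Y V k"
    then have "pull \<mu> V (\<theta> V f) \<in> gpart S ?W (k + j)" "\<phi> ?W (pull \<mu> V f) \<in> gpart S ?W (k + j)"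
      using h(3) vector_field_part[OF \<theta> V] vector_field_part[OF \<phi> W] by blast+
    then show "?D V f \<in> gpart S ?W (k + j)" by (simp add: a_minus_def part_add part_neg)
  qed
  show "?D V (f \<otimes>\<^bsub>sect Y V\<^esub> g) = ?D V f \<otimes>\<^bsub>sect S ?W\<^esub> pull \<mu> V g
      \<oplus>\<^bsub>sect S ?W\<^esub> sgn_deg (j * k) \<odot>\<^bsub>sect S ?W\<^esub> (pull \<mu> V f \<otimes>\<^bsub>sect S ?W\<^esub> ?D V g)"
    if f: "f \<in> gpart Y V k" and g: "g \<in> carrier (sect Y V)" for k f g
  proof -
    note f' = Y.part_sub[OF f]
    show ?thesis
      using c f' g
      by (simp add: vector_field_mult[OF \<theta> V f g] hs vector_field_mult[OF \<phi> W h(3)[OF f] c(1)[OF g]]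
          a_minus_def minus_add l_distr r_distr smult_add_right smult_neg l_minus r_minus a_ac)
  qed
qed

lemma related_comp:
  assumes u: "graded_morphism T P u" and g: "graded_morphism P G g"
    and \<theta>\<psi>: "related P G g \<theta> \<psi>" and \<phi>\<theta>: "related T P u \<phi> \<theta>" and \<psi>: "vector_field G j \<psi>"
  shows "related T G (comp_mor T P G g u) \<phi> \<psi>"
  unfolding related_def
proof (intro allI impI ballI)
  fix V f assume V: "openin (supp G) V" and f: "f \<in> carrier (sect G V)"
  have "pull u (preim P g V) (pull g V (\<psi> V f)) = pull u (preim P g V) (\<theta> (preim P g V) (pull g V f))"
    using \<theta>\<psi> V f by (simp add: related_def)
  also have "\<dots> = \<phi> (preim T u (preim P g V)) (pull u (preim P g V) (pull g V f))"
    using \<phi>\<theta> openin_preim[OF g V] pull_closed[OF g V f] by (simp add: related_def)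
  finally show "pull (comp_mor T P G g u) V (\<psi> V f) =
      \<phi> (preim T (comp_mor T P G g u) V) (pull (comp_mor T P G g u) V f)"
    using V f vector_field_closed[OF \<psi> V f] by (simp add: preim_comp[OF u])
qed

text \<open>Relatedness can be tested on components: \<open>\<theta>\<psi>\<close> and
  \<open>\<phi>\<psi>\<close> say that the defect is zero on functions pulled back from the factors,
  and \<open>derivation_vanishes\<close> does the rest.\<close>

lemma related_fibre_power:
  fixes T P :: "('x, 'f) gspace"
  assumes fp: "fibre_power M G s t q P pr" and T: "supermanifold T" and u: "smorphism T P u"
    and G: "graded_presheaf G" and s: "graded_morphism G M s" and t: "graded_morphism G M t"
    and \<phi>: "vector_field T j \<phi>" and \<theta>: "vector_field P j \<theta>" and \<psi>: "vector_field G j \<psi>"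
    and \<theta>\<psi>: "\<And>k. k \<in> {1..q} \<Longrightarrow> related P G (pr k) \<theta> \<psi>"
    and \<phi>\<psi>: "\<And>k. k \<in> {1..q} \<Longrightarrow> related T G (comp_mor T P G (pr k) u) \<phi> \<psi>"
  shows "related T P u \<phi> \<theta>"
  unfolding related_def
proof (intro allI impI ballI)
  fix V f assume V: "openin (supp P) V" and f: "f \<in> carrier (sect P V)"
  note T' = supermanifold_presheaf[OF T] and P' = supermanifold_presheaf[OF fibre_powerD(1)[OF fp]]
  note u' = smorphism_graded[OF u] and pr' = smorphism_graded[OF fibre_powerD(2)[OF fp]]
  let ?D = "\<lambda>V f. pull u V (\<theta> V f) \<ominus>\<^bsub>sect T (preim T u V)\<^esub> \<phi> (preim T u V) (pull u V f)"
  have cl: "pull u V (\<theta> V f) \<in> carrier (sect T (preim T u V))"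
      "\<phi> (preim T u V) (pull u V f) \<in> carrier (sect T (preim T u V))"
    if "openin (supp P) V" "f \<in> carrier (sect P V)" for V f
    using that vector_field_closed[OF \<theta>] vector_field_closed[OF \<phi>] pull_closed[OF u'] openin_preim[OF u'] by blast+
  have zero_iff: "?D V f = \<zero>\<^bsub>sect T (preim T u V)\<^esub> \<longleftrightarrow> pull u V (\<theta> V f) = \<phi> (preim T u V) (pull u V f)"
    if "openin (supp P) V" "f \<in> carrier (sect P V)" for V f
  proof -
    interpret galg "sect T (preim T u V)" "gpart T (preim T u V)"
      by (rule presheaf_galg[OF T' openin_preim[OF u' that(1)]])
    show ?thesis using cl[OF that] r_right_minus_eq by blast
  qed
  have D0: "?D (preim P (pr k) V) (pull (pr k) V f) = \<zero>\<^bsub>sect T (preim T u (preim P (pr k) V))\<^esub>"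
    if k: "k \<in> {1..q}" and V: "openin (supp G) V" and f: "f \<in> carrier (sect G V)" for k V f
  proof -
    have "\<theta> (preim P (pr k) V) (pull (pr k) V f) = pull (pr k) V (\<psi> V f)"
      using \<theta>\<psi>[OF k] V f by (simp add: related_def)
    then have "pull u (preim P (pr k) V) (\<theta> (preim P (pr k) V) (pull (pr k) V f)) =
        pull (comp_mor T P G (pr k) u) V (\<psi> V f)"
      using V vector_field_closed[OF \<psi> V f] by simp
    also have "\<dots> = \<phi> (preim T u (preim P (pr k) V)) (pull u (preim P (pr k) V) (pull (pr k) V f))"
      using \<phi>\<psi>[OF k] V f by (simp add: related_def preim_comp[OF u'])
    finally show ?thesis
      using zero_iff[OF openin_preim[OF pr'[OF k] V] pull_closed[OF pr'[OF k] V f]] by blast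
  qed
  have "?D V f = \<zero>\<^bsub>sect T (preim T u V)\<^esub>"
    by (rule derivation_vanishes[OF fp T u G s t derivation_related_defect[OF T' P' u' \<phi> \<theta>] _ V f]) (rule D0)
  then show "pull u V (\<theta> V f) = \<phi> (preim T u V) (pull u V f)" using zero_iff[OF V f] by blast
qed

section \<open>The nerve of a Lie supergroupoid\<close>

context
  fixes \<G> :: "('x, 'f) groupoid_data"
  assumes grp: "lie_supergroupoid \<G>"
begin

private abbreviation (input) "M \<equiv> obj \<G>"
private abbreviation (input) "G \<equiv> arr \<G>"
private abbreviation (input) "N \<equiv> nerve \<G>"
private abbreviation (input) "pr \<equiv> prj \<G>"

lemma supermanifold_obj: "supermanifold M"
  and supermanifold_arr: "supermanifold G"
  and nerve_0: "N 0 = M" and nerve_1: "N (Suc 0) = G"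
  and prj_1: "pr (Suc 0) (Suc 0) = id_mor G"
  and nerve_fibre_power: "2 \<le> q \<Longrightarrow> fibre_power M G (src \<G>) (tgt \<G>) q (N q) (pr q)"
  and smorphism_src: "smorphism G M (src \<G>)" and smorphism_tgt: "smorphism G M (tgt \<G>)"
  and smorphism_mlt: "smorphism (N 2) G (mlt \<G>)"
  and src_mlt: "comp_mor (N 2) G M (src \<G>) (mlt \<G>) = comp_mor (N 2) G M (src \<G>) (pr 2 2)"
  and tgt_mlt: "comp_mor (N 2) G M (tgt \<G>) (mlt \<G>) = comp_mor (N 2) G M (tgt \<G>) (pr 2 1)"
  using grp unfolding lie_supergroupoid_def Let_def surjective_submersion_def submersion_def One_nat_def
  by meson+

lemma presheaf_arr: "graded_presheaf G"
  by (rule supermanifold_presheaf[OF supermanifold_arr])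

lemmas graded_src = smorphism_graded[OF smorphism_src]
lemmas graded_tgt = smorphism_graded[OF smorphism_tgt]

lemma supermanifold_nerve: "supermanifold (N q)"
proof -
  consider "q = 0" | "q = Suc 0" | "2 \<le> q" by linarith
  then show ?thesis
    using supermanifold_obj supermanifold_arr nerve_0 nerve_1 fibre_powerD(1)[OF nerve_fibre_power]
    by cases auto
qed

lemma presheaf_nerve: "graded_presheaf (N q)"
  by (rule supermanifold_presheaf[OF supermanifold_nerve])

text \<open>The condition on a cone in \<open>fibre_power\<close>. For \<open>q = 1\<close> its
  second half is empty, so single morphisms to the space of arrows are included.\<close>

definition composable :: "nat \<Rightarrow> ('x, 'f) gspace \<Rightarrow> (nat \<Rightarrow> ('x, 'f, 'x, 'f) gmor) \<Rightarrow> bool" where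
  "composable q T f \<longleftrightarrow> (\<forall>k\<in>{1..q}. smorphism T G (f k)) \<and>
     (\<forall>k\<in>{1..<q}. comp_mor T G M (src \<G>) (f k) = comp_mor T G M (tgt \<G>) (f (k + 1)))"

lemma composable_prj: "2 \<le> q \<Longrightarrow> composable q (N q) (pr q)"
  unfolding composable_def
  using fibre_powerD(2,3)[OF nerve_fibre_power] by blast

lemma tuple_mor:
  assumes q: "1 \<le> q" and T: "supermanifold T" and f: "composable q T f"
  shows "smorphism T (N q) (tuple_mor \<G> q T f)"
    and "k \<in> {1..q} \<Longrightarrow> comp_mor T (N q) G (pr q k) (tuple_mor \<G> q T f) = f k"
proof -
  have "\<exists>!u. smorphism T (N q) u \<and> (\<forall>k\<in>{1..q}. comp_mor T (N q) G (pr q k) u = f k)"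
  proof (cases "q = 1")
    \<comment> \<open>Fibre powers are given for \<open>q \<ge> 2\<close>. With a single factor the
      projection is the identity, and the tuple is its only component.\<close>
    case True
    have id: "comp_mor T G G (id_mor G) u = u" if "smorphism T G u" for u
      by (rule comp_id_mor[OF smorphism_graded[OF that]])
    have "smorphism T G (f 1)" using f True by (simp add: composable_def)
    then show ?thesis
      using id by (intro ex1I[of _ "f 1"]) (auto simp: True nerve_1 prj_1)
  next
    case False
    then have q2: "2 \<le> q" using q by simp
    show ?thesis
      by (rule fibre_powerD(4)[OF nerve_fibre_power[OF q2] T]) (use f in \<open>auto simp: composable_def\<close>)
  qed
  from theI'[OF this]
  have "smorphism T (N q) (tuple_mor \<G> q T f) \<and>
      (\<forall>k\<in>{1..q}. comp_mor T (N q) G (pr q k) (tuple_mor \<G> q T f) = f k)"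
    unfolding tuple_mor_def .
  then show "smorphism T (N q) (tuple_mor \<G> q T f)"
    and "k \<in> {1..q} \<Longrightarrow> comp_mor T (N q) G (pr q k) (tuple_mor \<G> q T f) = f k"
    by blast+
qed

lemma related_tuple:
  assumes q: "1 \<le> q" and T: "supermanifold T" and f: "composable q T f"
    and \<phi>: "vector_field T j \<phi>" and \<theta>: "vector_field (N q) j \<theta>" and \<psi>: "vector_field G j \<psi>"
    and 1: "q = 1 \<Longrightarrow> \<theta> = \<psi>"
    and \<theta>\<psi>: "\<And>k. k \<in> {1..q} \<Longrightarrow> related (N q) G (pr q k) \<theta> \<psi>"
    and \<phi>\<psi>: "\<And>k. k \<in> {1..q} \<Longrightarrow> related T G (f k) \<phi> \<psi>"
  shows "related T (N q) (tuple_mor \<G> q T f) \<phi> \<theta>"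
proof (cases "q = 1")
  case True
  have "tuple_mor \<G> q T f = comp_mor T G G (id_mor G) (tuple_mor \<G> q T f)"
    by (rule comp_id_mor[OF smorphism_graded, symmetric])
      (use tuple_mor(1)[OF q T f] in \<open>simp add: True nerve_1\<close>)
  also have "\<dots> = f 1"
    using tuple_mor(2)[OF q T f, of 1] by (simp add: True nerve_1 prj_1)
  finally show ?thesis using \<phi>\<psi>[of 1] 1 True by (simp add: nerve_1)
next
  case False
  then have q2: "2 \<le> q" using q by simp
  show ?thesis
  proof (rule related_fibre_power[OF nerve_fibre_power[OF q2] T tuple_mor(1)[OF q T f] presheaf_arr
        graded_src graded_tgt \<phi> \<theta> \<psi> \<theta>\<psi>])
    show "related T G (comp_mor T (N q) G (pr q k) (tuple_mor \<G> q T f)) \<phi> \<psi>" if "k \<in> {1..q}" for k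
      unfolding tuple_mor(2)[OF q T f that] by (rule \<phi>\<psi>[OF that])
  qed
qed

text \<open>The source of a product is that of its second factor and the target that of its first,
  which keeps a tuple composable when two neighbours are multiplied. For relatedness, the morphism
  into composable pairs relates \<open>\<phi>\<close> to the field that
  \<open>multiplicative\<close> provides there, and composing with \<open>mlt\<close> leads to
  \<open>\<psi>\<close>.\<close>

lemma mult_mor:
  assumes T: "supermanifold T" and g: "smorphism T G g" and h: "smorphism T G h"
    and gh: "comp_mor T G M (src \<G>) g = comp_mor T G M (tgt \<G>) h"
  shows "smorphism T G (mult_mor \<G> T g h)"
    and "comp_mor T G M (src \<G>) (mult_mor \<G> T g h) = comp_mor T G M (src \<G>) h"
    and "comp_mor T G M (tgt \<G>) (mult_mor \<G> T g h) = comp_mor T G M (tgt \<G>) g"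
    and "\<lbrakk>multiplicative \<G> j \<psi>; vector_field T j \<phi>; related T G g \<phi> \<psi>; related T G h \<phi> \<psi>\<rbrakk> \<Longrightarrow>
      related T G (mult_mor \<G> T g h) \<phi> \<psi>"
proof -
  let ?f = "\<lambda>j :: nat. if j = 1 then g else h"
  let ?u = "tuple_mor \<G> 2 T ?f"
  have f: "composable 2 T ?f" using g h gh by (auto simp: composable_def)
  have u: "smorphism T (N 2) ?u" by (rule tuple_mor(1)[OF _ T f]) simp
  have u1: "comp_mor T (N 2) G (pr 2 1) ?u = g" and u2: "comp_mor T (N 2) G (pr 2 2) ?u = h"
    using tuple_mor(2)[OF _ T f, of 1] tuple_mor(2)[OF _ T f, of 2] by simp_all
  note gu = smorphism_graded[OF u] and gm = smorphism_graded[OF smorphism_mlt]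
  have gp: "graded_morphism (N 2) G (pr 2 k)" if "k \<in> {1..2}" for k
    by (rule smorphism_graded) (use composable_prj[of 2] that in \<open>simp add: composable_def\<close>)
  show "smorphism T G (mult_mor \<G> T g h)"
    unfolding mult_mor_def by (rule smorphism_comp[OF u smorphism_mlt presheaf_arr])
  have "comp_mor T G M (src \<G>) (mult_mor \<G> T g h) = comp_mor T (N 2) M (comp_mor (N 2) G M (src \<G>) (mlt \<G>)) ?u"
    unfolding mult_mor_def by (rule comp_mor_assoc[OF gu gm graded_src, symmetric])
  also have "\<dots> = comp_mor T G M (src \<G>) (comp_mor T (N 2) G (pr 2 2) ?u)"
    unfolding src_mlt by (rule comp_mor_assoc[OF gu gp graded_src]) simp
  finally show "comp_mor T G M (src \<G>) (mult_mor \<G> T g h) = comp_mor T G M (src \<G>) h"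
    by (simp only: u2)
  have "comp_mor T G M (tgt \<G>) (mult_mor \<G> T g h) = comp_mor T (N 2) M (comp_mor (N 2) G M (tgt \<G>) (mlt \<G>)) ?u"
    unfolding mult_mor_def by (rule comp_mor_assoc[OF gu gm graded_tgt, symmetric])
  also have "\<dots> = comp_mor T G M (tgt \<G>) (comp_mor T (N 2) G (pr 2 1) ?u)"
    unfolding tgt_mlt by (rule comp_mor_assoc[OF gu gp graded_tgt]) simp
  finally show "comp_mor T G M (tgt \<G>) (mult_mor \<G> T g h) = comp_mor T G M (tgt \<G>) g"
    by (simp only: u1)
  assume \<psi>: "multiplicative \<G> j \<psi>" and \<phi>: "vector_field T j \<phi>"
    and rg: "related T G g \<phi> \<psi>" and rh: "related T G h \<phi> \<psi>"
  obtain \<psi>2 where \<psi>': "vector_field G j \<psi>" and \<psi>2: "vector_field (N 2) j \<psi>2"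
    and r: "related (N 2) G (pr 2 1) \<psi>2 \<psi>" "related (N 2) G (pr 2 2) \<psi>2 \<psi>" "related (N 2) G (mlt \<G>) \<psi>2 \<psi>"
    using \<psi> unfolding multiplicative_def by blast
  have k12: "k = 1 \<or> k = 2" if "k \<in> {1..2}" for k :: nat using that by auto
  have "related T (N 2) ?u \<phi> \<psi>2"
  proof (rule related_tuple[OF _ T f \<phi> \<psi>2 \<psi>'])
    show "related (N 2) G (pr 2 k) \<psi>2 \<psi>" if "k \<in> {1..2}" for k using k12[OF that] r by auto
    show "related T G (?f k) \<phi> \<psi>" if "k \<in> {1..2}" for k using rg rh by auto
  qed simp_all
  then show "related T G (mult_mor \<G> T g h) \<phi> \<psi>"
    unfolding mult_mor_def by (rule related_comp[OF gu gm r(3) _ \<psi>'])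
qed

text \<open>For \<open>q \<ge> 2\<close> a face is a tuple made of projections and at most one
  product, and each of these relates \<open>\<Psi> q\<close> to \<open>\<psi>\<close>. For
  \<open>q = 1\<close> relatedness is part of \<open>induced_fields\<close>.\<close>

lemma face_related:
  assumes \<psi>: "multiplicative \<G> j \<psi>" and \<Psi>: "induced_fields \<G> j \<psi> \<Psi>"
    and q: "1 \<le> q" and i: "i \<le> q"
  shows "smorphism (N q) (N (q - 1)) (face \<G> q i) \<and>
    related (N q) (N (q - 1)) (face \<G> q i) (\<Psi> q) (\<Psi> (q - 1))"
proof (cases "q = 1")
  case True
  have "related G M (src \<G>) \<psi> (\<Psi> 0)" "related G M (tgt \<G>) \<psi> (\<Psi> 0)" "\<Psi> 1 = \<psi>"
    using \<Psi> unfolding induced_fields_def by blast+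
  then show ?thesis
    using smorphism_src smorphism_tgt by (simp add: True face_def nerve_0 nerve_1)
next
  case False
  then have q2: "2 \<le> q" and q1: "1 \<le> q - 1" using q by auto
  have vf: "vector_field (N r) j (\<Psi> r)" for r using \<Psi> unfolding induced_fields_def by blast
  have \<psi>': "vector_field G j \<psi>" using \<psi> unfolding multiplicative_def by blast
  have rel: "related (N r) G (pr r k) (\<Psi> r) \<psi>" if "k \<in> {1..r}" for r k
    using \<Psi> that unfolding induced_fields_def by auto
  have prs: "smorphism (N q) G (pr q k)" if "k \<in> {1..q}" for k
    using composable_prj[OF q2] that by (simp add: composable_def)
  have prc: "comp_mor (N q) G M (src \<G>) (pr q k) = comp_mor (N q) G M (tgt \<G>) (pr q (Suc k))"
    if "k \<in> {1..<q}" for k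
    using composable_prj[OF q2] that by (simp add: composable_def)
  have *: ?thesis if face: "face \<G> q i = tuple_mor \<G> (q - 1) (N q) f"
    and f: "composable (q - 1) (N q) f"
    and r: "\<And>k. k \<in> {1..q - 1} \<Longrightarrow> related (N q) G (f k) (\<Psi> q) \<psi>" for f
  proof
    show "smorphism (N q) (N (q - 1)) (face \<G> q i)"
      unfolding face by (rule tuple_mor(1)[OF q1 supermanifold_nerve f])
    show "related (N q) (N (q - 1)) (face \<G> q i) (\<Psi> q) (\<Psi> (q - 1))"
      unfolding face
    proof (rule related_tuple[OF q1 supermanifold_nerve f vf vf \<psi>'])
      \<comment> \<open>The case \<open>q = 2\<close>, in which the face lands in the space of
        arrows itself.\<close>
      show "\<Psi> (q - 1) = \<psi>" if "q - 1 = 1"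
        unfolding that using \<Psi> unfolding induced_fields_def by blast
    qed (use rel r in blast)+
  qed
  consider "i = 0" | "i = q" | "0 < i" "i < q" using i by linarith
  then show ?thesis
  proof cases
    case 1
    show ?thesis
    proof (rule *)
      show "face \<G> q i = tuple_mor \<G> (q - 1) (N q) (\<lambda>k. pr q (k + 1))"
        using False by (simp add: face_def 1)
      show "composable (q - 1) (N q) (\<lambda>k. pr q (k + 1))"
        unfolding composable_def by (auto intro!: prs prc)
      show "related (N q) G (pr q (k + 1)) (\<Psi> q) \<psi>" if "k \<in> {1..q - 1}" for k
        using that by (intro rel) auto
    qed
  next
    case 2
    show ?thesis
    proof (rule *)
      show "face \<G> q i = tuple_mor \<G> (q - 1) (N q) (pr q)"
        using False q by (simp add: face_def 2)
      show "composable (q - 1) (N q) (pr q)"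
        unfolding composable_def by (auto intro!: prs prc)
      show "related (N q) G (pr q k) (\<Psi> q) \<psi>" if "k \<in> {1..q - 1}" for k
        using that by (intro rel) auto
    qed
  next
    case 3
    let ?m = "mult_mor \<G> (N q) (pr q i) (pr q (i + 1))"
    let ?f = "\<lambda>j. if j < i then pr q j else if j = i then ?m else pr q (j + 1)"
    have i1: "i \<in> {1..q}" "i + 1 \<in> {1..q}" "i \<in> {1..<q}" using 3 by auto
    note m = mult_mor[OF supermanifold_nerve prs[OF i1(1)] prs[OF i1(2)] prc[OF i1(3), unfolded Suc_eq_plus1]]
    show ?thesis
    proof (rule *)
      show "face \<G> q i = tuple_mor \<G> (q - 1) (N q) ?f"
        using 3 by (simp add: face_def Let_def)
      have "smorphism (N q) G (?f k)" if "k \<in> {1..q - 1}" for k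
        using that prs m(1) by auto
      moreover have "comp_mor (N q) G M (src \<G>) (?f k) = comp_mor (N q) G M (tgt \<G>) (?f (k + 1))"
        if k: "k \<in> {1..<q - 1}" for k
      proof -
        \<comment> \<open>Before the product nothing changes. At its left end its target is that of
          \<open>pr q i\<close>, at its right end its source is that of \<open>pr q (i + 1)\<close>,
          and beyond it all indices are shifted by one.\<close>
        consider "k + 1 < i" | "k + 1 = i" | "k = i" | "i < k" by linarith
        then show ?thesis
        proof cases
          case 1
          then show ?thesis using prc[of k] k by auto
        next
          case 2
          then show ?thesis using prc[of k] k m(3) by auto
        next
          case 3
          then show ?thesis using prc[of "Suc k"] k m(2) by auto
        next
          case 4
          then show ?thesis using prc[of "Suc k"] k by auto
        qed
      qed
      ultimately show "composable (q - 1) (N q) ?f" unfolding composable_def by blast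
      show "related (N q) G (?f k) (\<Psi> q) \<psi>" if k: "k \<in> {1..q - 1}" for k
      proof -
        have "related (N q) G ?m (\<Psi> q) \<psi>"
          by (rule m(4)[OF \<psi> vf rel[OF i1(1)] rel[OF i1(2)]])
        moreover have "related (N q) G (pr q k) (\<Psi> q) \<psi>" "related (N q) G (pr q (k + 1)) (\<Psi> q) \<psi>"
          using k by (auto intro!: rel)
        ultimately show ?thesis by simp
      qed
    qed
  qed
qed

end

section \<open>The coboundary operator\<close>

lemma vector_field_finsum:
  assumes S: "graded_presheaf S" and \<phi>: "vector_field S j \<phi>" and U: "openin (supp S) U"
    and I: "finite I" and h: "\<And>i. i \<in> I \<Longrightarrow> h i \<in> carrier (sect S U)"
  shows "\<phi> U (finsum (sect S U) h I) = finsum (sect S U) (\<lambda>i. \<phi> U (h i)) I"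
proof -
  interpret galg "sect S U" "gpart S U" by (rule presheaf_galg[OF S U])
  have "\<phi> U \<zero>\<^bsub>sect S U\<^esub> = \<zero>\<^bsub>sect S U\<^esub>"
    using vector_field_smult[OF \<phi> U, of "\<zero>\<^bsub>sect S U\<^esub>" 0] vector_field_closed[OF \<phi> U] by simp
  with I h show ?thesis
    by (induct I) (simp_all add: finsum_insert vector_field_add[OF \<phi> U] vector_field_closed[OF \<phi> U] Pi_def)
qed

theorem proposition4p1p3:
  fixes \<G> :: "('x, 'f) groupoid_data"
    and j :: int
    and \<psi> :: "'x set \<Rightarrow> 'f \<Rightarrow> 'f"
    and \<Psi> :: "nat \<Rightarrow> 'x set \<Rightarrow> 'f \<Rightarrow> 'f"
  assumes "lie_supergroupoid \<G>"
    and "multiplicative \<G> j \<psi>"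
    and "induced_fields \<G> j \<psi> \<Psi>"
  shows "\<forall>q\<ge>1. \<forall>f\<in>carrier (global_sections (nerve \<G> (q - 1))).
           \<Psi> q (topspace (supp (nerve \<G> q))) (coboundary \<G> q f) =
           coboundary \<G> q (\<Psi> (q - 1) (topspace (supp (nerve \<G> (q - 1)))) f)"
proof (intro allI impI ballI)
  fix q f assume q: "1 \<le> q" and f: "f \<in> carrier (global_sections (nerve \<G> (q - 1)))"
  let ?X = "topspace (supp (nerve \<G> q))" and ?Y = "topspace (supp (nerve \<G> (q - 1)))"
  let ?A = "sect (nerve \<G> q) ?X"
  have X: "openin (supp (nerve \<G> q)) ?X" and Y: "openin (supp (nerve \<G> (q - 1))) ?Y" by simp_all
  have f': "f \<in> carrier (sect (nerve \<G> (q - 1)) ?Y)" using f by (simp add: global_sections_def)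
  have vf: "vector_field (nerve \<G> q) j (\<Psi> q)" using assms(3) unfolding induced_fields_def by blast
  have pS: "graded_presheaf (nerve \<G> q)" by (rule presheaf_nerve[OF assms(1)])
  interpret galg ?A "gpart (nerve \<G> q) ?X" by (rule presheaf_galg[OF pS X])
  have pc: "pull (face \<G> q i) ?Y f \<in> carrier ?A"
    and pr: "\<Psi> q ?X (pull (face \<G> q i) ?Y f) = pull (face \<G> q i) ?Y (\<Psi> (q - 1) ?Y f)"
    if i: "i \<in> {0..q}" for i
  proof -
    have s: "graded_morphism (nerve \<G> q) (nerve \<G> (q - 1)) (face \<G> q i)"
      and r: "related (nerve \<G> q) (nerve \<G> (q - 1)) (face \<G> q i) (\<Psi> q) (\<Psi> (q - 1))"
      using face_related[OF assms(1-3) q, of i] i smorphism_graded by auto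
    show "pull (face \<G> q i) ?Y f \<in> carrier ?A"
      using pull_closed[OF s Y f'] by (simp only: preim_topspace[OF s])
    show "\<Psi> q ?X (pull (face \<G> q i) ?Y f) = pull (face \<G> q i) ?Y (\<Psi> (q - 1) ?Y f)"
      using r Y f' preim_topspace[OF s] by (simp add: related_def)
  qed
  have "\<Psi> q ?X (coboundary \<G> q f) =
      finsum ?A (\<lambda>i. \<Psi> q ?X ((- 1) ^ i \<odot>\<^bsub>?A\<^esub> pull (face \<G> q i) ?Y f)) {0..q}"
    unfolding coboundary_def global_sections_def
    by (rule vector_field_finsum[OF pS vf X]) (use pc in auto)
  \<comment> \<open>The alternating signs are real scalars, so they pass the vector field without a
    further sign.\<close>
  also have "\<dots> = finsum ?A (\<lambda>i. (- 1) ^ i \<odot>\<^bsub>?A\<^esub> pull (face \<G> q i) ?Y (\<Psi> (q - 1) ?Y f)) {0..q}"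
  proof (rule finsum_cong'[OF refl])
    fix i assume i: "i \<in> {0..q}"
    show "\<Psi> q ?X ((- 1) ^ i \<odot>\<^bsub>?A\<^esub> pull (face \<G> q i) ?Y f) =
        (- 1) ^ i \<odot>\<^bsub>?A\<^esub> pull (face \<G> q i) ?Y (\<Psi> (q - 1) ?Y f)"
      by (simp only: vector_field_smult[OF vf X pc[OF i]] pr[OF i])
  next
    show "(\<lambda>i. (- 1) ^ i \<odot>\<^bsub>?A\<^esub> pull (face \<G> q i) ?Y (\<Psi> (q - 1) ?Y f)) \<in> {0..q} \<rightarrow> carrier ?A"
      by (rule Pi_I) (simp only: pr[symmetric] smult_closed vector_field_closed[OF vf X pc])
  qed
  finally show "\<Psi> q ?X (coboundary \<G> q f) = coboundary \<G> q (\<Psi> (q - 1) ?Y f)"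
    unfolding coboundary_def global_sections_def .
qed

end
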